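(* Assume $\Gamma=\partial\Omega$ to be at least $C^2$ and let $\boldsymbol x\in\Omega$ be a point away from the boundary, with distance $d=\operatorname{dist}(\boldsymbol x,\Gamma)>0$. There exists a positive constant $C$, independent of $s$ (where $\operatorname{Re}s>0$) and of $\boldsymbol\varphi$, such that the pointwise bounds $$\left|(\mathcal S(s)\boldsymbol\varphi)(\boldsymbol x)\right|\le C|s|e^{-d\operatorname{Re}s}\|\boldsymbol\varphi\|_{\boldsymbol L^p(\Gamma)},\qquad \left|(\mathcal D(s)\boldsymbol\varphi)(\boldsymbol x)\right|\le C|s|e^{-d\operatorname{Re}s}\|\boldsymbol\varphi\|_{\boldsymbol L^p(\Gamma)}$$ hold for all $1\le p<\infty$. By density, point evaluations of the potential operators extend to bounded linear operators of the type $\mathcal S_{\boldsymbol x}(s):\boldsymbol L^p(\Gamma)\to\mathbb C^3$ (and likewise for $\mathcal D$), fulfilling the bounds above.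
   Context: $\Omega\subset\mathbb R^3$ is an exterior domain, the complement of one or several bounded domains, with boundary $\Gamma=\partial\Omega$. For $s\in\mathbb C$ with $\operatorname{Re}s>0$, the fundamental solution is $G(s,\boldsymbol x)=e^{-s|\boldsymbol x|}/(4\pi|\boldsymbol x|)$, $\boldsymbol x\in\mathbb R^3\setminus\{0\}$. For a regular complex-valued tangential vector field $\boldsymbol\varphi$ on $\Gamma$ and $\boldsymbol x\in\mathbb R^3\setminus\Gamma$, the electromagnetic single layer potential $\mathcal S(s)$ and double layer potential $\mathcal D(s)$ are defined by $$\mathcal S(s)\boldsymbol\varphi(\boldsymbol x)=-s\int_\Gamma G(s,\boldsymbol x-\boldsymbol y)\boldsymbol\varphi(\boldsymbol y)\,\mathrm d\boldsymbol y+s^{-1}\nabla\int_\Gamma G(s,\boldsymbol x-\boldsymbol y)\operatorname{div}_\Gamma\boldsymbol\varphi(\boldsymbol y)\,\mathrm d\boldsymbol y,$$ $$\mathcal D(s)\boldsymbol\varphi(\boldsymbol x)=\operatorname{curl}\int_\Gamma G(s,\boldsymbol x-\boldsymbol y)\boldsymbol\varphi(\boldsymbol y)\,\mathrm d\boldsymbol y,$$ where $\operatorname{div}_\Gamma$ is the surface divergence. $\boldsymbol L^p(\Gamma)$ is the $L^p$ space of vector fields on $\Gamma$; $\mathcal S_{\boldsymbol x}(s)$ denotes the map $\boldsymbol\varphi\mapsto(\mathcal S(s)\boldsymbol\varphi)(\boldsymbol x)$.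
   Formalization: The bounds with one C for all Re s > 0 fail as s → 0 (S(s)φ(x) grows like 1/s for φ the surface gradient of y₁ on the unit sphere); here, for every σ > 0, C is independent of s with Re s > 0 and |s| ≥ σ, but may depend on σ. *)

theory Defs
  imports "HOL-Analysis.Analysis"
begin

section \<open>Functions of class C1 and C2\<close>

definition C1_on :: "'a::real_normed_vector set \<Rightarrow> ('a \<Rightarrow> 'b::real_normed_vector) \<Rightarrow> bool" where
  "C1_on U f \<longleftrightarrow>
     (\<exists>f'. (\<forall>x\<in>U. (f has_derivative blinfun_apply (f' x)) (at x)) \<and> continuous_on U f')"

definition C2_on :: "'a::real_normed_vector set \<Rightarrow> ('a \<Rightarrow> 'b::real_normed_vector) \<Rightarrow> bool" where
  "C2_on U f \<longleftrightarrow>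
     (\<exists>f'. (\<forall>x\<in>U. (f has_derivative blinfun_apply (f' x)) (at x)) \<and> C1_on U f')"


section \<open>Exterior domains with C2 boundary\<close>

text \<open>
  A domain is open, so the closures of the bounded domains are removed.  Nonemptiness of
  the boundary follows from that of the bounded domains.
\<close>

definition exterior_domain :: "(real^3) set \<Rightarrow> bool" where
  "exterior_domain \<Omega> \<longleftrightarrow>
     connected \<Omega> \<and>
     (\<exists>\<D>. finite \<D> \<and> \<D> \<noteq> {} \<and>
          (\<forall>B\<in>\<D>. open B \<and> connected B \<and> bounded B \<and> B \<noteq> {}) \<and>
          \<Omega> = - closure (\<Union>\<D>))"

text \<open>
  Near each of its boundary points the set lies, after an orthogonal change of coordinates,
  strictly above the graph of a C2 function.
\<close>

definition C2_boundary :: "(real^3) set \<Rightarrow> bool" where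
  "C2_boundary \<Omega> \<longleftrightarrow>
     (\<forall>y\<in>frontier \<Omega>. \<exists>r>0. \<exists>(R :: real^3 \<Rightarrow> real^3) (\<gamma> :: real^2 \<Rightarrow> real).
        orthogonal_transformation R \<and> C2_on UNIV \<gamma> \<and>
        \<Omega> \<inter> ball y r = {z \<in> ball y r. \<gamma> (vector [R z $ 1, R z $ 2]) < R z $ 3})"


section \<open>Surface measure\<close>

definition regular_parametrization ::
    "(real^3) set \<Rightarrow> (real^2) set \<Rightarrow> (real^2 \<Rightarrow> real^3) \<Rightarrow> bool" where
  "regular_parametrization \<Gamma> V X \<longleftrightarrow>
     open V \<and> C2_on V X \<and> (\<forall>u\<in>V. inj (frechet_derivative X (at u))) \<and>
     openin (top_of_set \<Gamma>) (X ` V) \<and> (\<exists>Y. homeomorphism V (X ` V) X Y)"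

definition area_element :: "(real^2 \<Rightarrow> real^3) \<Rightarrow> real^2 \<Rightarrow> real" where
  "area_element X u =
     norm (cross3 (frechet_derivative X (at u) (axis 1 1)) (frechet_derivative X (at u) (axis 2 1)))"

text \<open>
  For a C2 surface, the images of parametrizations cover the surface and the area formula is
  compatible with changes of parameters, so exactly one measure satisfies this predicate.
\<close>

definition is_surface_measure :: "(real^3) set \<Rightarrow> (real^3) measure \<Rightarrow> bool" where
  "is_surface_measure \<Gamma> \<mu> \<longleftrightarrow>
     sets \<mu> = sets (restrict_space borel \<Gamma>) \<and>
     (\<forall>V X A. regular_parametrization \<Gamma> V X \<longrightarrow> A \<in> sets borel \<longrightarrow> A \<subseteq> V \<longrightarrow>
        emeasure \<mu> (X ` A) = (\<integral>\<^sup>+u\<in>A. ennreal (area_element X u) \<partial>lborel))"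

text \<open>The underlying space is \<open>\<Gamma>\<close> itself, so values of integrands off \<open>\<Gamma>\<close> are irrelevant.\<close>

definition surface_measure :: "(real^3) set \<Rightarrow> (real^3) measure" where
  "surface_measure \<Gamma> = (SOME \<mu>. is_surface_measure \<Gamma> \<mu>)"


section \<open>Tangential fields and surface divergence\<close>

definition tangent_space :: "(real^3) set \<Rightarrow> real^3 \<Rightarrow> (real^3) set" where
  "tangent_space \<Gamma> y =
     {v. \<exists>c. c 0 = y \<and> (\<exists>\<epsilon>>0. \<forall>t. \<bar>t\<bar> < \<epsilon> \<longrightarrow> c t \<in> \<Gamma>) \<and>
             (c has_vector_derivative v) (at (0::real))}"

text \<open>Determined up to sign on a regular surface; all uses below are invariant under the sign.\<close>

definition unit_normal :: "(real^3) set \<Rightarrow> real^3 \<Rightarrow> real^3" where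
  "unit_normal \<Gamma> y = (SOME n. norm n = 1 \<and> (\<forall>v\<in>tangent_space \<Gamma> y. orthogonal n v))"

definition tangential_at :: "(real^3) set \<Rightarrow> real^3 \<Rightarrow> complex^3 \<Rightarrow> bool" where
  "tangential_at \<Gamma> y w \<longleftrightarrow> (\<Sum>i\<in>UNIV. of_real (unit_normal \<Gamma> y $ i) * w $ i) = 0"

text \<open>
  A map on \<open>\<Gamma>\<close> is of class C1 if it is locally the restriction of a C1 map on an open set.
\<close>

definition regular_tangential_fields :: "(real^3) set \<Rightarrow> (real^3 \<Rightarrow> complex^3) set" where
  "regular_tangential_fields \<Gamma> =
     {\<phi>. (\<forall>y\<in>\<Gamma>. tangential_at \<Gamma> y (\<phi> y)) \<and>
         (\<forall>y\<in>\<Gamma>. \<exists>U \<psi>. open U \<and> y \<in> U \<and> C1_on U \<psi> \<and> (\<forall>z\<in>U \<inter> \<Gamma>. \<psi> z = \<phi> z))}"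

text \<open>
  The trace of the tangential derivative.  A derivative within \<open>\<Gamma>\<close> is determined only on the
  tangent space; the projection of the basis vectors onto the tangent space makes the value
  independent of the choice of the derivative.
\<close>

definition surface_div :: "(real^3) set \<Rightarrow> (real^3 \<Rightarrow> complex^3) \<Rightarrow> real^3 \<Rightarrow> complex" where
  "surface_div \<Gamma> \<phi> y =
     (let n = unit_normal \<Gamma> y; D = frechet_derivative \<phi> (at y within \<Gamma>)
      in \<Sum>i\<in>UNIV. D (axis i 1 - (n $ i) *\<^sub>R n) $ i)"


section \<open>Electromagnetic layer potentials\<close>

definition partial_deriv :: "3 \<Rightarrow> (real^3 \<Rightarrow> complex) \<Rightarrow> real^3 \<Rightarrow> complex" where
  "partial_deriv i u x = frechet_derivative u (at x) (axis i 1)"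

definition grad :: "(real^3 \<Rightarrow> complex) \<Rightarrow> real^3 \<Rightarrow> complex^3" where
  "grad u x = (\<chi> i. partial_deriv i u x)"

definition curl :: "(real^3 \<Rightarrow> complex^3) \<Rightarrow> real^3 \<Rightarrow> complex^3" where
  "curl v x = vector
     [partial_deriv 2 (\<lambda>z. v z $ 3) x - partial_deriv 3 (\<lambda>z. v z $ 2) x,
      partial_deriv 3 (\<lambda>z. v z $ 1) x - partial_deriv 1 (\<lambda>z. v z $ 3) x,
      partial_deriv 1 (\<lambda>z. v z $ 2) x - partial_deriv 2 (\<lambda>z. v z $ 1) x]"

definition fundamental_solution :: "complex \<Rightarrow> real^3 \<Rightarrow> complex" where
  "fundamental_solution s x = exp (- s * of_real (norm x)) / of_real (4 * pi * norm x)"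

definition single_layer :: "(real^3) set \<Rightarrow> complex \<Rightarrow> (real^3 \<Rightarrow> complex^3) \<Rightarrow> real^3 \<Rightarrow> complex^3" where
  "single_layer \<Gamma> s \<phi> x =
     (- s) *s (LINT y|surface_measure \<Gamma>. fundamental_solution s (x - y) *s \<phi> y)
     + inverse s *s
       grad (\<lambda>z. LINT y|surface_measure \<Gamma>. fundamental_solution s (z - y) * surface_div \<Gamma> \<phi> y) x"

definition double_layer :: "(real^3) set \<Rightarrow> complex \<Rightarrow> (real^3 \<Rightarrow> complex^3) \<Rightarrow> real^3 \<Rightarrow> complex^3" where
  "double_layer \<Gamma> s \<phi> x =
     curl (\<lambda>z. LINT y|surface_measure \<Gamma>. fundamental_solution s (z - y) *s \<phi> y) x"


section \<open>The space of tangential p-integrable fields\<close>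

definition Lp_norm :: "(real^3) set \<Rightarrow> real \<Rightarrow> (real^3 \<Rightarrow> complex^3) \<Rightarrow> real" where
  "Lp_norm \<Gamma> p f = (LINT y|surface_measure \<Gamma>. norm (f y) powr p) powr (1 / p)"

definition Lp_fields :: "(real^3) set \<Rightarrow> real \<Rightarrow> (real^3 \<Rightarrow> complex^3) set" where
  "Lp_fields \<Gamma> p =
     {f. f \<in> borel_measurable (surface_measure \<Gamma>) \<and>
         integrable (surface_measure \<Gamma>) (\<lambda>y. norm (f y) powr p) \<and>
         (AE y in surface_measure \<Gamma>. tangential_at \<Gamma> y (f y))}"

definition Lp_dense :: "(real^3) set \<Rightarrow> real \<Rightarrow> (real^3 \<Rightarrow> complex^3) set \<Rightarrow> bool" where
  "Lp_dense \<Gamma> p A \<longleftrightarrow>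
     A \<subseteq> Lp_fields \<Gamma> p \<and>
     (\<forall>f\<in>Lp_fields \<Gamma> p. \<forall>\<epsilon>>0. \<exists>\<phi>\<in>A. Lp_norm \<Gamma> p (\<lambda>y. f y - \<phi> y) < \<epsilon>)"

text \<open>
  Operators act on representatives; linearity and boundedness force equal values on fields
  that agree almost everywhere, so they descend to the quotient.
\<close>

definition bounded_linear_Lp ::
    "(real^3) set \<Rightarrow> real \<Rightarrow> ((real^3 \<Rightarrow> complex^3) \<Rightarrow> complex^3) \<Rightarrow> bool" where
  "bounded_linear_Lp \<Gamma> p T \<longleftrightarrow>
     (\<forall>f\<in>Lp_fields \<Gamma> p. \<forall>g\<in>Lp_fields \<Gamma> p. T (\<lambda>y. f y + g y) = T f + T g) \<and>
     (\<forall>c. \<forall>f\<in>Lp_fields \<Gamma> p. T (\<lambda>y. c *s f y) = c *s T f) \<and>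
     (\<exists>B. \<forall>f\<in>Lp_fields \<Gamma> p. norm (T f) \<le> B * Lp_norm \<Gamma> p f)"

end

theory Submission imports Defs begin

text \<open>
  At a point \<open>x\<close> at distance \<open>d\<close> from the surface, the fundamental solution \<open>G\<close> and its derivatives up to
  second order are smooth in \<open>x - y\<close>, and by explicit formulas they are bounded by \<open>exp (- d * Re s)\<close> times
  a polynomial in \<open>\<bar>s\<bar>\<close> whose degree is the order of the derivative (\<open>norm_radial0\<close>, \<open>norm_radial1\<close>,
  \<open>norm_radial2\<close>).  The bounds follow once both potentials are written as integrals over the surface
  of such a kernel applied to the density itself.  The double layer potential has the kernel
  \<open>\<nabla>G \<times> \<phi>\<close>, by differentiation under the integral sign.  In the single layer potential the surface
  divergence first has to be moved from \<open>\<phi>\<close> to \<open>G\<close> by integration by parts on the closed surface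
  (\<open>surface_integration_by_parts\<close>); taking the gradient then produces the Hessian of \<open>G\<close>, of order \<open>\<bar>s\<bar>\<^sup>2\<close>,
  and the factor \<open>1 / s\<close> brings this down to \<open>\<bar>s\<bar>\<close>.  Lower powers of \<open>\<bar>s\<bar>\<close> are absorbed by \<open>\<bar>s\<bar> \<ge> \<sigma>\<close>.
  The integral representations are \<open>single_layer_eq\<close> and \<open>double_layer_eq\<close>.

  The embedding of \<open>L\<^sup>p\<close> into \<open>L\<^sup>1\<close> over the surface, of finite area, has a constant that does not depend
  on \<open>p\<close> (\<open>Lp_imp_L1\<close>).  The integral operators with the same kernels are therefore bounded on every
  \<open>L\<^sup>p\<close>, and they are the extensions of the potentials.

  Integration by parts is proved in graph patches.  There the surface divergence of a tangential
  field with components \<open>a\<^sub>1\<close>, \<open>a\<^sub>2\<close> is \<open>(\<partial>\<^sub>1 (J a\<^sub>1) + \<partial>\<^sub>2 (J a\<^sub>2)) / J\<close> with the area element \<open>J\<close>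
  (\<open>surface_div_patch\<close>), so that against a function supported in the patch one integrates
  derivatives of compactly supported functions over the plane.  Bumps subordinate to a finite cover
  by patches glue the local statements together.

  All of this needs the surface measure to be what its defining predicate says.  A measure with this
  property is assembled from finitely many disjoint Borel pieces, each carrying the image of \<open>J\<close> times
  Lebesgue measure; its compatibility with an arbitrary regular parametrization is the change of
  variables formula for the chart change (\<open>surface_measure_exists\<close>).

  For the density of regular fields (\<open>regular_fields_dense\<close>), bounded fields are approximated in \<open>L\<^sup>1\<close> by
  continuous and then by polynomial fields, and the approximations are projected to the tangent
  planes; the projection is of class C1 because the surface is of class C2.
\<close>


section \<open>Calculus of functions of class C1\<close>

text \<open>
  On a finite-dimensional domain, continuity of the derivative in the operator norm is continuity
  of every directional derivative, so linear maps need not be packed as elements of a normed space.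
\<close>

lemma C1_on_iff:
  fixes f :: "'a::euclidean_space \<Rightarrow> 'b::real_normed_vector"
  shows "C1_on U f \<longleftrightarrow> (\<exists>f'. (\<forall>x\<in>U. (f has_derivative f' x) (at x)) \<and>
            (\<forall>h. continuous_on U (\<lambda>x. f' x h)))"
proof
  assume "C1_on U f"
  then obtain f' where f': "\<forall>x\<in>U. (f has_derivative blinfun_apply (f' x)) (at x)" "continuous_on U f'"
    unfolding C1_on_def by blast
  then show "\<exists>f'. (\<forall>x\<in>U. (f has_derivative f' x) (at x)) \<and> (\<forall>h. continuous_on U (\<lambda>x. f' x h))"
    by (intro exI[of _ "\<lambda>x. blinfun_apply (f' x)"]) (auto intro!: continuous_intros)
next
  assume "\<exists>f'. (\<forall>x\<in>U. (f has_derivative f' x) (at x)) \<and> (\<forall>h. continuous_on U (\<lambda>x. f' x h))"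
  then obtain f' where f': "\<And>x. x \<in> U \<Longrightarrow> (f has_derivative f' x) (at x)"
    "\<And>h. continuous_on U (\<lambda>x. f' x h)"
    by blast
  have eq: "blinfun_apply (Blinfun (f' x)) = f' x" if "x \<in> U" for x
    by (rule bounded_linear_Blinfun_apply) (rule has_derivative_bounded_linear[OF f'(1)[OF that]])
  have "continuous_on U (\<lambda>x. Blinfun (f' x))"
  proof (rule continuous_on_blinfun_componentwise)
    fix i :: 'a
    show "continuous_on U (\<lambda>x. blinfun_apply (Blinfun (f' x)) i)"
      using f'(2)[of i] by (rule continuous_on_eq) (simp add: eq)
  qed
  with f'(1) show "C1_on U f"
    unfolding C1_on_def by (intro exI[of _ "\<lambda>x. Blinfun (f' x)"]) (simp add: eq)
qed

lemma C1_onI: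
  fixes f :: "'a::euclidean_space \<Rightarrow> 'b::real_normed_vector"
  assumes "\<And>x. x \<in> U \<Longrightarrow> (f has_derivative f' x) (at x)"
    and "\<And>h. continuous_on U (\<lambda>x. f' x h)"
  shows "C1_on U f"
  using assms C1_on_iff by blast

lemma C1_onD:
  fixes f :: "'a::euclidean_space \<Rightarrow> 'b::real_normed_vector"
  assumes "C1_on U f"
  shows C1_on_has_derivative: "x \<in> U \<Longrightarrow> (f has_derivative frechet_derivative f (at x)) (at x)"
    and C1_on_continuous_derivative: "continuous_on U (\<lambda>x. frechet_derivative f (at x) h)"
proof -
  obtain f' where f': "\<And>x. x \<in> U \<Longrightarrow> (f has_derivative f' x) (at x)"
    "\<And>h. continuous_on U (\<lambda>x. f' x h)"
    using assms unfolding C1_on_iff by blast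
  have eq: "f' x = frechet_derivative f (at x)" if "x \<in> U" for x
    by (rule frechet_derivative_at[OF f'(1)[OF that]])
  show "x \<in> U \<Longrightarrow> (f has_derivative frechet_derivative f (at x)) (at x)"
    using f'(1) eq by metis
  show "continuous_on U (\<lambda>x. frechet_derivative f (at x) h)"
    using f'(2)[of h] by (rule continuous_on_eq) (simp add: eq)
qed

lemma C1_on_subset: "C1_on U f \<Longrightarrow> V \<subseteq> U \<Longrightarrow> C1_on V f"
  unfolding C1_on_def by (meson continuous_on_subset subsetD)

lemma C1_on_imp_continuous_on:
  "C1_on U f \<Longrightarrow> continuous_on U f"
  unfolding C1_on_def
  by (meson continuous_at_imp_continuous_on has_derivative_continuous)

text \<open>
  The derivative at a point is determined by the values nearby, which makes C1 a local property;
  fields that are given by local extensions are handled by this lemma.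
\<close>

lemma C1_on_local:
  fixes f :: "'a::euclidean_space \<Rightarrow> 'b::real_normed_vector"
  assumes "\<And>x. x \<in> U \<Longrightarrow> \<exists>V g. open V \<and> x \<in> V \<and> C1_on V g \<and> (\<forall>z\<in>V. f z = g z)"
  shows "C1_on U f"
proof (rule C1_onI)
  fix x assume "x \<in> U"
  then obtain V g where V: "open V" "x \<in> V" "C1_on V g" "\<forall>z\<in>V. f z = g z"
    using assms by blast
  have "(f has_derivative frechet_derivative g (at x)) (at x)"
    by (rule has_derivative_transform_within_open[OF C1_on_has_derivative[OF V(3,2)] V(1,2)])
      (use V(4) in auto)
  then show "(f has_derivative frechet_derivative f (at x)) (at x)"
    using frechet_derivative_at by metis
next
  fix h
  show "continuous_on U (\<lambda>x. frechet_derivative f (at x) h)"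
  proof (rule continuous_at_imp_continuous_on, safe)
    fix x assume "x \<in> U"
    then obtain V g where V: "open V" "x \<in> V" "C1_on V g" "\<forall>z\<in>V. f z = g z"
      using assms by blast
    have eq: "frechet_derivative g (at z) = frechet_derivative f (at z)" if "z \<in> V" for z
      by (rule frechet_derivative_at,
          rule has_derivative_transform_within_open[OF C1_on_has_derivative[OF V(3) that] V(1) that])
        (use V(4) in auto)
    have "continuous_on V (\<lambda>x. frechet_derivative f (at x) h)"
      using C1_on_continuous_derivative[OF V(3), of h] by (rule continuous_on_eq) (simp add: eq)
    then show "continuous (at x) (\<lambda>x. frechet_derivative f (at x) h)"
      using V by (simp add: continuous_on_eq_continuous_at)
  qed
qed

lemma C1_on_bounded_linear:
  fixes f :: "'a::euclidean_space \<Rightarrow> 'b::real_normed_vector"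
  shows "bounded_linear f \<Longrightarrow> C1_on U f"
  by (rule C1_onI[of _ _ "\<lambda>_. f"]) (auto intro: bounded_linear_imp_has_derivative)

lemma C1_on_const: "C1_on U (\<lambda>x::'a::euclidean_space. c)"
  by (rule C1_onI[of _ _ "\<lambda>_ _. 0"]) auto

lemma C1_on_add:
  fixes f g :: "'a::euclidean_space \<Rightarrow> 'b::real_normed_vector"
  assumes "C1_on U f" "C1_on U g"
  shows "C1_on U (\<lambda>x. f x + g x)"
  by (rule C1_onI[OF has_derivative_add[OF C1_on_has_derivative[OF assms(1)] C1_on_has_derivative[OF assms(2)]]])
    (auto intro!: continuous_intros C1_on_continuous_derivative assms)

lemma C1_on_bilinear:
  fixes f :: "'a::euclidean_space \<Rightarrow> 'b::real_normed_vector"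
    and g :: "'a \<Rightarrow> 'c::real_normed_vector"
    and B :: "'b \<Rightarrow> 'c \<Rightarrow> 'd::real_normed_vector"
  assumes B: "bounded_bilinear B" and f: "C1_on U f" and g: "C1_on U g"
  shows "C1_on U (\<lambda>x. B (f x) (g x))"
  by (rule C1_onI[OF bounded_bilinear.FDERIV[OF B C1_on_has_derivative[OF f] C1_on_has_derivative[OF g]]])
    (assumption+, intro continuous_on_add bounded_bilinear.continuous_on[OF B]
      C1_on_continuous_derivative[OF f] C1_on_continuous_derivative[OF g]
      C1_on_imp_continuous_on[OF f] C1_on_imp_continuous_on[OF g])

lemmas C1_on_mult = C1_on_bilinear[OF bounded_bilinear_mult]
lemmas C1_on_scaleR = C1_on_bilinear[OF bounded_bilinear_scaleR]
lemmas C1_on_inner = C1_on_bilinear[OF bounded_bilinear_inner]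

lemma C1_on_compose:
  fixes f :: "'a::euclidean_space \<Rightarrow> 'b::euclidean_space" and g :: "'b \<Rightarrow> 'c::real_normed_vector"
  assumes f: "C1_on U f" and g: "C1_on V g" and sub: "\<And>x. x \<in> U \<Longrightarrow> f x \<in> V"
  shows "C1_on U (\<lambda>x. g (f x))"
proof -
  obtain f' where f': "\<forall>x\<in>U. (f has_derivative blinfun_apply (f' x)) (at x)" "continuous_on U f'"
    using f unfolding C1_on_def by blast
  obtain g' where g': "\<forall>x\<in>V. (g has_derivative blinfun_apply (g' x)) (at x)" "continuous_on V g'"
    using g unfolding C1_on_def by blast
  have "((\<lambda>x. g (f x)) has_derivative (\<lambda>h. g' (f x) (f' x h))) (at x)" if "x \<in> U" for x
    using has_derivative_compose[of f "blinfun_apply (f' x)" x UNIV g] f' g' sub that by auto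
  moreover have "continuous_on U (\<lambda>x. g' (f x) (f' x h))" for h
    by (intro continuous_intros continuous_on_compose2[OF g'(2) C1_on_imp_continuous_on[OF f]] f')
       (use sub in auto)
  ultimately show ?thesis
    by (rule C1_onI)
qed

lemma C1_on_linear_compose:
  fixes f :: "'a::euclidean_space \<Rightarrow> 'b::real_normed_vector" and L :: "'b \<Rightarrow> 'c::real_normed_vector"
  assumes L: "bounded_linear L" and f: "C1_on U f"
  shows "C1_on U (\<lambda>x. L (f x))"
  by (rule C1_onI[OF bounded_linear.has_derivative[OF L C1_on_has_derivative[OF f]]])
    (auto intro!: bounded_linear.continuous_on[OF L] C1_on_continuous_derivative[OF f])

lemma C1_on_minus:
  fixes f :: "'a::euclidean_space \<Rightarrow> 'b::real_normed_vector"
  shows "C1_on U f \<Longrightarrow> C1_on U (\<lambda>x. - f x)"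
  by (rule C1_on_linear_compose[OF bounded_linear_minus[OF bounded_linear_ident]])

lemma C1_on_diff:
  fixes f g :: "'a::euclidean_space \<Rightarrow> 'b::real_normed_vector"
  shows "C1_on U f \<Longrightarrow> C1_on U g \<Longrightarrow> C1_on U (\<lambda>x. f x - g x)"
  using C1_on_add[of U f "\<lambda>x. - g x"] C1_on_minus[of U g] by simp

lemma C1_on_real:
  fixes f :: "'a::euclidean_space \<Rightarrow> real" and g :: "real \<Rightarrow> 'c::real_normed_vector"
  assumes f: "C1_on U f" and g: "\<And>t. t \<in> V \<Longrightarrow> (g has_vector_derivative g' t) (at t)"
    and "continuous_on V g'" and sub: "\<And>x. x \<in> U \<Longrightarrow> f x \<in> V"
  shows "C1_on U (\<lambda>x. g (f x))"
proof (rule C1_on_compose[OF f _ sub])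
  show "C1_on V g"
    using assms(2,3) by (intro C1_onI[of _ _ "\<lambda>t h. h *\<^sub>R g' t"])
      (auto simp: has_vector_derivative_def intro!: continuous_intros)
qed

lemma C1_on_inverse:
  fixes f :: "'a::euclidean_space \<Rightarrow> real"
  assumes f: "C1_on U f" and nz: "\<And>x. x \<in> U \<Longrightarrow> f x \<noteq> 0"
  shows "C1_on U (\<lambda>x. inverse (f x))"
proof (rule C1_on_real[OF f, of "- {0}" inverse "\<lambda>t. - (inverse t * inverse t)"])
  show "(inverse has_vector_derivative - (inverse t * inverse t)) (at t)" if "t \<in> - {0}" for t :: real
    using that unfolding has_real_derivative_iff_has_vector_derivative[symmetric]
    by (auto intro!: derivative_eq_intros simp: power2_eq_square)
  show "continuous_on (- {0}) (\<lambda>t::real. - (inverse t * inverse t))"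
    by (auto intro!: continuous_intros)
qed (use nz in auto)

lemma C1_on_sqrt:
  fixes f :: "'a::euclidean_space \<Rightarrow> real"
  assumes f: "C1_on U f" and pos: "\<And>x. x \<in> U \<Longrightarrow> f x > 0"
  shows "C1_on U (\<lambda>x. sqrt (f x))"
proof (rule C1_on_real[OF f, of "{0<..}" sqrt "\<lambda>t. inverse (sqrt t) / 2"])
  show "(sqrt has_vector_derivative inverse (sqrt t) / 2) (at t)" if "t \<in> {0<..}" for t :: real
    using that unfolding has_real_derivative_iff_has_vector_derivative[symmetric]
    by (auto intro!: derivative_eq_intros simp: field_simps)
  show "continuous_on {0<..} (\<lambda>t::real. inverse (sqrt t) / 2)"
    by (auto intro!: continuous_intros)
qed (use pos in auto)

lemma C1_on_sum:
  fixes f :: "'i \<Rightarrow> 'a::euclidean_space \<Rightarrow> 'b::real_normed_vector"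
  assumes "\<And>i. i \<in> I \<Longrightarrow> C1_on U (f i)"
  shows "C1_on U (\<lambda>x. \<Sum>i\<in>I. f i x)"
  using assms by (induction I rule: infinite_finite_induct) (auto intro!: C1_on_const C1_on_add)

lemma C1_on_polynomial_function:
  fixes f :: "'a::euclidean_space \<Rightarrow> 'b::euclidean_space"
  assumes "polynomial_function f"
  shows "C1_on U f"
proof -
  have real: "C1_on U p" if "real_polynomial_function p" for p :: "'a \<Rightarrow> real"
    using that by induction (auto intro: C1_on_bounded_linear C1_on_const C1_on_add C1_on_mult)
  have "C1_on U (\<lambda>x. \<Sum>b\<in>Basis. (f x \<bullet> b) *\<^sub>R b)"
    using assms unfolding polynomial_function_iff_Basis_inner
    by (intro C1_on_sum C1_on_scaleR real C1_on_const) auto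
  then show ?thesis
    by (simp add: euclidean_representation)
qed

lemma has_vector_derivative_along_line:
  assumes "(f has_derivative f') (at (x + s *\<^sub>R e))"
  shows "((\<lambda>s. f (x + s *\<^sub>R e)) has_vector_derivative f' e) (at s within S)"
proof -
  have "((\<lambda>s. x + s *\<^sub>R e) has_derivative (\<lambda>h. h *\<^sub>R e)) (at s within S)"
    by (auto intro!: derivative_eq_intros)
  from has_derivative_compose[OF this assms] show ?thesis
    using linear_cmul[OF has_derivative_linear[OF assms]] by (simp add: has_vector_derivative_def)
qed

text \<open>
  Applying the mean value theorem twice writes the second difference of \<open>f\<close> over a small
  parallelogram as \<open>t\<^sup>2\<close> times either of the mixed derivatives at some point nearby; continuity of both
  gives equality in the limit \<open>t \<rightarrow> 0\<close>.
\<close>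

lemma mixed_partial_derivatives_commute:
  fixes f :: "'a::euclidean_space \<Rightarrow> real"
  assumes f: "\<And>x. (f has_derivative f' x) (at x)"
    and a: "C1_on UNIV (\<lambda>x. f' x a)" and b: "C1_on UNIV (\<lambda>x. f' x b)"
  shows "frechet_derivative (\<lambda>x. f' x a) (at u) b = frechet_derivative (\<lambda>x. f' x b) (at u) a"
proof -
  \<comment> \<open>stated for both orders of the two directions\<close>
  have key: "\<exists>\<xi> \<eta>. 0 < \<xi> \<and> \<xi> < t \<and> 0 < \<eta> \<and> \<eta> < t \<and>
      f (u + t *\<^sub>R a + t *\<^sub>R b) - f (u + t *\<^sub>R a) - f (u + t *\<^sub>R b) + f u
        = t * t * frechet_derivative (\<lambda>x. f' x a) (at (u + \<xi> *\<^sub>R a + \<eta> *\<^sub>R b)) b"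
    if a: "C1_on UNIV (\<lambda>x. f' x a)" and t: "t > 0" for a b :: 'a and t :: real
  proof -
    let ?g = "\<lambda>s. f (u + s *\<^sub>R a + t *\<^sub>R b) - f (u + s *\<^sub>R a)"
    have lin: "linear (f' x)" for x
      using f[of x] has_derivative_linear by blast
    have "(?g has_real_derivative f' (u + s *\<^sub>R a + t *\<^sub>R b) a - f' (u + s *\<^sub>R a) a) (at s)" for s
      unfolding has_field_derivative_def
      by (rule derivative_eq_intros has_derivative_compose[OF _ f] refl)+
        (simp add: fun_eq_iff linear_cmul[OF lin] algebra_simps)
    from MVT2[OF t this] obtain \<xi> where \<xi>: "0 < \<xi>" "\<xi> < t"
      "?g t - ?g 0 = t * (f' (u + \<xi> *\<^sub>R a + t *\<^sub>R b) a - f' (u + \<xi> *\<^sub>R a) a)"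
      by auto
    let ?D = "\<lambda>x. frechet_derivative (\<lambda>x. f' x a) (at x)"
    note D = C1_on_has_derivative[OF a UNIV_I]
    have "((\<lambda>s. f' (u + \<xi> *\<^sub>R a + s *\<^sub>R b) a) has_real_derivative ?D (u + \<xi> *\<^sub>R a + s *\<^sub>R b) b) (at s)" for s
      using has_vector_derivative_along_line[OF D]
      by (simp add: has_real_derivative_iff_has_vector_derivative)
    from MVT2[OF t this] obtain \<eta> where \<eta>: "0 < \<eta>" "\<eta> < t"
      "f' (u + \<xi> *\<^sub>R a + t *\<^sub>R b) a - f' (u + \<xi> *\<^sub>R a) a = t * ?D (u + \<xi> *\<^sub>R a + \<eta> *\<^sub>R b) b"
      by auto
    with \<xi> show ?thesis
      by (intro exI[of _ \<xi>] exI[of _ \<eta>]) (simp add: algebra_simps)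
  qed
  have lim: "(\<lambda>n. frechet_derivative (\<lambda>x. f' x a) (at (u + \<xi> n *\<^sub>R a + \<eta> n *\<^sub>R b)) b)
        \<longlonglongrightarrow> frechet_derivative (\<lambda>x. f' x a) (at u) b"
    if a: "C1_on UNIV (\<lambda>x. f' x a)"
      and "\<And>n. 0 < \<xi> n \<and> \<xi> n < inverse (real (Suc n)) \<and> 0 < \<eta> n \<and> \<eta> n < inverse (real (Suc n))"
    for a b :: 'a and \<xi> \<eta> :: "nat \<Rightarrow> real"
  proof -
    have "\<xi> \<longlonglongrightarrow> 0" "\<eta> \<longlonglongrightarrow> 0"
      by (rule tendsto_sandwich[OF _ _ tendsto_const LIMSEQ_inverse_real_of_nat];
          use that(2) less_imp_le in \<open>auto intro!: always_eventually\<close>)+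
    then have "(\<lambda>n. u + \<xi> n *\<^sub>R a + \<eta> n *\<^sub>R b) \<longlonglongrightarrow> u + 0 *\<^sub>R a + 0 *\<^sub>R b"
      by (intro tendsto_intros)
    then have "(\<lambda>n. u + \<xi> n *\<^sub>R a + \<eta> n *\<^sub>R b) \<longlonglongrightarrow> u"
      by simp
    from continuous_on_tendsto_compose[OF C1_on_continuous_derivative[OF a, of b] this]
    show ?thesis by simp
  qed
  let ?t = "\<lambda>n. inverse (real (Suc n))"
  obtain \<xi> \<eta> where 1: "\<And>n. 0 < \<xi> n \<and> \<xi> n < ?t n \<and> 0 < \<eta> n \<and> \<eta> n < ?t n \<and>
      f (u + ?t n *\<^sub>R a + ?t n *\<^sub>R b) - f (u + ?t n *\<^sub>R a) - f (u + ?t n *\<^sub>R b) + f u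
        = ?t n * ?t n * frechet_derivative (\<lambda>x. f' x a) (at (u + \<xi> n *\<^sub>R a + \<eta> n *\<^sub>R b)) b"
    using key[OF a, of "?t _" b] by (metis inverse_positive_iff_positive of_nat_0_less_iff zero_less_Suc)
  obtain \<xi>' \<eta>' where 2: "\<And>n. 0 < \<xi>' n \<and> \<xi>' n < ?t n \<and> 0 < \<eta>' n \<and> \<eta>' n < ?t n \<and>
      f (u + ?t n *\<^sub>R b + ?t n *\<^sub>R a) - f (u + ?t n *\<^sub>R b) - f (u + ?t n *\<^sub>R a) + f u
        = ?t n * ?t n * frechet_derivative (\<lambda>x. f' x b) (at (u + \<xi>' n *\<^sub>R b + \<eta>' n *\<^sub>R a)) a"
    using key[OF b, of "?t _" a] by (metis inverse_positive_iff_positive of_nat_0_less_iff zero_less_Suc)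
  have "?t n * ?t n * frechet_derivative (\<lambda>x. f' x a) (at (u + \<xi> n *\<^sub>R a + \<eta> n *\<^sub>R b)) b
      = ?t n * ?t n * frechet_derivative (\<lambda>x. f' x b) (at (u + \<xi>' n *\<^sub>R b + \<eta>' n *\<^sub>R a)) a" for n
    using 1[of n] 2[of n] by (simp add: algebra_simps)
  then have "frechet_derivative (\<lambda>x. f' x a) (at (u + \<xi> n *\<^sub>R a + \<eta> n *\<^sub>R b)) b
      = frechet_derivative (\<lambda>x. f' x b) (at (u + \<xi>' n *\<^sub>R b + \<eta>' n *\<^sub>R a)) a" for n
    by simp
  with lim[OF a, of \<xi> \<eta> b] lim[OF b, of \<xi>' \<eta>' a] 1 2 show ?thesis
    using LIMSEQ_unique by auto
qed

lemma frechet_derivative_vanishes: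
  assumes "open U" "x \<in> U" "\<And>z. z \<in> U \<Longrightarrow> f z = 0"
  shows "frechet_derivative f (at x) = (\<lambda>_. 0)"
proof -
  have "(f has_derivative (\<lambda>_. 0)) (at x)"
    by (rule has_derivative_transform_within_open[OF has_derivative_const assms(1,2)])
      (use assms(3) in auto)
  then show ?thesis
    using frechet_derivative_at by metis
qed

text \<open>
  Translation invariance of Lebesgue measure makes the integral of every difference quotient
  vanish; dominated convergence passes this on to the derivative.
\<close>

lemma integral_derivative_compact_support:
  fixes F :: "'a::euclidean_space \<Rightarrow> 'b::euclidean_space"
  assumes F: "C1_on UNIV F" and K: "compact K" and zero: "\<And>x. x \<notin> K \<Longrightarrow> F x = 0"
  shows "(LINT x|lborel. frechet_derivative F (at x) e) = 0"
proof -
  note D = C1_on_has_derivative[OF F UNIV_I]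
  let ?D = "\<lambda>x. frechet_derivative F (at x)"
  have contF: "continuous_on UNIV F"
    by (rule C1_on_imp_continuous_on[OF F])
  \<comment> \<open>contains the supports of all difference quotients with step in \<open>[0,1]\<close>\<close>
  define K' where "K' = (\<lambda>(x,y). x - y) ` (K \<times> ((\<lambda>t. t *\<^sub>R e) ` {0..1}))"
  have K': "compact K'"
    unfolding K'_def case_prod_beta
    by (intro compact_continuous_image continuous_intros compact_Times K) auto
  have D0: "?D x e = 0" if "x \<notin> K" for x
    using frechet_derivative_vanishes[of "- K" x F] K zero that
    by (simp add: compact_imp_closed open_Compl)
  obtain B where B: "B \<ge> 0" "\<And>x. norm (?D x e) \<le> B"
  proof -
    have "bounded ((\<lambda>x. ?D x e) ` K)"
      by (intro compact_imp_bounded compact_continuous_image K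
          continuous_on_subset[OF C1_on_continuous_derivative[OF F]]) auto
    then obtain B where B: "B > 0" "\<And>x. x \<in> K \<Longrightarrow> norm (?D x e) \<le> B"
      by (auto simp: bounded_pos)
    show ?thesis
    proof (rule that)
      show "norm (?D x e) \<le> B" for x
        using B D0[of x] by (cases "x \<in> K") auto
    qed (use B in auto)
  qed
  let ?t = "\<lambda>n. inverse (real (Suc n))"
  let ?Q = "\<lambda>n x. (F (x + ?t n *\<^sub>R e) - F x) /\<^sub>R ?t n"
  have vd: "((\<lambda>s. F (x + s *\<^sub>R e)) has_vector_derivative ?D (x + s *\<^sub>R e) e) (at s within S)" for x s S
    by (rule has_vector_derivative_along_line[OF D])
  have "(\<lambda>n. LINT x|lborel. ?Q n x) \<longlonglongrightarrow> (LINT x|lborel. ?D x e)"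
  proof (rule integral_dominated_convergence[where w="\<lambda>x. indicator K' x *\<^sub>R B"])
    show "(\<lambda>x. ?D x e) \<in> borel_measurable lborel"
      using C1_on_continuous_derivative[OF F] by (simp add: borel_measurable_continuous_onI)
    show "?Q n \<in> borel_measurable lborel" for n
      by (auto intro!: borel_measurable_continuous_onI continuous_intros continuous_on_compose2[OF contF])
    show "integrable lborel (\<lambda>x. indicator K' x *\<^sub>R B)"
      by (rule borel_integrable_compact[OF K' continuous_on_const])
    show "AE x in lborel. (\<lambda>n. ?Q n x) \<longlonglongrightarrow> ?D x e"
    proof (rule AE_I2)
      fix x
      have "((\<lambda>h. norm (F (x + h *\<^sub>R e) - F x - h *\<^sub>R ?D x e) / norm h) \<longlongrightarrow> 0) (at 0)"
        using vd[of x 0 UNIV] by (simp add: has_vector_derivative_def has_derivative_at)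
      moreover have "filterlim ?t (at 0) sequentially"
        using LIMSEQ_inverse_real_of_nat by (auto simp: filterlim_at)
      ultimately have "(\<lambda>n. norm (F (x + ?t n *\<^sub>R e) - F x - ?t n *\<^sub>R ?D x e) / norm (?t n)) \<longlonglongrightarrow> 0"
        by (rule filterlim_compose)
      also have "(\<lambda>n. norm (F (x + ?t n *\<^sub>R e) - F x - ?t n *\<^sub>R ?D x e) / norm (?t n))
          = (\<lambda>n. norm (?Q n x - ?D x e))"
      proof
        fix n
        have shift: "y /\<^sub>R t - z = (y - t *\<^sub>R z) /\<^sub>R t" if "t \<noteq> 0" for y z :: 'b and t :: real
          using that by (simp add: scaleR_diff_right)
        have "?Q n x - ?D x e = (F (x + ?t n *\<^sub>R e) - F x - ?t n *\<^sub>R ?D x e) /\<^sub>R ?t n"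
          by (rule shift) (simp only: inverse_nonzero_iff_nonzero of_nat_eq_0_iff nat.distinct simp_thms)
        then show "norm (F (x + ?t n *\<^sub>R e) - F x - ?t n *\<^sub>R ?D x e) / norm (?t n) = norm (?Q n x - ?D x e)"
          by (simp only: norm_scaleR divide_inverse real_norm_def abs_inverse mult.commute)
      qed
      finally show "(\<lambda>n. ?Q n x) \<longlonglongrightarrow> ?D x e"
        by (simp only: tendsto_norm_zero_iff LIM_zero_iff)
    qed
    show "AE x in lborel. norm (?Q n x) \<le> indicator K' x *\<^sub>R B" for n
    proof (rule AE_I2)
      fix x
      have "norm (F (x + ?t n *\<^sub>R e) - F (x + 0 *\<^sub>R e)) \<le> B * norm (?t n - 0)"
      proof (rule differentiable_bound[of "{0..?t n}"])
        show "((\<lambda>s. F (x + s *\<^sub>R e)) has_derivative (\<lambda>h. h *\<^sub>R ?D (x + s *\<^sub>R e) e)) (at s within {0..?t n})" for s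
          using vd by (simp add: has_vector_derivative_def)
        show "onorm (\<lambda>h. h *\<^sub>R ?D (x + s *\<^sub>R e) e) \<le> B" for s
          by (rule onorm_bound) (use B in \<open>auto simp: mult.commute[of B] intro!: mult_left_mono\<close>)
      qed auto
      then have "norm (?Q n x) \<le> B"
        by (simp add: divide_simps mult.commute)
      moreover have "F (x + ?t n *\<^sub>R e) = 0 \<and> F x = 0" if "x \<notin> K'"
      proof -
        have "x - 0 *\<^sub>R e \<in> K'" if "x \<in> K"
          unfolding K'_def using that by (intro image_eqI[of _ _ "(x, 0 *\<^sub>R e)"]) auto
        moreover have "x + ?t n *\<^sub>R e - ?t n *\<^sub>R e \<in> K'" if "x + ?t n *\<^sub>R e \<in> K"
          unfolding K'_def using that
          by (intro image_eqI[of _ _ "(x + ?t n *\<^sub>R e, ?t n *\<^sub>R e)"]) (auto simp: divide_simps)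
        ultimately show ?thesis
          using that zero by auto
      qed
      ultimately show "norm (?Q n x) \<le> indicator K' x *\<^sub>R B"
        by (cases "x \<in> K'") auto
    qed
  qed
  moreover have "(LINT x|lborel. ?Q n x) = 0" for n
  proof -
    have "(\<lambda>x. indicator K x *\<^sub>R F x) = F"
      using zero by (auto simp: fun_eq_iff indicator_def)
    then have int: "integrable lborel F"
      using borel_integrable_compact[OF K continuous_on_subset[OF contF]] by simp
    have "(LINT x|lborel. F x) = (LINT x|distr lborel borel ((+) (?t n *\<^sub>R e)). F x)"
      by (simp add: lborel_distr_plus)
    also have "\<dots> = (LINT x|lborel. F (?t n *\<^sub>R e + x))"
      by (rule integral_distr) (auto intro: borel_measurable_continuous_onI contF)
    finally have eq: "(LINT x|lborel. F (x + ?t n *\<^sub>R e)) = (LINT x|lborel. F x)"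
      by (simp add: add.commute)
    have "integrable (distr lborel borel ((+) (?t n *\<^sub>R e))) F"
      using int by (simp add: lborel_distr_plus)
    then have "integrable lborel (\<lambda>x. F (?t n *\<^sub>R e + x))"
      by (subst (asm) integrable_distr_eq) (auto intro: borel_measurable_continuous_onI contF)
    then show ?thesis
      using int eq by (simp add: add.commute)
  qed
  ultimately show ?thesis
    using LIMSEQ_unique[OF _ tendsto_const] by (simp only:) blast
qed


section \<open>Complex vectors and their pairing with real directions\<close>

definition cdot :: "real^3 \<Rightarrow> complex^3 \<Rightarrow> complex" where
  "cdot v w = (\<Sum>i\<in>UNIV. of_real (v $ i) * w $ i)"

definition cvec :: "real^3 \<Rightarrow> complex^3" where
  "cvec v = (\<chi> i. of_real (v $ i))"

text \<open>
  The complex linear extension of a real linear functional; with \<open>L\<close> the derivative of a function \<open>g\<close>,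
  \<open>clin L w\<close> is \<open>\<nabla>g \<cdot> w\<close> for a complex vector \<open>w\<close>.
\<close>

definition clin :: "(real^3 \<Rightarrow> complex) \<Rightarrow> complex^3 \<Rightarrow> complex" where
  "clin L w = (\<Sum>i\<in>UNIV. w $ i * L (axis i 1))"

lemma norm_vector_scalar_mult: "norm (c *s w) = cmod c * norm w" for w :: "complex^'n"
  by (simp add: norm_vec_def L2_set_def norm_mult power_mult_distrib sum_distrib_left[symmetric]
      real_sqrt_mult)

lemma bounded_bilinear_vector_scalar_mult:
  "bounded_bilinear (\<lambda>c (w::complex^'n). c *s w)"
proof (rule bounded_bilinear.intro)
  show "\<exists>K. \<forall>c (w::complex^'n). norm (c *s w) \<le> norm c * norm w * K"
    by (rule exI[of _ 1]) (simp add: norm_vector_scalar_mult)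
qed (auto simp: vec_eq_iff algebra_simps scaleR_conv_of_real[where 'a=complex])

lemma norm_cdot_le: "cmod (cdot v w) \<le> 3 * norm v * norm w"
proof -
  have "norm (cdot v w) \<le> (\<Sum>i\<in>UNIV. norm (complex_of_real (v $ i) * w $ i))"
    unfolding cdot_def by (rule norm_sum)
  also have "\<dots> \<le> (\<Sum>i\<in>(UNIV::3 set). norm v * norm w)"
    by (rule sum_mono) (auto simp: norm_mult intro!: mult_mono component_le_norm_cart Finite_Cartesian_Product.norm_nth_le)
  finally show ?thesis by simp
qed

lemma bounded_bilinear_cdot: "bounded_bilinear cdot"
proof (rule bounded_bilinear.intro)
  show "\<exists>K. \<forall>v w. norm (cdot v w) \<le> norm v * norm w * K"
    by (rule exI[of _ 3]) (use norm_cdot_le in \<open>simp add: algebra_simps\<close>)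
qed (auto simp: cdot_def algebra_simps scaleR_conv_of_real[where 'a=complex] sum.distrib sum_distrib_left)

lemmas cdot_add_left = bounded_bilinear.add_left[OF bounded_bilinear_cdot]
lemmas cdot_add_right = bounded_bilinear.add_right[OF bounded_bilinear_cdot]
lemmas cdot_diff_left = bounded_bilinear.diff_left[OF bounded_bilinear_cdot]
lemmas cdot_diff_right = bounded_bilinear.diff_right[OF bounded_bilinear_cdot]
lemmas cdot_scaleR_left = bounded_bilinear.scaleR_left[OF bounded_bilinear_cdot]
lemmas cdot_scaleR_right = bounded_bilinear.scaleR_right[OF bounded_bilinear_cdot]

lemma cdot_mult_right: "cdot v (c *s w) = c * cdot v w"
  by (simp add: cdot_def sum_distrib_left algebra_simps)

lemma cdot_cvec: "cdot v (cvec w) = of_real (v \<bullet> w)"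
  by (simp add: cdot_def cvec_def inner_vec_def)

lemma tangential_at_iff: "tangential_at \<Gamma> y w \<longleftrightarrow> cdot (unit_normal \<Gamma> y) w = 0"
  by (simp add: tangential_at_def cdot_def)

lemma bounded_linear_cvec: "bounded_linear cvec"
  by (intro linear_conv_bounded_linear[THEN iffD1] linearI)
     (auto simp: cvec_def vec_eq_iff scaleR_conv_of_real[where 'a=complex])

lemma norm_cvec: "norm (cvec v) = norm v"
  by (simp add: norm_vec_def L2_set_def cvec_def)

lemma clin_add: "clin L (v + w) = clin L v + clin L w"
  by (simp add: clin_def sum.distrib algebra_simps)

lemma clin_mult: "clin L (c *s w) = c * clin L w"
  by (simp add: clin_def sum_distrib_left algebra_simps)

lemma sum_axis: "(\<Sum>i\<in>UNIV. (v $ i) *\<^sub>R axis i 1) = (v :: real^'n)"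
  by (simp add: vec_eq_iff axis_def if_distrib cong: if_cong)

lemma clin_cvec: assumes "linear L" shows "clin L (cvec v) = L v"
proof -
  have "L v = L (\<Sum>i\<in>UNIV. (v $ i) *\<^sub>R axis i 1)"
    by (simp add: sum_axis)
  also have "\<dots> = clin L (cvec v)"
    by (simp add: linear_sum[OF assms] linear_cmul[OF assms] clin_def cvec_def scaleR_conv_of_real[where 'a=complex])
  finally show ?thesis by simp
qed

section \<open>Graph patches of a surface\<close>

text \<open>
  A patch is described by an open set \<open>W\<close> and an orthonormal frame \<open>q\<close>: inside \<open>W\<close>, the surface is the
  graph of \<open>\<gamma>\<close> over the plane of \<open>q 1\<close> and \<open>q 2\<close>, in direction \<open>q 3\<close>.  With a frame instead of a rotation
  all computations are inner products with \<open>q k\<close>.  Boundedness of \<open>W\<close> keeps the area of the patch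
  finite.
\<close>

locale graph_patch =
  fixes \<Gamma> W :: "(real^3) set" and q :: "3 \<Rightarrow> real^3" and \<gamma> :: "real^2 \<Rightarrow> real"
  assumes open_W: "open W" and bounded_W: "bounded W"
    and ortho: "\<And>i j. q i \<bullet> q j = (if i = j then 1 else 0)"
    and frame: "\<And>z. (\<Sum>k\<in>UNIV. (q k \<bullet> z) *\<^sub>R q k) = z"
    and C2_gamma: "C2_on UNIV \<gamma>"
    and graph: "\<Gamma> \<inter> W = {z \<in> W. \<gamma> (vector [q 1 \<bullet> z, q 2 \<bullet> z]) = q 3 \<bullet> z}"
begin

definition proj :: "real^3 \<Rightarrow> real^2" where
  "proj z = vector [q 1 \<bullet> z, q 2 \<bullet> z]"

definition X :: "real^2 \<Rightarrow> real^3" where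
  "X u = u $ 1 *\<^sub>R q 1 + u $ 2 *\<^sub>R q 2 + \<gamma> u *\<^sub>R q 3"

definition V :: "(real^2) set" where
  "V = X -` W"

definition g1 :: "real^2 \<Rightarrow> real" where
  "g1 u = frechet_derivative \<gamma> (at u) (axis 1 1)"

definition g2 :: "real^2 \<Rightarrow> real" where
  "g2 u = frechet_derivative \<gamma> (at u) (axis 2 1)"

text \<open>
  \<open>J\<close> is the area element of the chart \<open>X\<close>, \<open>N\<close> the upward normal of length \<open>J\<close>, and \<open>DX u\<close> the derivative of
  \<open>X\<close>, whose range is the tangent plane.
\<close>

definition J :: "real^2 \<Rightarrow> real" where
  "J u = sqrt (1 + g1 u * g1 u + g2 u * g2 u)"

definition N :: "real^2 \<Rightarrow> real^3" where
  "N u = q 3 - g1 u *\<^sub>R q 1 - g2 u *\<^sub>R q 2"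

definition DX :: "real^2 \<Rightarrow> real^2 \<Rightarrow> real^3" where
  "DX u h = h $ 1 *\<^sub>R (q 1 + g1 u *\<^sub>R q 3) + h $ 2 *\<^sub>R (q 2 + g2 u *\<^sub>R q 3)"

lemma proj_nth [simp]: "proj z $ 1 = q 1 \<bullet> z" "proj z $ 2 = q 2 \<bullet> z"
  by (simp_all add: proj_def)

lemma bounded_linear_proj: "bounded_linear proj"
  by (intro linear_conv_bounded_linear[THEN iffD1] linearI)
     (simp_all add: vec_eq_iff forall_2 inner_right_distrib)

lemma gamma_has_derivative:
  "(\<gamma> has_derivative (\<lambda>h. h $ 1 * g1 u + h $ 2 * g2 u)) (at u)"
proof -
  obtain f' where "(\<gamma> has_derivative blinfun_apply (f' u)) (at u)"
    using C2_gamma unfolding C2_on_def by blast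
  then have D: "(\<gamma> has_derivative frechet_derivative \<gamma> (at u)) (at u)"
    using frechet_derivative_at by metis
  have lin: "linear (frechet_derivative \<gamma> (at u))"
    using D has_derivative_linear by blast
  have "frechet_derivative \<gamma> (at u) h = h $ 1 * g1 u + h $ 2 * g2 u" for h
  proof -
    have "frechet_derivative \<gamma> (at u) h
        = frechet_derivative \<gamma> (at u) (\<Sum>i\<in>UNIV. (h $ i) *\<^sub>R axis i 1)"
      by (simp only: sum_axis)
    also have "\<dots> = h $ 1 * g1 u + h $ 2 * g2 u"
      by (simp only: sum_2 linear_add[OF lin] linear_cmul[OF lin] real_scaleR_def g1_def g2_def)
    finally show ?thesis .
  qed
  with D show ?thesis
    by (metis (no_types, lifting) ext)
qed

lemma C1_partials: "C1_on UNIV g1" "C1_on UNIV g2"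
proof -
  obtain f' where f': "\<And>x. (\<gamma> has_derivative blinfun_apply (f' x)) (at x)" "C1_on UNIV f'"
    using C2_gamma unfolding C2_on_def by blast
  have eq: "frechet_derivative \<gamma> (at x) = blinfun_apply (f' x)" for x
    using frechet_derivative_at[OF f'(1)] by simp
  have "bounded_linear (\<lambda>A::(real^2) \<Rightarrow>\<^sub>L real. blinfun_apply A h)" for h
    by (rule bounded_bilinear.bounded_linear_left[OF bounded_bilinear_blinfun_apply])
  from C1_on_linear_compose[OF this f'(2)]
  have "C1_on UNIV (\<lambda>x. frechet_derivative \<gamma> (at x) h)" for h
    by (simp add: eq)
  then show "C1_on UNIV g1" "C1_on UNIV g2"
    by (simp_all add: g1_def[abs_def] g2_def[abs_def])
qed

lemma C1_gamma: "C1_on UNIV \<gamma>"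
  by (rule C1_onI[OF gamma_has_derivative])
    (intro continuous_intros C1_partials[THEN C1_on_imp_continuous_on])

lemma mixed_partials:
  "frechet_derivative g1 (at u) (axis 2 1) = frechet_derivative g2 (at u) (axis 1 1)"
proof -
  have "(\<lambda>x. (axis 1 1 :: real^2) $ 1 * g1 x + (axis 1 1 :: real^2) $ 2 * g2 x) = g1"
    "(\<lambda>x. (axis 2 1 :: real^2) $ 1 * g1 x + (axis 2 1 :: real^2) $ 2 * g2 x) = g2"
    by (simp_all add: axis_def)
  then show ?thesis
    using mixed_partial_derivatives_commute[OF gamma_has_derivative, of "axis 1 1" "axis 2 1" u] C1_partials
    by simp
qed

lemma J_pos: "J u > 0"
  unfolding J_def by (simp add: add_pos_nonneg)

lemma J_square: "J u * J u = 1 + g1 u * g1 u + g2 u * g2 u"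
  unfolding J_def by (simp add: add_nonneg_nonneg)

lemma C1_J: "C1_on UNIV J"
  unfolding J_def[abs_def]
  by (intro C1_on_sqrt C1_on_add C1_on_const C1_on_mult C1_partials) (simp add: add_pos_nonneg)

lemma C1_N: "C1_on UNIV N"
  unfolding N_def[abs_def]
  by (intro C1_on_diff C1_on_const C1_on_scaleR C1_partials)

lemma X_has_derivative: "(X has_derivative DX u) (at u)"
proof -
  have "(X has_derivative (\<lambda>h. h $ 1 *\<^sub>R q 1 + h $ 2 *\<^sub>R q 2
      + (h $ 1 * g1 u + h $ 2 * g2 u) *\<^sub>R q 3)) (at u)"
    unfolding X_def[abs_def]
    by (intro has_derivative_add has_derivative_scaleR_left gamma_has_derivative
        bounded_linear_imp_has_derivative bounded_linear_vec_nth)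
  then show ?thesis
    by (rule has_derivative_eq_rhs) (simp add: DX_def fun_eq_iff algebra_simps)
qed

lemma C1_X: "C1_on UNIV X"
  unfolding X_def[abs_def]
  by (intro C1_on_add C1_on_scaleR C1_on_const C1_gamma C1_on_bounded_linear bounded_linear_vec_nth)

lemma continuous_X: "continuous_on S X"
  using C1_on_imp_continuous_on[OF C1_X] continuous_on_subset by blast

lemma C2_X: "C2_on S X"
proof -
  obtain f' where f': "\<And>x. (\<gamma> has_derivative blinfun_apply (f' x)) (at x)" "C1_on UNIV f'"
    using C2_gamma unfolding C2_on_def by blast
  define L where "L = Blinfun (\<lambda>h::real^2. h $ 1 *\<^sub>R q 1 + h $ 2 *\<^sub>R q 2)"
  have "bounded_linear (\<lambda>h::real^2. h $ 1 *\<^sub>R q 1 + h $ 2 *\<^sub>R q 2)"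
    by (intro bounded_linear_add bounded_linear_scaleR_const bounded_linear_vec_nth)
  then have L: "blinfun_apply L h = h $ 1 *\<^sub>R q 1 + h $ 2 *\<^sub>R q 2" for h
    by (simp add: L_def bounded_linear_Blinfun_apply)
  let ?X' = "\<lambda>u. L + (blinfun_scaleR_left (q 3) o\<^sub>L f' u)"
  have "(X has_derivative blinfun_apply (?X' u)) (at u)" for u
  proof -
    have "(X has_derivative (\<lambda>h. h $ 1 *\<^sub>R q 1 + h $ 2 *\<^sub>R q 2 + f' u h *\<^sub>R q 3)) (at u)"
      unfolding X_def[abs_def]
      by (intro has_derivative_add has_derivative_scaleR_left f'
          bounded_linear_imp_has_derivative bounded_linear_vec_nth)
    then show ?thesis
      by (rule has_derivative_eq_rhs) (simp add: L fun_eq_iff blinfun.bilinear_simps)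
  qed
  moreover have "C1_on UNIV ?X'"
    by (intro C1_on_add C1_on_const
        C1_on_linear_compose[OF bounded_bilinear.bounded_linear_right[OF bounded_bilinear_blinfun_compose] f'(2)])
  ultimately show ?thesis
    unfolding C2_on_def by (intro exI[of _ ?X']) (auto intro: C1_on_subset)
qed

lemma proj_X [simp]: "proj (X u) = u"
  by (simp add: vec_eq_iff forall_2 X_def inner_add_right ortho)

lemma X_proj: assumes "z \<in> \<Gamma>" "z \<in> W" shows "X (proj z) = z"
proof -
  have "\<gamma> (proj z) = q 3 \<bullet> z"
    using graph assms unfolding proj_def by blast
  then show ?thesis
    using frame[of z] by (simp add: X_def sum_3)
qed

lemma q3_X: "q 3 \<bullet> X u = \<gamma> u"
  by (simp add: X_def inner_add_right ortho)

lemma X_in: "u \<in> V \<Longrightarrow> X u \<in> \<Gamma> \<inter> W"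
  using graph by (auto simp: V_def q3_X proj_def[symmetric])

lemma X_image: "X ` V = \<Gamma> \<inter> W"
proof (intro set_eqI iffI)
  show "z \<in> \<Gamma> \<inter> W" if "z \<in> X ` V" for z
    using that X_in by auto
  show "z \<in> X ` V" if "z \<in> \<Gamma> \<inter> W" for z
    using that X_proj[of z] by (intro image_eqI[of _ _ "proj z"]) (auto simp: V_def)
qed

lemma proj_in: "z \<in> \<Gamma> \<Longrightarrow> z \<in> W \<Longrightarrow> proj z \<in> V"
  using X_proj by (auto simp: V_def)

lemma open_V: "open V"
  unfolding V_def using open_W continuous_X by (rule open_vimage)

lemma bounded_V: "bounded V"
proof -
  have "V \<subseteq> proj ` W"
    using proj_X by (force simp: V_def image_iff)
  then show ?thesis
    using bounded_linear_image[OF bounded_W bounded_linear_proj] bounded_subset by blast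
qed

lemma continuous_proj: "continuous_on S proj"
  by (rule linear_continuous_on[OF bounded_linear_proj])

lemma homeomorphism_X: "homeomorphism V (X ` V) X proj"
  unfolding homeomorphism_def by (auto simp: continuous_X continuous_proj image_image)

lemma frechet_derivative_X: "frechet_derivative X (at u) = DX u"
  using frechet_derivative_at[OF X_has_derivative] by simp

lemma proj_DX [simp]: "proj (DX u h) = h"
  by (simp add: vec_eq_iff forall_2 DX_def inner_add_right ortho)

lemma N_DX: "N u \<bullet> DX u h = 0"
  by (simp add: N_def DX_def inner_add_right inner_diff_left ortho algebra_simps)

lemma N_square: "N u \<bullet> N u = J u * J u"
  by (simp add: N_def J_square inner_diff_left inner_diff_right ortho algebra_simps)

lemma tangent_eq_DX:
  assumes "N u \<bullet> v = 0" shows "v = DX u (proj v)"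
proof -
  have "q 3 \<bullet> v = g1 u * (q 1 \<bullet> v) + g2 u * (q 2 \<bullet> v)"
    using assms by (simp add: N_def inner_diff_left)
  then show ?thesis
    using frame[of v] by (simp add: DX_def sum_3 algebra_simps)
qed

lemma regular_parametrization_X: "regular_parametrization \<Gamma> V X"
  unfolding regular_parametrization_def
proof (intro conjI ballI)
  show "inj (frechet_derivative X (at u))" for u
    unfolding frechet_derivative_X by (metis injI proj_DX)
  show "openin (top_of_set \<Gamma>) (X ` V)"
    unfolding X_image by (simp add: open_W openin_open_Int)
qed (use open_V C2_X homeomorphism_X in auto)

lemma area_element_X: "area_element X u = J u"
proof -
  let ?a = "DX u (axis 1 1)" and ?b = "DX u (axis 2 1)"
  have a: "?a = q 1 + g1 u *\<^sub>R q 3" and b: "?b = q 2 + g2 u *\<^sub>R q 3"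
    by (simp_all add: DX_def axis_def)
  have "(norm (cross3 ?a ?b))\<^sup>2 = (?a \<bullet> ?a) * (?b \<bullet> ?b) - (?a \<bullet> ?b)\<^sup>2"
    using norm_cross_dot[of ?a ?b] by (simp add: power_mult_distrib power2_norm_eq_inner)
  also have "\<dots> = (J u)\<^sup>2"
    unfolding a b by (simp add: inner_add_left inner_add_right ortho J_square power2_eq_square algebra_simps)
  finally show ?thesis
    using J_pos[of u] by (simp add: area_element_def frechet_derivative_X)
qed

end


section \<open>The boundary as a union of graph patches\<close>

lemma exterior_domain_open: "exterior_domain \<Omega> \<Longrightarrow> open \<Omega>"
  unfolding exterior_domain_def by auto

lemma exterior_domain_compact_frontier:
  assumes "exterior_domain \<Omega>" shows "compact (frontier \<Omega>)"
proof -
  obtain \<D> where \<D>: "finite \<D>" "\<forall>B\<in>\<D>. bounded B" "\<Omega> = - closure (\<Union>\<D>)"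
    using assms unfolding exterior_domain_def by blast
  have "bounded (closure (\<Union>\<D>))"
    using \<D>(1,2) by (intro bounded_closure bounded_Union) auto
  moreover have "frontier \<Omega> \<subseteq> closure (\<Union>\<D>)"
    unfolding \<D>(3) frontier_complement by (simp add: frontier_closures)
  ultimately show ?thesis
    using bounded_subset compact_eq_bounded_closed frontier_closed by blast
qed

text \<open>
  Points below the graph are outside the closure of the domain, points above it are inside the
  domain, and moving a point of the graph upwards enters the domain.
\<close>

lemma frontier_graph_patch:
  assumes ext: "exterior_domain \<Omega>" and bd: "C2_boundary \<Omega>" and y: "y \<in> frontier \<Omega>"
  shows "\<exists>W q \<gamma>. graph_patch (frontier \<Omega>) W q \<gamma> \<and> y \<in> W"
proof -
  obtain r and R :: "real^3 \<Rightarrow> real^3" and \<gamma> :: "real^2 \<Rightarrow> real" where r: "r > 0" and R: "orthogonal_transformation R" and \<gamma>: "C2_on UNIV \<gamma>"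
    and G: "\<Omega> \<inter> ball y r = {z \<in> ball y r. \<gamma> (vector [R z $ 1, R z $ 2]) < R z $ 3}"
    using bspec[OF bd[unfolded C2_boundary_def] y] by blast
  define q where "q k = inv R (axis k 1)" for k :: 3
  have Rq: "R (q k) = axis k 1" for k
    using orthogonal_transformation_surj[OF R] by (simp add: q_def surj_f_inv_f)
  have inner: "q k \<bullet> z = R z $ k" for k z
    using R Rq[of k] unfolding orthogonal_transformation_def by (metis cart_eq_inner_axis inner_commute)
  have ortho: "q i \<bullet> q j = (if i = j then 1 else 0)" for i j
    unfolding inner Rq by (simp add: axis_def)
  have linR: "linear R"
    using R orthogonal_transformation_def by blast
  have frame: "(\<Sum>k\<in>UNIV. (q k \<bullet> z) *\<^sub>R q k) = z" for z
  proof -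
    have "R (\<Sum>k\<in>UNIV. (q k \<bullet> z) *\<^sub>R q k) = R z"
      by (simp add: linear_sum[OF linR] linear_cmul[OF linR] inner Rq sum_axis)
    then show ?thesis
      using orthogonal_transformation_inj[OF R] by (simp add: inj_eq)
  qed
  define P :: "real^3 \<Rightarrow> real^2" where "P z = vector [q 1 \<bullet> z, q 2 \<bullet> z]" for z
  have linP: "linear P"
    by (rule linearI) (simp_all add: P_def vec_eq_iff forall_2 inner_add_right)
  obtain f' where "\<And>x. (\<gamma> has_derivative blinfun_apply (f' x)) (at x)"
    using \<gamma> unfolding C2_on_def by blast
  then have cont\<gamma>: "continuous_on UNIV \<gamma>"
    by (meson continuous_at_imp_continuous_on has_derivative_continuous)
  have contP: "continuous_on S (\<lambda>z. \<gamma> (P z))" for S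
    by (rule continuous_on_compose2[OF cont\<gamma> linear_continuous_on])
      (use linP linear_conv_bounded_linear in auto)
  have G': "z \<in> \<Omega> \<longleftrightarrow> \<gamma> (P z) < q 3 \<bullet> z" if "z \<in> ball y r" for z
    using G that unfolding P_def inner by blast
  have fr: "frontier \<Omega> = closure \<Omega> - \<Omega>"
    using exterior_domain_open[OF ext] by (simp add: frontier_def interior_open)
  have "frontier \<Omega> \<inter> ball y r = {z \<in> ball y r. \<gamma> (P z) = q 3 \<bullet> z}"
  proof (intro set_eqI iffI)
    fix z assume z: "z \<in> frontier \<Omega> \<inter> ball y r"
    then have "\<not> \<gamma> (P z) < q 3 \<bullet> z"
      using G' fr by blast
    moreover have "\<not> \<gamma> (P z) > q 3 \<bullet> z"
    proof
      assume *: "\<gamma> (P z) > q 3 \<bullet> z"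
      let ?U = "{z. q 3 \<bullet> z < \<gamma> (P z)} \<inter> ball y r"
      have "open ?U"
        by (intro open_Int open_Collect_less continuous_intros contP) auto
      moreover have "?U \<inter> \<Omega> = {}"
        using G' by force
      ultimately have "?U \<inter> closure \<Omega> = {}"
        using open_Int_closure_eq_empty by blast
      then show False
        using z * fr by blast
    qed
    ultimately show "z \<in> {z \<in> ball y r. \<gamma> (P z) = q 3 \<bullet> z}"
      using z by auto
  next
    fix z assume z: "z \<in> {z \<in> ball y r. \<gamma> (P z) = q 3 \<bullet> z}"
    have "z \<in> closure \<Omega>"
    proof (rule closure_approachable[THEN iffD2], intro allI impI)
      fix e :: real assume "e > 0"
      define t where "t = min (e / 2) ((r - dist y z) / 2)"
      have t: "t > 0" "t < e" "t < r - dist y z"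
        using \<open>e > 0\<close> z by (auto simp: t_def min_def field_simps)
      have nq: "norm (q 3) = 1"
        using ortho[of 3 3] by (simp add: norm_eq_sqrt_inner)
      have d: "dist (z + t *\<^sub>R q 3) z = t"
        using t nq by (simp add: dist_norm)
      then have "z + t *\<^sub>R q 3 \<in> ball y r"
        using t dist_triangle[of y "z + t *\<^sub>R q 3" z] by (simp add: dist_commute)
      moreover have "P (z + t *\<^sub>R q 3) = P z"
        by (simp add: P_def inner_add_right ortho)
      ultimately have "z + t *\<^sub>R q 3 \<in> \<Omega>"
        using G' z t by (simp add: inner_add_right ortho)
      then show "\<exists>w\<in>\<Omega>. dist w z < e"
        by (rule bexI[rotated]) (simp only: d t)
    qed
    then show "z \<in> frontier \<Omega> \<inter> ball y r"
      using z G' fr by auto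
  qed
  then have "graph_patch (frontier \<Omega>) (ball y r) q \<gamma>"
    unfolding P_def using ortho frame \<gamma> by unfold_locales auto
  with r show ?thesis
    by (meson centre_in_ball)
qed

section \<open>Existence of the surface measure\<close>

text \<open>
  Finiteness of the integral of \<open>f\<close> makes the change of variables for absolutely integrable functions
  applicable; its conclusion is stated here for nonnegative integrals, where measures are computed.
\<close>

lemma nn_integral_change_of_variables:
  fixes \<psi> :: "real^'n::{finite,wellorder} \<Rightarrow> real^'n::_" and f :: "real^'n::_ \<Rightarrow> real"
  assumes S: "S \<in> sets borel" and inj: "inj_on \<psi> S"
    and deriv: "\<And>x. x \<in> S \<Longrightarrow> (\<psi> has_derivative \<psi>' x) (at x within S)"
    and f: "set_integrable lborel (\<psi> ` S) f" and nonneg: "\<And>x. f x \<ge> 0"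
  shows "(\<integral>\<^sup>+x. ennreal (indicator (\<psi> ` S) x * f x) \<partial>lborel)
       = (\<integral>\<^sup>+x. ennreal (indicator S x * (\<bar>det (matrix (\<psi>' x))\<bar> * f (\<psi> x))) \<partial>lborel)"
proof -
  have "f absolutely_integrable_on (\<psi> ` S)"
    using f unfolding set_integrable_def by (rule integrable_completion[THEN iffD2, rotated])
      (use f in \<open>auto simp: set_integrable_def\<close>)
  then have "(\<lambda>x. vec (f x) :: real^1) absolutely_integrable_on (\<psi> ` S)"
    by (simp add: absolutely_integrable_on_1_iff)
  moreover have S': "S \<in> sets lebesgue"
    using S by auto
  define b where "b = integral (\<psi> ` S) f"
  ultimately have "(\<lambda>x. \<bar>det (matrix (\<psi>' x))\<bar> *\<^sub>R vec (f (\<psi> x)) :: real^1) absolutely_integrable_on S"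
    and "integral S (\<lambda>x. \<bar>det (matrix (\<psi>' x))\<bar> *\<^sub>R vec (f (\<psi> x)) :: real^1) = vec b"
    using has_absolute_integral_change_of_variables[OF S' deriv inj, of "\<lambda>x. vec (f x) :: real^1" "vec b"]
    by (auto simp: b_def integral_on_1_eq)
  then have g: "(\<lambda>x. \<bar>det (matrix (\<psi>' x))\<bar> * f (\<psi> x)) absolutely_integrable_on S"
     "integral S (\<lambda>x. \<bar>det (matrix (\<psi>' x))\<bar> * f (\<psi> x)) = b"
    by (simp_all add: absolutely_integrable_on_1_iff integral_on_1_eq)
  then have "((\<lambda>x. \<bar>det (matrix (\<psi>' x))\<bar> * f (\<psi> x)) has_integral b) S"
    using set_lebesgue_integral_eq_integral(1)[OF g(1)] by (metis integrable_integral)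
  from nn_integral_has_integral_lebesgue[OF _ this]
  have "(\<integral>\<^sup>+x. ennreal (indicator S x * (\<bar>det (matrix (\<psi>' x))\<bar> * f (\<psi> x))) \<partial>lborel) = b"
    using nonneg by simp
  moreover have "(f has_integral b) (\<psi> ` S)"
    using set_borel_integral_eq_integral(1)[OF f] by (simp add: b_def integrable_integral)
  from nn_integral_has_integral_lebesgue[OF _ this]
  have "(\<integral>\<^sup>+x. ennreal (indicator (\<psi> ` S) x * f x) \<partial>lborel) = b"
    using nonneg by simp
  ultimately show ?thesis by simp
qed

lemma regular_parametrizationD:
  assumes "regular_parametrization \<Gamma> U Z"
  shows regular_parametrization_open: "open U"
    and regular_parametrization_has_derivative:
      "u \<in> U \<Longrightarrow> (Z has_derivative frechet_derivative Z (at u)) (at u)"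
    and regular_parametrization_continuous: "continuous_on U Z"
    and regular_parametrization_derivative_continuous:
      "continuous_on U (\<lambda>u. frechet_derivative Z (at u) h)"
    and regular_parametrization_inj: "inj_on Z U"
    and regular_parametrization_image: "Z ` U \<subseteq> \<Gamma>"
proof -
  note R = assms[unfolded regular_parametrization_def]
  show "open U" using R by blast
  obtain f' where f': "\<And>u. u \<in> U \<Longrightarrow> (Z has_derivative blinfun_apply (f' u)) (at u)" "C1_on U f'"
    using R unfolding C2_on_def by blast
  have "C1_on U Z"
    unfolding C1_on_def using f' C1_on_imp_continuous_on by blast
  then show "u \<in> U \<Longrightarrow> (Z has_derivative frechet_derivative Z (at u)) (at u)"
    and "continuous_on U Z"
    and "continuous_on U (\<lambda>u. frechet_derivative Z (at u) h)"
    using C1_on_has_derivative C1_on_imp_continuous_on C1_on_continuous_derivative by blast+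
  show "inj_on Z U"
    using R unfolding homeomorphism_def by (metis inj_onI)
  show "Z ` U \<subseteq> \<Gamma>"
    using R openin_imp_subset by blast
qed

lemma regular_parametrization_borel_image:
  assumes Z: "regular_parametrization \<Gamma> U Z" and \<Gamma>: "closed \<Gamma>" and A: "A \<in> sets borel" "A \<subseteq> U"
  shows "Z ` A \<in> sets borel"
proof -
  obtain Y where Y: "homeomorphism U (Z ` U) Z Y"
    using Z unfolding regular_parametrization_def by blast
  obtain T where "open T" "Z ` U = \<Gamma> \<inter> T"
    using Z unfolding regular_parametrization_def openin_open by blast
  then have ZU: "Z ` U \<in> sets borel"
    using \<Gamma> by auto
  have "Y \<in> borel_measurable (restrict_space borel (Z ` U))"
    using Y by (intro borel_measurable_continuous_on_restrict) (simp add: homeomorphism_def)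
  from measurable_sets[OF this A(1)] have "Y -` A \<inter> Z ` U \<in> sets (restrict_space borel (Z ` U))"
    by (simp add: space_restrict_space)
  moreover have "Y -` A \<inter> Z ` U = Z ` A"
    using Y A(2) unfolding homeomorphism_def by force
  ultimately show ?thesis
    using ZU by (simp add: sets_restrict_space_iff)
qed

lemma regular_parametrization_borel_preimage:
  assumes Z: "regular_parametrization \<Gamma> U Z" and A: "A \<in> sets borel" "A \<subseteq> U" and B: "B \<in> sets borel"
  shows "A \<inter> Z -` B \<in> sets borel"
proof -
  have "Z \<in> borel_measurable (restrict_space borel U)"
    by (intro borel_measurable_continuous_on_restrict regular_parametrization_continuous[OF Z])
  from measurable_sets[OF this B] have "Z -` B \<inter> U \<in> sets (restrict_space borel U)"
    by (simp add: space_restrict_space)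
  then have "Z -` B \<inter> U \<in> sets borel"
    using regular_parametrization_open[OF Z] by (simp add: sets_restrict_space_iff)
  with A(1) have "A \<inter> (Z -` B \<inter> U) \<in> sets borel"
    by auto
  moreover have "A \<inter> (Z -` B \<inter> U) = A \<inter> Z -` B"
    using A(2) by blast
  ultimately show ?thesis by simp
qed

lemma regular_parametrization_area_measurable:
  assumes Z: "regular_parametrization \<Gamma> U Z"
  shows "(\<lambda>u. indicator U u * area_element Z u) \<in> borel_measurable borel"
proof -
  have "continuous_on U (area_element Z)"
    unfolding area_element_def[abs_def]
    by (intro continuous_intros continuous_on_cross regular_parametrization_derivative_continuous[OF Z])
  from borel_measurable_continuous_on_indicator[OF _ this] show ?thesis
    using regular_parametrization_open[OF Z] by simp
qed

context graph_patch
begin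

lemma J_measurable [measurable]: "J \<in> borel_measurable borel"
  by (rule borel_measurable_continuous_onI[OF C1_on_imp_continuous_on[OF C1_J]])

lemma X_measurable [measurable]: "X \<in> borel_measurable borel"
  by (rule borel_measurable_continuous_onI[OF continuous_X])

lemma V_borel [measurable]: "V \<in> sets borel"
  using open_V by simp

lemma set_integrable_J: "set_integrable lborel V J"
proof -
  obtain r where r: "V \<subseteq> cball 0 r"
    using bounded_V by (auto simp: bounded_iff subset_eq)
  have "set_integrable lborel (cball 0 r) J"
    unfolding set_integrable_def
    by (rule borel_integrable_compact[OF compact_cball])
      (rule continuous_on_subset[OF C1_on_imp_continuous_on[OF C1_J] subset_UNIV])
  then show ?thesis
    by (rule set_integrable_subset) (use r in auto)
qed

text \<open>
  The chart change \<open>\<psi> = proj \<circ> Z\<close> satisfies \<open>Z = X \<circ> \<psi>\<close>; by the chain rule the area elements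
  of \<open>Z\<close> and \<open>X\<close> differ by the factor \<open>\<bar>det \<psi>'\<bar>\<close>.
\<close>

lemma area_element_chart_change:
  assumes Z: "regular_parametrization \<Gamma> U Z" and u: "u \<in> U" "Z u \<in> W"
  defines "D \<equiv> frechet_derivative Z (at u)"
  shows "area_element Z u = \<bar>det (matrix (\<lambda>h. proj (D h)))\<bar> * J (proj (Z u))"
proof -
  have D: "(Z has_derivative D) (at u)"
    unfolding D_def by (rule regular_parametrization_has_derivative[OF Z u(1)])
  have opn: "open (U \<inter> Z -` W)"
    using continuous_open_preimage regular_parametrization_continuous[OF Z]
      regular_parametrization_open[OF Z] open_W by blast
  have "((\<lambda>u. X (proj (Z u))) has_derivative (\<lambda>h. DX (proj (Z u)) (proj (D h)))) (at u)"
    using has_derivative_compose[OF has_derivative_compose[OF D bounded_linear_imp_has_derivative[OF bounded_linear_proj]]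
        X_has_derivative] .
  then have "(Z has_derivative (\<lambda>h. DX (proj (Z u)) (proj (D h)))) (at u)"
    by (rule has_derivative_transform_within_open[OF _ opn])
      (use u X_proj regular_parametrization_image[OF Z] in auto)
  then have DDX: "D h = DX (proj (Z u)) (proj (D h))" for h
    using has_derivative_unique[OF D] by metis
  let ?p = "proj (Z u)"
  let ?a = "proj (D (axis 1 1))" and ?b = "proj (D (axis 2 1))"
  have det: "det (matrix (\<lambda>h. proj (D h))) = ?a $ 1 * ?b $ 2 - ?b $ 1 * ?a $ 2"
    by (simp add: det_2 matrix_def)
  have cross: "cross3 (DX p a) (DX p b)
      = (a $ 1 * b $ 2 - b $ 1 * a $ 2) *\<^sub>R cross3 (DX p (axis 1 1)) (DX p (axis 2 1))" for p a b
  proof -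
    define e f where "e = DX p (axis 1 1)" and "f = DX p (axis 2 1)"
    have D2: "DX p h = h $ 1 *\<^sub>R e + h $ 2 *\<^sub>R f" for h
      by (simp add: DX_def e_def f_def axis_def)
    have "cross3 f e = - cross3 e f"
      by (rule cross_skew)
    then show ?thesis
      unfolding e_def[symmetric] f_def[symmetric]
      by (simp add: D2 cross_add_left cross_add_right cross_mult_left cross_mult_right algebra_simps)
  qed
  have "area_element Z u = norm (cross3 (DX ?p ?a) (DX ?p ?b))"
    unfolding area_element_def D_def[symmetric] using DDX by metis
  also have "\<dots> = \<bar>?a $ 1 * ?b $ 2 - ?b $ 1 * ?a $ 2\<bar> * area_element X ?p"
    using cross[of ?p ?a ?b] by (simp add: area_element_def frechet_derivative_X)
  finally show ?thesis
    unfolding det area_element_X .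
qed

text \<open>
  On a Borel piece \<open>B\<close> of the patch the surface measure is the image under \<open>X\<close> of Lebesgue measure with
  density \<open>J\<close>.  That it satisfies the area formula for every other parametrization \<open>Z\<close> is the change of
  variables under the chart change \<open>proj \<circ> Z\<close>.
\<close>

lemma patch_measure_exists:
  assumes closed: "closed \<Gamma>" and B: "B \<in> sets borel" "B \<subseteq> \<Gamma> \<inter> W"
  shows "\<exists>M. sets M = sets borel \<and> (\<forall>U Z A. regular_parametrization \<Gamma> U Z \<longrightarrow> A \<in> sets borel \<longrightarrow> A \<subseteq> U \<longrightarrow>
     emeasure M (Z ` A) = (\<integral>\<^sup>+u. ennreal (indicator (A \<inter> Z -` B) u * area_element Z u) \<partial>lborel))"
proof -
  have [measurable]: "B \<in> sets borel" by fact
  define M where "M = distr (density lborel (\<lambda>u. ennreal (indicator (V \<inter> X -` B) u * J u))) borel X"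
  have "emeasure M (Z ` A) = (\<integral>\<^sup>+u. ennreal (indicator (A \<inter> Z -` B) u * area_element Z u) \<partial>lborel)"
    if Z: "regular_parametrization \<Gamma> U Z" and A: "A \<in> sets borel" "A \<subseteq> U" for U Z A
  proof -
    have [measurable]: "Z ` A \<in> sets borel"
      by (rule regular_parametrization_borel_image[OF Z closed A])
    have [measurable]: "X -` Z ` A \<in> sets borel" "X -` B \<in> sets borel"
      using measurable_sets[OF X_measurable \<open>Z ` A \<in> sets borel\<close>]
        measurable_sets[OF X_measurable B(1)] by simp_all
    define S where "S = A \<inter> Z -` B"
    have S: "S \<in> sets borel"
      unfolding S_def by (rule regular_parametrization_borel_preimage[OF Z A B(1)])
    define \<psi> where "\<psi> u = proj (Z u)" for u
    have XZ: "X (\<psi> u) = Z u" if "u \<in> S" for u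
      using that B X_proj by (auto simp: \<psi>_def S_def)
    have img: "\<psi> ` S = V \<inter> X -` (Z ` A \<inter> B)"
    proof (intro set_eqI iffI)
      fix w assume "w \<in> \<psi> ` S"
      then obtain u where u: "u \<in> S" "w = \<psi> u" by blast
      then have "Z u \<in> B" by (auto simp: S_def)
      then show "w \<in> V \<inter> X -` (Z ` A \<inter> B)"
        using u XZ[OF u(1)] B proj_in by (auto simp: \<psi>_def S_def)
    next
      fix w assume w: "w \<in> V \<inter> X -` (Z ` A \<inter> B)"
      then obtain u where u: "u \<in> A" "X w = Z u" by auto
      then have "u \<in> S"
        using w by (simp add: S_def)
      moreover have "w = \<psi> u"
        using u proj_X by (metis \<psi>_def)
      ultimately show "w \<in> \<psi> ` S" by blast
    qed
    have "emeasure M (Z ` A) = emeasure (density lborel (\<lambda>u. ennreal (indicator (V \<inter> X -` B) u * J u))) (X -` Z ` A)"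
      unfolding M_def by (subst emeasure_distr) auto
    also have "\<dots> = (\<integral>\<^sup>+u. ennreal (indicator (V \<inter> X -` B) u * J u) * indicator (X -` Z ` A) u \<partial>lborel)"
      by (rule emeasure_density) auto
    also have "\<dots> = (\<integral>\<^sup>+u. ennreal (indicator (\<psi> ` S) u * J u) \<partial>lborel)"
      unfolding img by (intro nn_integral_cong) (auto simp: indicator_def)
    also have "\<dots> = (\<integral>\<^sup>+u. ennreal (indicator S u *
        (\<bar>det (matrix (\<lambda>h. proj (frechet_derivative Z (at u) h)))\<bar> * J (\<psi> u))) \<partial>lborel)"
    proof (rule nn_integral_change_of_variables[OF S])
      show "inj_on \<psi> S"
      proof (rule inj_onI)
        fix u v assume "u \<in> S" "v \<in> S" "\<psi> u = \<psi> v"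
        then have "Z u = Z v" "u \<in> U" "v \<in> U"
          using XZ A(2) by (metis, auto simp: S_def)
        then show "u = v"
          using regular_parametrization_inj[OF Z] by (simp add: inj_on_def)
      qed
      show "(\<psi> has_derivative (\<lambda>h. proj (frechet_derivative Z (at u) h))) (at u within S)" if "u \<in> S" for u
        unfolding \<psi>_def[abs_def] using that A(2)
        by (intro bounded_linear.has_derivative[OF bounded_linear_proj]
            has_derivative_at_withinI[OF regular_parametrization_has_derivative[OF Z]]) (auto simp: S_def)
      have "\<psi> ` S \<in> sets borel"
        unfolding img vimage_Int by auto
      then show "set_integrable lborel (\<psi> ` S) J"
        by (intro set_integrable_subset[OF set_integrable_J]) (auto simp: img)
      show "0 \<le> J w" for w
        using J_pos[of w] by simp
    qed
    also have "\<dots> = (\<integral>\<^sup>+u. ennreal (indicator S u * area_element Z u) \<partial>lborel)"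
    proof (intro nn_integral_cong)
      fix u
      show "ennreal (indicator S u * (\<bar>det (matrix (\<lambda>h. proj (frechet_derivative Z (at u) h)))\<bar> * J (\<psi> u)))
          = ennreal (indicator S u * area_element Z u)"
      proof (cases "u \<in> S")
        case True
        then have "u \<in> U" "Z u \<in> W"
          using A B by (auto simp: S_def)
        from area_element_chart_change[OF Z this] show ?thesis
          by (simp add: \<psi>_def)
      qed simp
    qed
    finally show ?thesis
      unfolding S_def .
  qed
  then show ?thesis
    by (intro exI[of _ M]) (auto simp: M_def)
qed

end

lemma finite_sum_measure_exists:
  fixes M :: "'i \<Rightarrow> 'a measure"
  assumes fin: "finite I" and sets: "\<And>i. i \<in> I \<Longrightarrow> sets (M i) = sets N"
  shows "\<exists>\<mu>. sets \<mu> = sets N \<and> (\<forall>E\<in>sets N. emeasure \<mu> E = (\<Sum>i\<in>I. emeasure (M i) E))"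
proof -
  define \<mu> where "\<mu> = measure_of (space N) (sets N) (\<lambda>E. \<Sum>i\<in>I. emeasure (M i) E)"
  have s: "sets \<mu> = sets N"
    unfolding \<mu>_def by (simp add: sets.space_closed)
  have "emeasure \<mu> E = (\<Sum>i\<in>I. emeasure (M i) E)" if "E \<in> sets N" for E
  proof (rule emeasure_measure_of[OF \<mu>_def])
    show "sets N \<subseteq> Pow (space N)"
      by (rule sets.space_closed)
    show "positive (sets \<mu>) (\<lambda>E. \<Sum>i\<in>I. emeasure (M i) E)"
      by (simp add: positive_def)
    show "countably_additive (sets \<mu>) (\<lambda>E. \<Sum>i\<in>I. emeasure (M i) E)"
    proof (rule countably_additiveI)
      fix A :: "nat \<Rightarrow> 'a set" assume A: "range A \<subseteq> sets \<mu>" "disjoint_family A"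
      have "(\<Sum>n. \<Sum>i\<in>I. emeasure (M i) (A n)) = (\<Sum>i\<in>I. \<Sum>n. emeasure (M i) (A n))"
        by (rule suminf_sum) auto
      also have "\<dots> = (\<Sum>i\<in>I. emeasure (M i) (\<Union>n. A n))"
        by (rule sum.cong) (use A s sets in \<open>auto intro!: suminf_emeasure\<close>)
      finally show "(\<Sum>n. \<Sum>i\<in>I. emeasure (M i) (A n)) = (\<Sum>i\<in>I. emeasure (M i) (\<Union>n. A n))" .
    qed
    show "E \<in> sets \<mu>"
      using that s by simp
  qed
  with s show ?thesis by blast
qed

text \<open>
  Cut the surface into finitely many Borel pieces, each in one graph patch, and add up the
  measures of the pieces.
\<close>

lemma surface_measure_exists:
  assumes comp: "compact \<Gamma>" and patch: "\<And>y. y \<in> \<Gamma> \<Longrightarrow> \<exists>W q \<gamma>. graph_patch \<Gamma> W q \<gamma> \<and> y \<in> W"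
  shows "\<exists>\<mu>. is_surface_measure \<Gamma> \<mu>"
proof -
  have cl: "closed \<Gamma>" using comp compact_imp_closed by blast
  obtain Ws where Ws: "finite Ws" "\<Gamma> \<subseteq> \<Union>Ws" "\<forall>W\<in>Ws. \<exists>q \<gamma>. graph_patch \<Gamma> W q \<gamma>"
  proof -
    let ?C = "{W. \<exists>q \<gamma>. graph_patch \<Gamma> W q \<gamma>}"
    have cov: "\<Gamma> \<subseteq> \<Union>?C"
      using patch by blast
    have opn: "open W" if "W \<in> ?C" for W
      using graph_patch.open_W that by blast
    obtain D where "D \<subseteq> ?C" "finite D" "\<Gamma> \<subseteq> \<Union>D"
      by (rule compactE[OF comp cov opn])
    then show ?thesis
      using that by blast
  qed
  obtain n and W :: "nat \<Rightarrow> (real^3) set" where W: "Ws = W ` {..<n}"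
    using Ws(1) by (metis finite_imp_nat_seg_image_inj_on lessThan_def)
  have opn: "open (W k)" if "k < n" for k
    using Ws(3) W that graph_patch.open_W by blast
  \<comment> \<open>disjoint pieces, so that no part of the surface is counted twice\<close>
  define B where "B k = \<Gamma> \<inter> W k - (\<Union>j<k. W j)" for k
  have B: "B k \<in> sets borel" "B k \<subseteq> \<Gamma> \<inter> W k" if "k < n" for k
    using that opn cl by (auto simp: B_def intro!: sets.Diff sets.Int sets.finite_UN)
  have B_unique: "\<exists>!k. k < n \<and> z \<in> B k" if z: "z \<in> \<Gamma>" for z
  proof -
    define k where "k = (LEAST k. z \<in> W k)"
    obtain m where m: "m < n" "z \<in> W m"
      using z Ws(2) W by blast
    have k: "z \<in> W k" "k \<le> m" "\<And>j. j < k \<Longrightarrow> z \<notin> W j"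
      unfolding k_def using m by (auto intro: LeastI Least_le dest: not_less_Least)
    show ?thesis
    proof (rule ex1I[of _ k])
      show "k < n \<and> z \<in> B k"
        using z k m by (auto simp: B_def)
      show "l = k" if "l < n \<and> z \<in> B l" for l
      proof (rule ccontr)
        assume "l \<noteq> k"
        then have "l < k \<or> k < l" by auto
        then show False
          using that k by (auto simp: B_def)
      qed
    qed
  qed
  define Q where "Q k M \<longleftrightarrow> sets M = sets borel \<and> (\<forall>U Z A. regular_parametrization \<Gamma> U Z \<longrightarrow> A \<in> sets borel \<longrightarrow> A \<subseteq> U \<longrightarrow>
     emeasure M (Z ` A) = (\<integral>\<^sup>+u. ennreal (indicator (A \<inter> Z -` B k) u * area_element Z u) \<partial>lborel))"
    for k and M :: "(real^3) measure"
  have "\<exists>M. Q k M" if "k \<in> {..<n}" for k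
  proof -
    obtain q \<gamma> where "graph_patch \<Gamma> (W k) q \<gamma>"
      using Ws(3) W \<open>k \<in> {..<n}\<close> by blast
    from graph_patch.patch_measure_exists[OF this cl B] \<open>k \<in> {..<n}\<close>
    show ?thesis
      unfolding Q_def by simp
  qed
  then obtain M where Q: "\<And>k. k \<in> {..<n} \<Longrightarrow> Q k (M k)"
    using bchoice[of "{..<n}" Q] by blast
  have M: "sets (M k) = sets borel"
    "regular_parametrization \<Gamma> U Z \<Longrightarrow> A \<in> sets borel \<Longrightarrow> A \<subseteq> U \<Longrightarrow>
      emeasure (M k) (Z ` A) = (\<integral>\<^sup>+u. ennreal (indicator (A \<inter> Z -` B k) u * area_element Z u) \<partial>lborel)"
    if "k < n" for k U Z A
    using Q[of k] that unfolding Q_def by simp_all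
  obtain \<mu> where \<mu>: "sets \<mu> = sets borel" "\<And>E. E \<in> sets borel \<Longrightarrow> emeasure \<mu> E = (\<Sum>k<n. emeasure (M k) E)"
    using finite_sum_measure_exists[of "{..<n}" M borel] M(1) by auto
  have "is_surface_measure \<Gamma> (restrict_space \<mu> \<Gamma>)"
    unfolding is_surface_measure_def
  proof (intro conjI allI impI)
    show "sets (restrict_space \<mu> \<Gamma>) = sets (restrict_space borel \<Gamma>)"
      using \<mu>(1) by (rule sets_restrict_space_cong)
    fix U :: "(real^2) set" and Z A
    assume Z: "regular_parametrization \<Gamma> U Z" and A: "A \<in> sets borel" "A \<subseteq> U"
    have ZA: "Z ` A \<subseteq> \<Gamma>"
      using regular_parametrization_image[OF Z] A by blast
    have meas: "(\<lambda>u. ennreal (indicator (A \<inter> Z -` B k) u * area_element Z u)) \<in> borel_measurable lborel" if "k < n" for k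
    proof -
      have [measurable]: "A \<inter> Z -` B k \<in> sets borel"
        by (rule regular_parametrization_borel_preimage[OF Z A B(1)[OF that]])
      have [measurable]: "(\<lambda>u. indicator U u * area_element Z u) \<in> borel_measurable borel"
        by (rule regular_parametrization_area_measurable[OF Z])
      have "(\<lambda>u. ennreal (indicator (A \<inter> Z -` B k) u * (indicator U u * area_element Z u))) \<in> borel_measurable lborel"
        by measurable
      also have "(\<lambda>u. ennreal (indicator (A \<inter> Z -` B k) u * (indicator U u * area_element Z u)))
         = (\<lambda>u. ennreal (indicator (A \<inter> Z -` B k) u * area_element Z u))"
        using A(2) by (auto simp: fun_eq_iff indicator_def)
      finally show ?thesis .
    qed
    have "emeasure (restrict_space \<mu> \<Gamma>) (Z ` A) = emeasure \<mu> (Z ` A)"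
      by (rule emeasure_restrict_space) (use ZA cl \<mu>(1) sets_eq_imp_space_eq[OF \<mu>(1)] in auto)
    also have "\<dots> = (\<Sum>k<n. emeasure (M k) (Z ` A))"
      by (rule \<mu>(2)[OF regular_parametrization_borel_image[OF Z cl A]])
    also have "\<dots> = (\<Sum>k<n. \<integral>\<^sup>+u. ennreal (indicator (A \<inter> Z -` B k) u * area_element Z u) \<partial>lborel)"
      by (rule sum.cong) (use M(2)[OF _ Z A] in auto)
    also have "\<dots> = (\<integral>\<^sup>+u. (\<Sum>k<n. ennreal (indicator (A \<inter> Z -` B k) u * area_element Z u)) \<partial>lborel)"
      by (rule nn_integral_sum[symmetric]) (use meas in auto)
    also have "\<dots> = (\<integral>\<^sup>+u\<in>A. ennreal (area_element Z u) \<partial>lborel)"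
    proof (rule nn_integral_cong)
      fix u
      show "(\<Sum>k<n. ennreal (indicator (A \<inter> Z -` B k) u * area_element Z u)) = ennreal (area_element Z u) * indicator A u"
      proof (cases "u \<in> A")
        case True
        then have "Z u \<in> \<Gamma>"
          using ZA by blast
        from B_unique[OF this] obtain k where
          "k < n \<and> Z u \<in> B k" "\<forall>l. l < n \<and> Z u \<in> B l \<longrightarrow> l = k"
          by (rule ex1E)
        then have k: "k < n" "\<And>l. l < n \<Longrightarrow> Z u \<in> B l \<longleftrightarrow> l = k"
          by blast+
        have "(\<Sum>l<n. ennreal (indicator (A \<inter> Z -` B l) u * area_element Z u))
            = (\<Sum>l<n. if l = k then ennreal (area_element Z u) else 0)"
          by (rule sum.cong) (use True k in \<open>auto simp: indicator_def\<close>)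
        with k(1) True show ?thesis
          by simp
      qed simp
    qed
    finally show "emeasure (restrict_space \<mu> \<Gamma>) (Z ` A) = (\<integral>\<^sup>+u\<in>A. ennreal (area_element Z u) \<partial>lborel)" .
  qed
  then show ?thesis by blast
qed


section \<open>Integration over a compact surface of class C2\<close>

text \<open>
  The boundary of the exterior domain enters the analysis through two properties: it is compact,
  and every point has a graph patch.
\<close>

locale compact_C2_surface =
  fixes \<Gamma> :: "(real^3) set"
  assumes compact_surface: "compact \<Gamma>"
    and patches: "\<And>y. y \<in> \<Gamma> \<Longrightarrow> \<exists>W q \<gamma>. graph_patch \<Gamma> W q \<gamma> \<and> y \<in> W"
begin

abbreviation S :: "(real^3) measure" where
  "S \<equiv> surface_measure \<Gamma>"

lemma closed_surface: "closed \<Gamma>"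
  using compact_surface compact_imp_closed by blast

lemma is_surface_measure: "is_surface_measure \<Gamma> S"
  unfolding surface_measure_def
  by (rule someI_ex[OF surface_measure_exists[OF compact_surface patches]])

lemma sets_S: "sets S = sets (restrict_space borel \<Gamma>)"
  using is_surface_measure unfolding is_surface_measure_def by blast

lemma space_S [simp]: "space S = \<Gamma>"
  using sets_eq_imp_space_eq[OF sets_S] by (simp add: space_restrict_space)

lemma emeasure_S_patch:
  assumes "graph_patch \<Gamma> W q \<gamma>" "A \<in> sets borel" "A \<subseteq> graph_patch.V W q \<gamma>"
  shows "emeasure S (graph_patch.X q \<gamma> ` A)
      = (\<integral>\<^sup>+u. ennreal (indicator A u * graph_patch.J \<gamma> u) \<partial>lborel)"
proof -
  interpret graph_patch \<Gamma> W q \<gamma> by fact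
  have "emeasure S (X ` A) = (\<integral>\<^sup>+u\<in>A. ennreal (area_element X u) \<partial>lborel)"
    using is_surface_measure regular_parametrization_X assms(2,3)
    unfolding is_surface_measure_def by blast
  also have "\<dots> = (\<integral>\<^sup>+u. ennreal (indicator A u * J u) \<partial>lborel)"
    by (intro nn_integral_cong) (auto simp: area_element_X indicator_def)
  finally show ?thesis .
qed

lemma patch_in_sets:
  assumes "graph_patch \<Gamma> W q \<gamma>" shows "\<Gamma> \<inter> W \<in> sets S"
  using graph_patch.open_W[OF assms] unfolding sets_S sets_restrict_space by auto

lemma emeasure_patch_finite:
  assumes "graph_patch \<Gamma> W q \<gamma>"
  shows "emeasure S (\<Gamma> \<inter> W) < \<infinity>"
proof -
  interpret graph_patch \<Gamma> W q \<gamma> by fact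
  have "emeasure S (X ` V) = (\<integral>\<^sup>+u. ennreal (indicator V u * J u) \<partial>lborel)"
    by (rule emeasure_S_patch[OF assms V_borel]) simp
  also have "\<dots> < \<infinity>"
  proof -
    have "integrable lborel (\<lambda>u. indicator V u * J u)"
      using set_integrable_J unfolding set_integrable_def by simp
    then have "(\<integral>\<^sup>+u. ennreal (norm (indicator V u * J u)) \<partial>lborel) < \<infinity>"
      unfolding integrable_iff_bounded by blast
    moreover have "norm (indicator V u * J u) = indicator V u * J u" for u
      using J_pos[of u] by (simp add: indicator_def)
    ultimately show ?thesis by simp
  qed
  finally show ?thesis
    unfolding X_image .
qed

lemma finite_patch_cover:
  assumes "\<And>y. y \<in> \<Gamma> \<Longrightarrow> y \<in> U y \<and> open (U y)"
  obtains Y where "finite Y" "Y \<subseteq> \<Gamma>" "\<Gamma> \<subseteq> (\<Union>y\<in>Y. U y)"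
proof (rule compactE_image[OF compact_surface])
  show "open (U y)" if "y \<in> \<Gamma>" for y
    using assms[OF that] by blast
  show "\<Gamma> \<subseteq> (\<Union>y\<in>\<Gamma>. U y)"
    using assms by blast
qed (use that in blast)

lemma finite_measure_S: "finite_measure S"
proof
  obtain W where W: "\<And>y. y \<in> \<Gamma> \<Longrightarrow> y \<in> W y \<and> (\<exists>q \<gamma>. graph_patch \<Gamma> (W y) q \<gamma>)"
    using patches by metis
  have "y \<in> W y \<and> open (W y)" if "y \<in> \<Gamma>" for y
    using W[OF that] graph_patch.open_W by blast
  from finite_patch_cover[OF this] obtain Y where Y: "finite Y" "Y \<subseteq> \<Gamma>" "\<Gamma> \<subseteq> (\<Union>y\<in>Y. W y)"
    by blast
  have "emeasure S (\<Union>y\<in>Y. \<Gamma> \<inter> W y) \<le> (\<Sum>y\<in>Y. emeasure S (\<Gamma> \<inter> W y))"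
    by (rule emeasure_subadditive_finite) (use Y W patch_in_sets in blast)+
  also have "\<dots> < \<infinity>"
  proof -
    have "emeasure S (\<Gamma> \<inter> W y) < top" if "y \<in> Y" for y
      using W[of y] Y(2) that emeasure_patch_finite by auto
    then show ?thesis
      using Y(1) by simp
  qed
  also have "(\<Union>y\<in>Y. \<Gamma> \<inter> W y) = \<Gamma>"
    using Y by blast
  finally show "emeasure S (space S) \<noteq> \<infinity>"
    by simp
qed

lemma continuous_on_imp_measurable_S:
  assumes "continuous_on \<Gamma> f" shows "f \<in> borel_measurable S"
  using borel_measurable_continuous_on_restrict[OF assms] measurable_cong_sets[OF sets_S refl] by blast

lemma continuous_on_imp_integrable_S:
  fixes f :: "real^3 \<Rightarrow> 'b::{banach, second_countable_topology}"
  assumes "continuous_on \<Gamma> f" shows "integrable S f"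
proof -
  interpret finite_measure S by (rule finite_measure_S)
  have "bounded (f ` \<Gamma>)"
    using compact_continuous_image[OF assms compact_surface] compact_imp_bounded by blast
  then obtain B where "\<And>y. y \<in> \<Gamma> \<Longrightarrow> norm (f y) \<le> B"
    by (auto simp: bounded_iff)
  then show ?thesis
    by (intro integrable_const_bound[of _ B] continuous_on_imp_measurable_S assms) auto
qed

text \<open>
  The area formula says that the surface measure restricted to the patch and the image under \<open>X\<close> of
  Lebesgue measure with density \<open>J\<close> agree on all Borel sets; integrals of vector-valued functions then
  agree as well.
\<close>

lemma integral_over_patch:
  fixes f :: "real^3 \<Rightarrow> 'b::{banach, second_countable_topology}"
  assumes "graph_patch \<Gamma> W q \<gamma>" and f: "f \<in> borel_measurable S"
    and zero: "\<And>y. y \<in> \<Gamma> \<Longrightarrow> y \<notin> W \<Longrightarrow> f y = 0"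
  shows "(LINT y|S. f y) = (LINT u|lborel. indicator (graph_patch.V W q \<gamma>) u *\<^sub>R
      (graph_patch.J \<gamma> u *\<^sub>R f (graph_patch.X q \<gamma> u)))"
proof -
  interpret graph_patch \<Gamma> W q \<gamma> by fact
  have WS [measurable]: "\<Gamma> \<inter> W \<in> sets S"
    by (rule patch_in_sets[OF assms(1)])
  let ?L = "restrict_space lborel V"
  have VL: "V \<inter> space lborel \<in> sets lborel"
    by simp
  have XS [measurable]: "X \<in> measurable ?L S"
  proof -
    have "X \<in> measurable (restrict_space lborel V) (restrict_space borel \<Gamma>)"
      by (rule measurable_restrict_space3) (use X_in in auto)
    then show ?thesis
      using measurable_cong_sets[OF refl sets_S] by blast
  qed
  have JL [measurable]: "J \<in> borel_measurable ?L"
    by (rule measurable_restrict_space1) simp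
  have eq: "density S (\<lambda>y. ennreal (indicator (\<Gamma> \<inter> W) y)) = distr (density ?L (\<lambda>u. ennreal (J u))) S X"
  proof (rule measure_eqI)
    fix E assume "E \<in> sets (density S (\<lambda>y. ennreal (indicator (\<Gamma> \<inter> W) y)))"
    then have E [measurable]: "E \<in> sets S" by simp
    have "X -` E \<inter> space ?L \<in> sets ?L"
      by (rule measurable_sets[OF XS E])
    then have VE: "V \<inter> X -` E \<in> sets borel"
      using VL by (simp add: sets_restrict_space_iff space_restrict_space Int_commute)
    have "emeasure (density S (\<lambda>y. ennreal (indicator (\<Gamma> \<inter> W) y))) E
        = (\<integral>\<^sup>+y. indicator (\<Gamma> \<inter> W \<inter> E) y \<partial>S)"
    proof (subst emeasure_density)
      show "(\<lambda>y. ennreal (indicator (\<Gamma> \<inter> W) y)) \<in> borel_measurable S"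
        by measurable
      show "(\<integral>\<^sup>+y. ennreal (indicator (\<Gamma> \<inter> W) y) * indicator E y \<partial>S)
          = (\<integral>\<^sup>+y. indicator (\<Gamma> \<inter> W \<inter> E) y \<partial>S)"
        by (rule nn_integral_cong) (simp add: indicator_def)
    qed (rule E)
    also have "\<dots> = emeasure S (\<Gamma> \<inter> W \<inter> E)"
      by simp
    also have "\<Gamma> \<inter> W \<inter> E = X ` (V \<inter> X -` E)"
      unfolding X_image[symmetric] by blast
    also have "emeasure S \<dots> = (\<integral>\<^sup>+u. ennreal (indicator (V \<inter> X -` E) u * J u) \<partial>lborel)"
      by (rule emeasure_S_patch[OF assms(1) VE]) simp
    also have "\<dots> = (\<integral>\<^sup>+u. ennreal (J u) * indicator (X -` E) u * indicator V u \<partial>lborel)"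
      by (intro nn_integral_cong) (auto simp: indicator_def)
    also have "\<dots> = (\<integral>\<^sup>+u. ennreal (J u) * indicator (X -` E) u \<partial>?L)"
      by (rule nn_integral_restrict_space[OF VL, symmetric])
    also have "\<dots> = (\<integral>\<^sup>+u. ennreal (J u) * indicator (X -` E \<inter> space ?L) u \<partial>?L)"
      by (intro nn_integral_cong) (auto simp: indicator_def)
    also have "\<dots> = emeasure (density ?L (\<lambda>u. ennreal (J u))) (X -` E \<inter> space ?L)"
      by (subst emeasure_density) (use measurable_sets[OF XS E] in auto)
    also have "\<dots> = emeasure (distr (density ?L (\<lambda>u. ennreal (J u))) S X) E"
      by (subst emeasure_distr) auto
    finally show "emeasure (density S (\<lambda>y. ennreal (indicator (\<Gamma> \<inter> W) y))) E
        = emeasure (distr (density ?L (\<lambda>u. ennreal (J u))) S X) E" .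
  qed simp
  have "(LINT y|S. f y) = (LINT y|S. indicator (\<Gamma> \<inter> W) y *\<^sub>R f y)"
    by (rule Bochner_Integration.integral_cong) (use zero in \<open>auto simp: indicator_def\<close>)
  also have "\<dots> = (LINT y|density S (\<lambda>y. ennreal (indicator (\<Gamma> \<inter> W) y)). f y)"
    by (rule integral_density[symmetric]) (use f in auto)
  also have "\<dots> = (LINT u|density ?L (\<lambda>u. ennreal (J u)). f (X u))"
    unfolding eq by (rule integral_distr) (use f in auto)
  also have "\<dots> = (LINT u|?L. J u *\<^sub>R f (X u))"
    by (rule integral_density) (use f J_pos less_imp_le in \<open>auto intro!: AE_I2 measurable_compose[OF XS]\<close>)
  also have "\<dots> = (LINT u|lborel. indicator V u *\<^sub>R (J u *\<^sub>R f (X u)))"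
    by (rule integral_restrict_space[OF VL])
  finally show ?thesis .
qed

end

lemma exterior_domain_compact_C2_surface:
  assumes "exterior_domain \<Omega>" "C2_boundary \<Omega>"
  shows "compact_C2_surface (frontier \<Omega>)"
  using exterior_domain_compact_frontier frontier_graph_patch assms by unfold_locales auto


section \<open>Tangent planes, normals and the surface divergence in a graph patch\<close>

lemma frame_expansion_complex:
  assumes frame: "\<And>z. (\<Sum>k\<in>UNIV. (q k \<bullet> z) *\<^sub>R q k) = z"
  shows "(\<Sum>k\<in>UNIV. cdot (q k) w *s cvec (q k)) = w"
proof -
  have e: "(\<Sum>k\<in>UNIV. (q k $ j) * (q k $ i)) = (if i = j then 1 else 0)" for i j
  proof -
    have "(\<Sum>k\<in>UNIV. (q k \<bullet> axis j 1) *\<^sub>R q k) $ i = (if i = j then 1 else 0)"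
      unfolding frame by (simp add: axis_def)
    then show ?thesis
      by (simp add: inner_axis)
  qed
  have "(\<Sum>k\<in>UNIV. cdot (q k) w *s cvec (q k)) $ i = w $ i" for i
  proof -
    have "(\<Sum>k\<in>UNIV. cdot (q k) w *s cvec (q k)) $ i
        = (\<Sum>k\<in>UNIV. \<Sum>j\<in>UNIV. of_real (q k $ j * q k $ i) * w $ j)"
      by (simp add: cdot_def cvec_def sum_distrib_left algebra_simps)
    also have "\<dots> = (\<Sum>j\<in>UNIV. of_real (\<Sum>k\<in>UNIV. q k $ j * q k $ i) * w $ j)"
      by (subst sum.swap) (simp add: sum_distrib_right)
    also have "\<dots> = (\<Sum>j\<in>UNIV. if i = j then w $ j else 0)"
      unfolding e by (rule sum.cong) auto
    also have "\<dots> = w $ i"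
      by simp
    finally show ?thesis .
  qed
  then show ?thesis
    by (simp add: vec_eq_iff)
qed

text \<open>
  The surface divergence is defined as a trace in the standard basis; in a patch it is computed in
  the frame \<open>q\<close>, where the tangent plane has simple coordinates.
\<close>

lemma trace_frame:
  assumes frame: "\<And>z. (\<Sum>k\<in>UNIV. (q k \<bullet> z) *\<^sub>R q k) = z" and lin: "linear L"
  shows "(\<Sum>i\<in>UNIV. L (axis i 1) $ i) = (\<Sum>k\<in>UNIV. cdot (q k) (L (q k)))"
proof -
  have "L (axis i 1) $ i = (\<Sum>k\<in>UNIV. of_real (q k $ i) * L (q k) $ i)" for i
  proof -
    have "L (axis i 1) = L (\<Sum>k\<in>UNIV. (q k \<bullet> axis i 1) *\<^sub>R q k)"
      unfolding frame ..
    then have "L (axis i 1) = (\<Sum>k\<in>UNIV. (q k $ i) *\<^sub>R L (q k))"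
      by (simp add: linear_sum[OF lin] linear_cmul[OF lin] inner_axis)
    then have "L (axis i 1) $ i = (\<Sum>k\<in>UNIV. (q k $ i) *\<^sub>R L (q k)) $ i"
      by simp
    also have "\<dots> = (\<Sum>k\<in>UNIV. of_real (q k $ i) * L (q k) $ i)"
      by (simp only: sum_component vector_scaleR_component scaleR_conv_of_real[where 'a=complex])
    finally show ?thesis .
  qed
  then show ?thesis
    unfolding cdot_def by (simp add: sum.swap[of "\<lambda>i k. of_real (q k $ i) * L (q k) $ i"])
qed

context graph_patch
begin

text \<open>
  Differentiating \<open>q 3 \<bullet> c t = \<gamma> (proj (c t))\<close> along a curve \<open>c\<close> in the surface shows that velocities are
  orthogonal to \<open>N\<close>; conversely, images of lines in the parameter plane realise every such vector.
\<close>

lemma tangent_space_patch: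
  assumes u: "u \<in> V"
  shows "tangent_space \<Gamma> (X u) = {v. N u \<bullet> v = 0}"
proof (intro set_eqI iffI)
  fix v assume "v \<in> tangent_space \<Gamma> (X u)"
  then obtain c \<epsilon> where c: "c 0 = X u" "\<epsilon> > 0" "\<And>t. \<bar>t\<bar> < \<epsilon> \<Longrightarrow> c t \<in> \<Gamma>"
    "(c has_vector_derivative v) (at (0::real))"
    unfolding tangent_space_def by blast
  have cd: "(c has_derivative (\<lambda>h. h *\<^sub>R v)) (at 0)"
    using c(4) by (simp add: has_vector_derivative_def)
  then have "continuous (at 0) c"
    by (rule has_derivative_continuous)
  then have "eventually (\<lambda>t. c t \<in> W) (nhds 0)"
    using c(1) u open_W by (auto simp: V_def continuous_at tendsto_def nhds_def[symmetric]
        eventually_nhds_metric eventually_at) (metis dist_self)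
  then obtain \<delta> where \<delta>: "\<delta> > 0" "\<And>t. \<bar>t\<bar> < \<delta> \<Longrightarrow> c t \<in> W"
    by (auto simp: eventually_nhds_metric dist_real_def)
  have pu: "proj (c 0) = u"
    using c(1) by simp
  have "((\<lambda>t. q 3 \<bullet> c t - \<gamma> (proj (c t))) has_derivative
      (\<lambda>h. q 3 \<bullet> (h *\<^sub>R v) - (proj (h *\<^sub>R v) $ 1 * g1 u + proj (h *\<^sub>R v) $ 2 * g2 u))) (at 0)"
    by (intro has_derivative_diff has_derivative_inner_right cd
        has_derivative_compose[OF bounded_linear.has_derivative[OF bounded_linear_proj cd],
          of \<gamma>, unfolded pu] gamma_has_derivative)
  moreover have "((\<lambda>t. q 3 \<bullet> c t - \<gamma> (proj (c t))) has_derivative (\<lambda>h. 0)) (at 0)"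
  proof (rule has_derivative_transform_within_open[OF has_derivative_const, of "{-min \<delta> \<epsilon> <..< min \<delta> \<epsilon>}" 0 0])
    show "0 = q 3 \<bullet> c t - \<gamma> (proj (c t))" if "t \<in> {-min \<delta> \<epsilon> <..< min \<delta> \<epsilon>}" for t
    proof -
      have "\<bar>t\<bar> < \<delta>" "\<bar>t\<bar> < \<epsilon>"
        using that by auto
      then have "c t \<in> \<Gamma> \<inter> W"
        using c(3) \<delta>(2) by blast
      then show ?thesis
        using graph unfolding proj_def by auto
    qed
  qed (use c(2) \<delta> in auto)
  ultimately have "q 3 \<bullet> (1 *\<^sub>R v) - (proj (1 *\<^sub>R v) $ 1 * g1 u + proj (1 *\<^sub>R v) $ 2 * g2 u) = 0"
    using has_derivative_unique by (metis (no_types, lifting))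
  then show "v \<in> {v. N u \<bullet> v = 0}"
    by (simp add: N_def inner_diff_left)
next
  fix v assume "v \<in> {v. N u \<bullet> v = 0}"
  then have v: "v = DX u (proj v)"
    using tangent_eq_DX by blast
  let ?c = "\<lambda>t. X (u + t *\<^sub>R proj v)"
  have "(?c has_vector_derivative v) (at 0)"
    using has_vector_derivative_along_line[of X "DX u" u 0 "proj v"] X_has_derivative[of u] v by simp
  moreover have "\<exists>\<epsilon>>0. \<forall>t. \<bar>t\<bar> < \<epsilon> \<longrightarrow> ?c t \<in> \<Gamma>"
  proof -
    have "open ((\<lambda>t. u + t *\<^sub>R proj v) -` V)"
      by (intro open_vimage open_V continuous_intros)
    moreover have "0 \<in> (\<lambda>t. u + t *\<^sub>R proj v) -` V"
      using u by simp
    ultimately obtain \<epsilon> where "\<epsilon> > 0" "\<And>t. dist t 0 < \<epsilon> \<Longrightarrow> t \<in> (\<lambda>t. u + t *\<^sub>R proj v) -` V"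
      unfolding open_dist by blast
    then show ?thesis
      using X_in by (intro exI[of _ \<epsilon>]) (auto simp: dist_real_def)
  qed
  ultimately show "v \<in> tangent_space \<Gamma> (X u)"
    unfolding tangent_space_def by (intro CollectI exI[of _ ?c]) auto
qed

text \<open>The sign of the chosen normal is unknown, but only \<open>c\<^sup>2 = 1 / J\<^sup>2\<close> enters later.\<close>

lemma unit_normal_patch:
  assumes u: "u \<in> V"
  obtains c where "unit_normal \<Gamma> (X u) = c *\<^sub>R N u" "c * c * (J u * J u) = 1"
proof -
  define n where "n = unit_normal \<Gamma> (X u)"
  let ?Q = "\<lambda>n. norm n = 1 \<and> (\<forall>v\<in>tangent_space \<Gamma> (X u). orthogonal n v)"
  have "norm (N u) = J u"
    using N_square[of u] J_pos[of u] by (simp add: norm_eq_sqrt_inner)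
  then have "?Q ((1 / J u) *\<^sub>R N u)"
    using J_pos[of u] by (auto simp: tangent_space_patch[OF u] orthogonal_def)
  then have n: "?Q n"
    unfolding n_def unit_normal_def by (rule someI)
  have "n \<bullet> DX u h = 0" for h
    using n N_DX by (simp add: tangent_space_patch[OF u] orthogonal_def)
  from this[of "axis 1 1"] this[of "axis 2 1"]
  have "q 1 \<bullet> n = - g1 u * (q 3 \<bullet> n)" "q 2 \<bullet> n = - g2 u * (q 3 \<bullet> n)"
    by (simp_all add: DX_def axis_def inner_add_right inner_commute)
  then have nN: "n = (q 3 \<bullet> n) *\<^sub>R N u"
    using frame[of n] by (simp add: sum_3 N_def algebra_simps)
  have "n \<bullet> n = 1"
    using n by (simp add: norm_eq_sqrt_inner)
  then have "(q 3 \<bullet> n) * (q 3 \<bullet> n) * (J u * J u) = 1"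
    by (subst (asm) (1 2) nN) (simp add: N_square algebra_simps)
  with nN show ?thesis
    using that n_def by blast
qed

lemma tangential_at_patch:
  assumes u: "u \<in> V"
  shows "tangential_at \<Gamma> (X u) w \<longleftrightarrow> cdot (N u) w = 0"
proof -
  obtain c where c: "unit_normal \<Gamma> (X u) = c *\<^sub>R N u" "c * c * (J u * J u) = 1"
    using unit_normal_patch[OF u] .
  then have "c \<noteq> 0" by auto
  then show ?thesis
    by (simp add: tangential_at_iff c(1) cdot_scaleR_left)
qed

text \<open>
  Inner products with \<open>q 1\<close> and \<open>q 2\<close> are the contravariant components of a tangential vector with
  respect to the chart, because \<open>proj (DX u h) = h\<close>.
\<close>

lemma tangential_components:
  assumes u: "u \<in> V" and t: "tangential_at \<Gamma> (X u) w"
  shows "cdot (q 3) w = of_real (g1 u) * cdot (q 1) w + of_real (g2 u) * cdot (q 2) w"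
    and "w = cdot (q 1) w *s cvec (DX u (axis 1 1)) + cdot (q 2) w *s cvec (DX u (axis 2 1))"
proof -
  have "cdot (N u) w = 0"
    using t tangential_at_patch[OF u] by blast
  then show a3: "cdot (q 3) w = of_real (g1 u) * cdot (q 1) w + of_real (g2 u) * cdot (q 2) w"
    by (simp add: N_def cdot_diff_left cdot_add_left cdot_scaleR_left scaleR_conv_of_real[where 'a=complex] algebra_simps)
  have D: "DX u (axis 1 1) = q 1 + g1 u *\<^sub>R q 3" "DX u (axis 2 1) = q 2 + g2 u *\<^sub>R q 3"
    by (simp_all add: DX_def axis_def)
  have cv: "cvec (v + r *\<^sub>R z) = cvec v + of_real r *s cvec z" for v z r
    by (simp add: cvec_def vec_eq_iff)
  have "w = cdot (q 1) w *s cvec (q 1) + cdot (q 2) w *s cvec (q 2) + cdot (q 3) w *s cvec (q 3)"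
    using frame_expansion_complex[OF frame, of w] by (simp add: sum_3)
  then show "w = cdot (q 1) w *s cvec (DX u (axis 1 1)) + cdot (q 2) w *s cvec (DX u (axis 2 1))"
    unfolding D cv a3 by (simp add: vec_eq_iff algebra_simps)
qed

lemma regular_field_patch:
  assumes \<phi>: "\<phi> \<in> regular_tangential_fields \<Gamma>"
  shows "C1_on V (\<lambda>u. \<phi> (X u))"
proof (rule C1_on_local)
  fix u assume u: "u \<in> V"
  then have "X u \<in> \<Gamma>"
    using X_in by blast
  then obtain U \<psi> where U: "open U" "X u \<in> U" "C1_on U \<psi>" "\<forall>z\<in>U \<inter> \<Gamma>. \<psi> z = \<phi> z"
    using \<phi> unfolding regular_tangential_fields_def by blast
  show "\<exists>V' g. open V' \<and> u \<in> V' \<and> C1_on V' g \<and> (\<forall>z\<in>V'. \<phi> (X z) = g z)"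
  proof (intro exI conjI ballI)
    show "open (V \<inter> X -` U)"
      by (intro open_Int open_V open_vimage U continuous_X)
    show "C1_on (V \<inter> X -` U) (\<lambda>u. \<psi> (X u))"
      by (rule C1_on_compose[OF C1_on_subset[OF C1_X subset_UNIV] U(3)]) auto
    show "\<phi> (X z) = \<psi> (X z)" if "z \<in> V \<inter> X -` U" for z
      using that U(4) X_in by auto
  qed (use u U in auto)
qed

text \<open>
  The chosen derivative within the surface is unspecified in normal directions; the chain rule fixes
  it on tangent vectors \<open>DX u h\<close>.
\<close>

lemma regular_field_derivative_patch:
  assumes \<phi>: "\<phi> \<in> regular_tangential_fields \<Gamma>" and u: "u \<in> V"
  defines "D \<equiv> frechet_derivative \<phi> (at (X u) within \<Gamma>)"
  shows "linear D" and "((\<lambda>u. \<phi> (X u)) has_derivative (\<lambda>h. D (DX u h))) (at u)"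
proof -
  have Xu: "X u \<in> \<Gamma>"
    using X_in[OF u] by blast
  then obtain U \<psi> where U: "open U" "X u \<in> U" "C1_on U \<psi>" "\<forall>z\<in>U \<inter> \<Gamma>. \<psi> z = \<phi> z"
    using \<phi> unfolding regular_tangential_fields_def by blast
  obtain e where e: "e > 0" "ball (X u) e \<subseteq> U"
    using U open_contains_ball by blast
  have "(\<phi> has_derivative frechet_derivative \<psi> (at (X u))) (at (X u) within \<Gamma>)"
    by (rule has_derivative_transform_within[OF has_derivative_at_withinI[OF C1_on_has_derivative[OF U(3,2)]] e(1) Xu])
      (use e U(4) in \<open>auto simp: dist_commute subset_eq\<close>)
  then have D: "(\<phi> has_derivative D) (at (X u) within \<Gamma>)"
    unfolding D_def using differentiableI frechet_derivative_works by blast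
  then show "linear D"
    using has_derivative_linear by blast
  have "(\<phi> has_derivative D) (at (X u) within X ` V)"
    by (rule has_derivative_subset[OF D]) (use X_image in blast)
  from diff_chain_within[OF has_derivative_at_withinI[OF X_has_derivative] this]
  have "((\<lambda>u. \<phi> (X u)) has_derivative (\<lambda>h. D (DX u h))) (at u within V)"
    by (simp add: o_def)
  then show "((\<lambda>u. \<phi> (X u)) has_derivative (\<lambda>h. D (DX u h))) (at u)"
    using at_within_open[OF u open_V] by simp
qed

lemma C1_components:
  assumes "\<phi> \<in> regular_tangential_fields \<Gamma>"
  shows "C1_on V (\<lambda>u. cdot (q k) (\<phi> (X u)))"
  by (rule C1_on_linear_compose[OF bounded_bilinear.bounded_linear_right[OF bounded_bilinear_cdot]
        regular_field_patch[OF assms]])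

lemma C1_weighted_components:
  assumes "\<phi> \<in> regular_tangential_fields \<Gamma>"
  shows "C1_on V (\<lambda>u. J u *\<^sub>R cdot (q k) (\<phi> (X u)))"
  by (rule C1_on_scaleR[OF C1_on_subset[OF C1_J subset_UNIV] C1_components[OF assms]])

text \<open>
  In graph coordinates the surface divergence of \<open>a\<close> is \<open>(\<partial>\<^sub>1 (J a\<^sub>1) + \<partial>\<^sub>2 (J a\<^sub>2)) / J\<close>.  The third
  component is \<open>a\<^sub>3 = \<gamma>\<^sub>1 a\<^sub>1 + \<gamma>\<^sub>2 a\<^sub>2\<close>, and the second derivatives of \<open>\<gamma>\<close> that this produces are the
  derivatives of \<open>J\<close> because mixed second derivatives agree.
\<close>

lemma surface_div_patch:
  assumes \<phi>: "\<phi> \<in> regular_tangential_fields \<Gamma>" and u: "u \<in> V"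
  shows "J u *\<^sub>R surface_div \<Gamma> \<phi> (X u)
       = frechet_derivative (\<lambda>u. J u *\<^sub>R cdot (q 1) (\<phi> (X u))) (at u) (axis 1 1)
       + frechet_derivative (\<lambda>u. J u *\<^sub>R cdot (q 2) (\<phi> (X u))) (at u) (axis 2 1)"
proof -
  define D where "D = frechet_derivative \<phi> (at (X u) within \<Gamma>)"
  have linD: "linear D" and DX: "((\<lambda>u. \<phi> (X u)) has_derivative (\<lambda>h. D (DX u h))) (at u)"
    using regular_field_derivative_patch[OF \<phi> u] by (simp_all add: D_def)
  let ?e1 = "axis 1 1 :: real^2" and ?e2 = "axis 2 1 :: real^2"
  define a where "a k u = cdot (q k) (\<phi> (X u))" for k u
  define A where "A k h = cdot (q k) (D (DX u h))" for k h
  have a': "(a k has_derivative A k) (at u)" for k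
    unfolding a_def[abs_def] A_def[abs_def]
    by (rule bounded_linear.has_derivative[OF bounded_bilinear.bounded_linear_right[OF bounded_bilinear_cdot] DX])
  let ?g1' = "frechet_derivative g1 (at u)" and ?g2' = "frechet_derivative g2 (at u)"
    and ?J' = "frechet_derivative J (at u)"
  have g1': "(g1 has_derivative ?g1') (at u)" and g2': "(g2 has_derivative ?g2') (at u)"
    and J': "(J has_derivative ?J') (at u)"
    by (rule C1_on_has_derivative[OF _ UNIV_I], rule C1_partials C1_J)+
  \<comment> \<open>differentiate \<open>a\<^sub>3 = \<gamma>\<^sub>1 a\<^sub>1 + \<gamma>\<^sub>2 a\<^sub>2\<close>, which tangentiality gives on the whole patch\<close>
  have A3: "A 3 h = of_real (?g1' h) * a 1 u + of_real (g1 u) * A 1 h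
      + of_real (?g2' h) * a 2 u + of_real (g2 u) * A 2 h" for h
  proof -
    have "((\<lambda>u. of_real (g1 u) * a 1 u + of_real (g2 u) * a 2 u) has_derivative
        (\<lambda>h. (of_real (g1 u) * A 1 h + of_real (?g1' h) * a 1 u)
          + (of_real (g2 u) * A 2 h + of_real (?g2' h) * a 2 u))) (at u)"
      by (intro has_derivative_add has_derivative_mult has_derivative_of_real a' g1' g2')
    moreover have "of_real (g1 w) * a 1 w + of_real (g2 w) * a 2 w = a 3 w" if "w \<in> V" for w
      using tangential_components(1)[OF that, of "\<phi> (X w)"] \<phi> X_in[OF that]
      by (auto simp: a_def regular_tangential_fields_def)
    ultimately have "(a 3 has_derivative
        (\<lambda>h. (of_real (g1 u) * A 1 h + of_real (?g1' h) * a 1 u)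
          + (of_real (g2 u) * A 2 h + of_real (?g2' h) * a 2 u))) (at u)"
      by (rule has_derivative_transform_within_open[OF _ open_V u])
    from has_derivative_unique[OF a' this] show ?thesis
      by (simp add: algebra_simps)
  qed
  \<comment> \<open>differentiating \<open>J\<^sup>2\<close> avoids the square root\<close>
  have JJ': "J u * ?J' h = g1 u * ?g1' h + g2 u * ?g2' h" for h
  proof -
    have l: "((\<lambda>u. J u * J u) has_derivative (\<lambda>h. J u * ?J' h + ?J' h * J u)) (at u)"
      by (intro has_derivative_mult J')
    have r: "((\<lambda>u. 1 + g1 u * g1 u + g2 u * g2 u) has_derivative
        (\<lambda>h. 0 + (g1 u * ?g1' h + ?g1' h * g1 u) + (g2 u * ?g2' h + ?g2' h * g2 u))) (at u)"
      by (intro has_derivative_add has_derivative_const has_derivative_mult g1' g2')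
    from fun_cong[OF has_derivative_unique[OF l[unfolded J_square] r], of h] show ?thesis
      by simp
  qed
  \<comment> \<open>projected frame vectors are tangent, so \<open>D\<close> is known on them through the chart\<close>
  define n where "n = unit_normal \<Gamma> (X u)"
  obtain c where c: "n = c *\<^sub>R N u" "c * c * (J u * J u) = 1"
    using unit_normal_patch[OF u] n_def by metis
  have cc: "c * c = 1 / (J u * J u)"
    using c(2) J_pos[of u] by (simp add: field_simps)
  define P where "P v = v - (n \<bullet> v) *\<^sub>R n" for v
  have linP: "linear (\<lambda>v. D (P v))"
    unfolding P_def
    by (rule linearI) (simp_all add: inner_add_right linear_diff[OF linD] linear_add[OF linD]
        linear_cmul[OF linD] algebra_simps)
  have "surface_div \<Gamma> \<phi> (X u) = (\<Sum>i\<in>UNIV. D (P (axis i 1)) $ i)"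
    by (simp add: surface_div_def Let_def D_def n_def P_def inner_axis)
  also have "\<dots> = (\<Sum>k\<in>UNIV. cdot (q k) (D (P (q k))))"
    by (rule trace_frame[OF frame linP])
  also have "\<dots> = (\<Sum>k\<in>UNIV. ((q 1 \<bullet> q k) + (N u \<bullet> q k) * g1 u / (J u * J u)) *\<^sub>R A k ?e1
      + ((q 2 \<bullet> q k) + (N u \<bullet> q k) * g2 u / (J u * J u)) *\<^sub>R A k ?e2)"
  proof (rule sum.cong[OF refl])
    fix k
    have Pk: "P (q k) = q k - ((N u \<bullet> q k) / (J u * J u)) *\<^sub>R N u"
    proof -
      have "(N u \<bullet> q k) / (J u * J u) = (c * c) * (N u \<bullet> q k)"
        by (simp add: cc)
      then show ?thesis
        by (simp add: P_def c(1) algebra_simps)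
    qed
    have "N u \<bullet> P (q k) = 0"
      using J_pos[of u] unfolding Pk by (simp add: inner_diff_right N_square)
    then have "P (q k) = DX u (proj (P (q k)))"
      by (rule tangent_eq_DX)
    also have "proj (P (q k)) = ((q 1 \<bullet> q k) + (N u \<bullet> q k) * g1 u / (J u * J u)) *\<^sub>R ?e1
      + ((q 2 \<bullet> q k) + (N u \<bullet> q k) * g2 u / (J u * J u)) *\<^sub>R ?e2" (is "_ = ?s *\<^sub>R _ + ?t *\<^sub>R _")
      unfolding Pk by (simp add: vec_eq_iff forall_2 axis_def inner_diff_right N_def ortho)
    also have "DX u (?s *\<^sub>R ?e1 + ?t *\<^sub>R ?e2) = ?s *\<^sub>R DX u ?e1 + ?t *\<^sub>R DX u ?e2"
      using has_derivative_linear[OF X_has_derivative[of u]] by (simp add: linear_add linear_cmul)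
    finally have "D (P (q k)) = ?s *\<^sub>R D (DX u ?e1) + ?t *\<^sub>R D (DX u ?e2)"
      by (simp only: linear_add[OF linD] linear_cmul[OF linD])
    then show "cdot (q k) (D (P (q k))) = ?s *\<^sub>R A k ?e1 + ?t *\<^sub>R A k ?e2"
      by (simp only: A_def cdot_add_right cdot_scaleR_right)
  qed
  also have "\<dots> = A 1 ?e1 + A 2 ?e2
      + (g1 u / (J u * J u)) *\<^sub>R (of_real (?g1' ?e1) * a 1 u + of_real (?g2' ?e1) * a 2 u)
      + (g2 u / (J u * J u)) *\<^sub>R (of_real (?g1' ?e2) * a 1 u + of_real (?g2' ?e2) * a 2 u)"
    by (simp add: sum_3 N_def inner_diff_left ortho A3 scaleR_conv_of_real[where 'a=complex] algebra_simps add_divide_distrib diff_divide_distrib)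
  finally have div: "surface_div \<Gamma> \<phi> (X u) = A 1 ?e1 + A 2 ?e2
      + (g1 u / (J u * J u)) *\<^sub>R (of_real (?g1' ?e1) * a 1 u + of_real (?g2' ?e1) * a 2 u)
      + (g2 u / (J u * J u)) *\<^sub>R (of_real (?g1' ?e2) * a 1 u + of_real (?g2' ?e2) * a 2 u)" .
  have d: "frechet_derivative (\<lambda>u. J u *\<^sub>R a k u) (at u) h = J u *\<^sub>R A k h + ?J' h *\<^sub>R a k u" for k h
  proof -
    have "((\<lambda>u. J u *\<^sub>R a k u) has_derivative (\<lambda>h. J u *\<^sub>R A k h + ?J' h *\<^sub>R a k u)) (at u)"
      by (intro has_derivative_scaleR J' a')
    from frechet_derivative_at[OF this] show ?thesis
      by (simp add: fun_eq_iff)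
  qed
  have J'1: "?J' h = (g1 u * ?g1' h + g2 u * ?g2' h) / J u" for h
    using JJ'[of h] J_pos[of u] by (simp add: field_simps)
  show ?thesis
    unfolding a_def[symmetric] unfolding d div J'1 using mixed_partials[of u] J_pos[of u]
    by (simp add: scaleR_conv_of_real[where 'a=complex] field_simps)
qed

lemma surface_div_continuous_patch:
  assumes \<phi>: "\<phi> \<in> regular_tangential_fields \<Gamma>"
  shows "continuous_on (\<Gamma> \<inter> W) (surface_div \<Gamma> \<phi>)"
proof -
  let ?f = "\<lambda>u. inverse (J u) *\<^sub>R (frechet_derivative (\<lambda>u. J u *\<^sub>R cdot (q 1) (\<phi> (X u))) (at u) (axis 1 1)
       + frechet_derivative (\<lambda>u. J u *\<^sub>R cdot (q 2) (\<phi> (X u))) (at u) (axis 2 1))"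
  have "J u \<noteq> 0" for u
    using J_pos[of u] by simp
  then have "continuous_on V ?f"
    by (intro continuous_intros C1_on_continuous_derivative C1_weighted_components \<phi>
        C1_on_imp_continuous_on C1_on_subset[OF C1_J]) auto
  then have "continuous_on (\<Gamma> \<inter> W) (\<lambda>y. ?f (proj y))"
    by (rule continuous_on_compose2[OF _ continuous_proj]) (use proj_in in auto)
  moreover have "?f (proj y) = surface_div \<Gamma> \<phi> y" if "y \<in> \<Gamma> \<inter> W" for y
  proof -
    have "proj y \<in> V" "X (proj y) = y"
      using that proj_in X_proj by auto
    then show ?thesis
      using surface_div_patch[OF \<phi>, of "proj y"] J_pos[of "proj y"]
      by (simp flip: surface_div_patch[OF \<phi>])
  qed
  ultimately show ?thesis
    using continuous_on_eq by blast
qed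

end


section \<open>Integration by parts on the surface\<close>

lemma clin_zero: "clin (\<lambda>_. 0) w = 0"
  by (simp add: clin_def)

lemma clin_sum_left: "clin (\<lambda>h. \<Sum>i\<in>I. L i h) w = (\<Sum>i\<in>I. clin (L i) w)"
  by (simp add: clin_def sum_distrib_left sum.swap[of _ I])

lemma C1_on_square_max_0:
  fixes f :: "'a::euclidean_space \<Rightarrow> real"
  assumes "C1_on U f"
  shows "C1_on U (\<lambda>x. max 0 (f x) * max 0 (f x))"
proof (rule C1_on_real[OF assms, of UNIV "\<lambda>t. max 0 t * max 0 t" "\<lambda>t. 2 * max 0 t"])
  fix t :: real
  have "((\<lambda>t. max 0 t * max 0 t) has_real_derivative 2 * max 0 t) (at t)"
  proof -
    consider "t < 0" | "t > 0" | "t = 0" by linarith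
    then show ?thesis
    proof cases
      case 1
      have "((\<lambda>t. 0) has_real_derivative 0) (at t)" by simp
      then have "((\<lambda>t. max 0 t * max 0 t) has_real_derivative 0) (at t)"
        by (rule DERIV_cong_ev[THEN iffD1, OF refl _ refl, rotated])
          (use 1 in \<open>auto intro!: eventually_nhds_in_open[of "{..<0}", THEN eventually_mono]\<close>)
      with 1 show ?thesis by simp
    next
      case 2
      have "((\<lambda>t. t * t) has_real_derivative 2 * t) (at t)"
        by (auto intro!: derivative_eq_intros)
      then have "((\<lambda>t. max 0 t * max 0 t) has_real_derivative 2 * t) (at t)"
        by (rule DERIV_cong_ev[THEN iffD1, OF refl _ refl, rotated])
          (use 2 in \<open>auto intro!: eventually_nhds_in_open[of "{0<..}", THEN eventually_mono]\<close>)
      with 2 show ?thesis by simp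
    next
      case 3
      have "((\<lambda>h::real. max 0 h * max 0 h / h) \<longlongrightarrow> 0) (at 0)"
      proof (rule Lim_null_comparison[OF always_eventually])
        show "\<forall>h::real. norm (max 0 h * max 0 h / h) \<le> \<bar>h\<bar>"
          by (auto simp: max_def)
        show "((\<lambda>h::real. \<bar>h\<bar>) \<longlongrightarrow> 0) (at 0)"
          by (intro tendsto_eq_intros) auto
      qed
      with 3 show ?thesis
        by (simp add: DERIV_def)
    qed
  qed
  then show "((\<lambda>t. max 0 t * max 0 t) has_vector_derivative 2 * max 0 t) (at t)"
    by (simp add: has_real_derivative_iff_has_vector_derivative)
qed (auto intro!: continuous_intros)

context compact_C2_surface
begin

lemma continuous_on_surface_local:
  assumes "\<And>W q \<gamma>. graph_patch \<Gamma> W q \<gamma> \<Longrightarrow> continuous_on (\<Gamma> \<inter> W) f"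
  shows "continuous_on \<Gamma> f"
  unfolding continuous_on_eq_continuous_within
proof
  fix y assume y: "y \<in> \<Gamma>"
  then obtain W q \<gamma> where W: "graph_patch \<Gamma> W q \<gamma>" "y \<in> W"
    using patches by blast
  have "continuous (at y within \<Gamma> \<inter> W) f"
    using assms[OF W(1)] y W(2) by (auto simp: continuous_on_eq_continuous_within)
  moreover have "at y within \<Gamma> \<inter> W = at y within \<Gamma>"
    by (rule at_within_nhd[of _ W]) (use W graph_patch.open_W in auto)
  ultimately show "continuous (at y within \<Gamma>) f"
    by simp
qed

lemma surface_div_continuous:
  "\<phi> \<in> regular_tangential_fields \<Gamma> \<Longrightarrow> continuous_on \<Gamma> (surface_div \<Gamma> \<phi>)"
  by (rule continuous_on_surface_local) (rule graph_patch.surface_div_continuous_patch)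

lemma regular_field_continuous:
  assumes \<phi>: "\<phi> \<in> regular_tangential_fields \<Gamma>"
  shows "continuous_on \<Gamma> \<phi>"
proof (rule continuous_on_surface_local)
  fix W q \<gamma> assume "graph_patch \<Gamma> W q \<gamma>"
  then interpret graph_patch \<Gamma> W q \<gamma> .
  have "continuous_on (\<Gamma> \<inter> W) (\<lambda>y. \<phi> (X (proj y)))"
    by (rule continuous_on_compose2[OF C1_on_imp_continuous_on[OF regular_field_patch[OF \<phi>]] continuous_proj])
      (use proj_in in auto)
  then show "continuous_on (\<Gamma> \<inter> W) \<phi>"
    by (rule continuous_on_eq) (use X_proj in auto)
qed

lemma continuous_on_clin_derivative:
  assumes "C1_on U g" "\<Gamma> \<subseteq> U" "\<phi> \<in> regular_tangential_fields \<Gamma>"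
  shows "continuous_on \<Gamma> (\<lambda>y. clin (frechet_derivative g (at y)) (\<phi> y))"
  unfolding clin_def
  by (intro continuous_intros continuous_on_subset[OF C1_on_continuous_derivative[OF assms(1)] assms(2)]
      regular_field_continuous assms(3))

text \<open>
  In graph coordinates the integrand is \<open>\<partial>\<^sub>1 (g J a\<^sub>1) + \<partial>\<^sub>2 (g J a\<^sub>2)\<close> with compactly supported fields.
\<close>

lemma divergence_theorem_patch:
  assumes "graph_patch \<Gamma> W q \<gamma>" and \<phi>: "\<phi> \<in> regular_tangential_fields \<Gamma>"
    and g: "C1_on U g" "open U" "\<Gamma> \<subseteq> U"
    and K: "compact K" "K \<subseteq> W" and zero: "\<And>z. z \<in> U \<Longrightarrow> z \<notin> K \<Longrightarrow> g z = 0"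
  shows "(LINT y|S. g y * surface_div \<Gamma> \<phi> y + clin (frechet_derivative g (at y)) (\<phi> y)) = 0"
proof -
  interpret graph_patch \<Gamma> W q \<gamma> by fact
  define Dg where "Dg y = frechet_derivative g (at y)" for y
  define h where "h y = g y * surface_div \<Gamma> \<phi> y + clin (Dg y) (\<phi> y)" for y
  have Dg: "(g has_derivative Dg y) (at y)" if "y \<in> \<Gamma>" for y
    unfolding Dg_def using C1_on_has_derivative[OF g(1)] that g(3) by blast
  have h_cont: "continuous_on \<Gamma> h"
    unfolding h_def[abs_def] Dg_def
    by (intro continuous_intros continuous_on_subset[OF C1_on_imp_continuous_on[OF g(1)] g(3)]
        surface_div_continuous \<phi> continuous_on_clin_derivative[OF g(1,3)])
  have h_zero: "h y = 0" if "y \<in> \<Gamma>" "y \<notin> W" for y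
  proof -
    have "open (U - K)"
      using g(2) K(1) by (simp add: open_Diff compact_imp_closed)
    moreover have "y \<in> U - K"
      using that g(3) K(2) by blast
    ultimately have "Dg y = (\<lambda>_. 0)"
      unfolding Dg_def by (rule frechet_derivative_vanishes) (use zero in auto)
    then show ?thesis
      using zero[of y] that g(3) K(2) by (auto simp: h_def clin_zero)
  qed
  define a where "a k u = J u *\<^sub>R cdot (q k) (\<phi> (X u))" for k u
  define F where "F k u = (if u \<in> V then g (X u) * a k u else 0)" for k u
  define K' where "K' = X -` K"
  have K'V: "K' \<subseteq> V"
    using K(2) by (auto simp: K'_def V_def)
  have K': "compact K'"
    unfolding compact_eq_bounded_closed
    using bounded_subset[OF bounded_V K'V] closed_vimage[OF compact_imp_closed[OF K(1)] continuous_X]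
    by (simp add: K'_def)
  have F0: "F k u = 0" if "u \<notin> K'" for k u
    using that zero X_in[of u] g(3) by (auto simp: F_def K'_def)
  have C1g: "C1_on V (\<lambda>u. g (X u))"
    by (rule C1_on_compose[OF C1_on_subset[OF C1_X subset_UNIV] g(1)]) (use X_in g(3) in blast)
  have C1a: "C1_on V (a k)" for k
    unfolding a_def[abs_def] by (rule C1_weighted_components[OF \<phi>])
  have C1F: "C1_on UNIV (F k)" for k
  proof (rule C1_on_local)
    fix u :: "real^2"
    show "\<exists>V' f. open V' \<and> u \<in> V' \<and> C1_on V' f \<and> (\<forall>z\<in>V'. F k z = f z)"
    proof (cases "u \<in> V")
      case True
      then show ?thesis
        using open_V C1_on_mult[OF C1g C1a] by (intro exI[of _ V] exI[of _ "\<lambda>u. g (X u) * a k u"]) (auto simp: F_def)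
    next
      case False
      then show ?thesis
        using K' K'V F0 by (intro exI[of _ "- K'"] exI[of _ "\<lambda>_. 0"]) (auto simp: compact_imp_closed C1_on_const)
    qed
  qed
  have DF: "frechet_derivative (F k) (at u) e
      = g (X u) * frechet_derivative (a k) (at u) e + Dg (X u) (DX u e) * a k u" if u: "u \<in> V" for k u e
  proof -
    have "((\<lambda>u. g (X u)) has_derivative (\<lambda>e. Dg (X u) (DX u e))) (at u)"
      using has_derivative_compose[OF X_has_derivative Dg] X_in[OF u] by blast
    from has_derivative_mult[OF this C1_on_has_derivative[OF C1a u]]
    have "((\<lambda>u. g (X u) * a k u) has_derivative (\<lambda>e. g (X u) * frechet_derivative (a k) (at u) e
        + Dg (X u) (DX u e) * a k u)) (at u)" .
    then have "(F k has_derivative (\<lambda>e. g (X u) * frechet_derivative (a k) (at u) e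
        + Dg (X u) (DX u e) * a k u)) (at u)"
      by (rule has_derivative_transform_within_open[OF _ open_V u]) (simp add: F_def)
    from frechet_derivative_at[OF this] show ?thesis
      by metis
  qed
  have DF0: "frechet_derivative (F k) (at u) e = 0" if "u \<notin> K'" for k u e
    using frechet_derivative_vanishes[of "- K'" u "F k"] K' F0 that by (simp add: compact_imp_closed open_Compl)
  have int: "integrable lborel (\<lambda>u. frechet_derivative (F k) (at u) e)" for k e
  proof -
    have "integrable lborel (\<lambda>u. indicator K' u *\<^sub>R frechet_derivative (F k) (at u) e)"
      by (rule borel_integrable_compact[OF K' continuous_on_subset[OF C1_on_continuous_derivative[OF C1F] subset_UNIV]])
    moreover have "(\<lambda>u. indicator K' u *\<^sub>R frechet_derivative (F k) (at u) e) = (\<lambda>u. frechet_derivative (F k) (at u) e)"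
      using DF0 by (auto simp: fun_eq_iff indicator_def)
    ultimately show ?thesis
      by simp
  qed
  have eq: "indicator V u *\<^sub>R (J u *\<^sub>R h (X u))
      = frechet_derivative (F 1) (at u) (axis 1 1) + frechet_derivative (F 2) (at u) (axis 2 1)" for u
  proof (cases "u \<in> V")
    case True
    have t: "tangential_at \<Gamma> (X u) (\<phi> (X u))"
      using \<phi> X_in[OF True] by (auto simp: regular_tangential_fields_def)
    have "linear (Dg (X u))"
      using Dg X_in[OF True] has_derivative_linear by blast
    then have cl: "clin (Dg (X u)) (\<phi> (X u)) = cdot (q 1) (\<phi> (X u)) * Dg (X u) (DX u (axis 1 1))
        + cdot (q 2) (\<phi> (X u)) * Dg (X u) (DX u (axis 2 1))"
      by (subst tangential_components(2)[OF True t]) (simp add: clin_add clin_mult clin_cvec)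
    have "J u *\<^sub>R h (X u) = g (X u) * (J u *\<^sub>R surface_div \<Gamma> \<phi> (X u)) + J u *\<^sub>R clin (Dg (X u)) (\<phi> (X u))"
      by (simp add: h_def algebra_simps)
    also have "J u *\<^sub>R surface_div \<Gamma> \<phi> (X u) = frechet_derivative (a 1) (at u) (axis 1 1)
        + frechet_derivative (a 2) (at u) (axis 2 1)"
      unfolding a_def[abs_def] by (rule surface_div_patch[OF \<phi> True])
    finally show ?thesis
      using True unfolding DF[OF True] cl by (simp add: a_def algebra_simps)
  next
    case False
    then have "u \<notin> K'"
      using K'V by blast
    with False show ?thesis
      by (simp add: DF0)
  qed
  have "(LINT y|S. h y) = (LINT u|lborel. indicator V u *\<^sub>R (J u *\<^sub>R h (X u)))"
    by (rule integral_over_patch[OF assms(1) continuous_on_imp_measurable_S[OF h_cont] h_zero])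
  also have "\<dots> = (LINT u|lborel. frechet_derivative (F 1) (at u) (axis 1 1))
      + (LINT u|lborel. frechet_derivative (F 2) (at u) (axis 2 1))"
    unfolding eq by (rule Bochner_Integration.integral_add[OF int int])
  also have "\<dots> = 0"
    using integral_derivative_compact_support[OF C1F K' F0] by simp
  finally show ?thesis
    unfolding h_def Dg_def .
qed

text \<open>
  Writing \<open>g\<close> as a finite sum of functions supported in graph patches reduces the general case to
  the local one.
\<close>

theorem surface_integration_by_parts:
  assumes \<phi>: "\<phi> \<in> regular_tangential_fields \<Gamma>"
    and g: "C1_on U g" "open U" "\<Gamma> \<subseteq> U"
  shows "(LINT y|S. g y * surface_div \<Gamma> \<phi> y) = - (LINT y|S. clin (frechet_derivative g (at y)) (\<phi> y))"
proof -
  obtain W where W: "\<And>y. y \<in> \<Gamma> \<Longrightarrow> y \<in> W y \<and> (\<exists>q \<gamma>. graph_patch \<Gamma> (W y) q \<gamma>)"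
    using patches by metis
  have "\<exists>e>0. cball y e \<subseteq> W y" if "y \<in> \<Gamma>" for y
    using W[OF that] graph_patch.open_W open_contains_cball by blast
  then obtain e where e: "\<And>y. y \<in> \<Gamma> \<Longrightarrow> e y > 0 \<and> cball y (e y) \<subseteq> W y"
    by metis
  have "y \<in> ball y (e y) \<and> open (ball y (e y))" if "y \<in> \<Gamma>" for y
    using e[OF that] by simp
  from finite_patch_cover[OF this] obtain Y where Y: "finite Y" "Y \<subseteq> \<Gamma>" "\<Gamma> \<subseteq> (\<Union>y\<in>Y. ball y (e y))"
    by blast
  \<comment> \<open>C1 bumps, positive exactly on the balls of the cover\<close>
  define b where "b y z = max 0 (e y * e y - (z - y) \<bullet> (z - y)) * max 0 (e y * e y - (z - y) \<bullet> (z - y))"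
    for y z :: "real^3"
  have C1b: "C1_on UNIV (b y)" for y
    unfolding b_def[abs_def]
    by (intro C1_on_square_max_0 C1_on_diff C1_on_const C1_on_inner C1_on_bounded_linear bounded_linear_ident)
  have sq: "(z - y) \<bullet> (z - y) = dist y z * dist y z" for y z :: "real^3"
    by (simp add: dist_norm norm_minus_commute dot_square_norm power2_eq_square)
  have b_zero: "b y z = 0" if "z \<notin> cball y (e y)" "y \<in> \<Gamma>" for y z
  proof -
    have "e y * e y \<le> dist y z * dist y z"
      using that e[of y] by (intro mult_mono) auto
    then show ?thesis
      by (simp add: b_def sq)
  qed
  have b_pos: "b y z > 0" if "z \<in> ball y (e y)" "y \<in> \<Gamma>" for y z
  proof -
    have "dist y z * dist y z < e y * e y"
      using that by (intro mult_strict_mono') auto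
    then show ?thesis
      by (simp add: b_def sq)
  qed
  have b_nonneg: "b y z \<ge> 0" for y z
    by (simp add: b_def)
  define B where "B z = (\<Sum>y\<in>Y. b y z)" for z
  define U' where "U' = U \<inter> (\<Union>y\<in>Y. ball y (e y))"
  have U': "open U'" "\<Gamma> \<subseteq> U'" "U' \<subseteq> U"
    using g Y by (auto simp: U'_def)
  have B_pos: "B z > 0" if z: "z \<in> U'" for z
  proof -
    obtain y where y: "y \<in> Y" "z \<in> ball y (e y)"
      using z by (auto simp: U'_def)
    show ?thesis
      unfolding B_def by (rule sum_pos2[OF Y(1) y(1)]) (use b_pos[OF y(2)] y Y b_nonneg in auto)
  qed
  have C1B: "C1_on UNIV B"
    unfolding B_def[abs_def] by (intro C1_on_sum C1b)
  define G where "G y z = (inverse (B z) * b y z) *\<^sub>R g z" for y z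
  have C1G: "C1_on U' (G y)" for y
    unfolding G_def[abs_def]
    by (intro C1_on_scaleR C1_on_mult C1_on_inverse C1_on_subset[OF C1B subset_UNIV]
        C1_on_subset[OF C1b subset_UNIV] C1_on_subset[OF g(1) U'(3)]) (use B_pos in force)
  have sumG: "(\<Sum>y\<in>Y. G y z) = g z" if "z \<in> U'" for z
  proof -
    have "(\<Sum>y\<in>Y. G y z) = (inverse (B z) * B z) *\<^sub>R g z"
      by (simp add: G_def B_def scaleR_sum_left sum_distrib_left)
    then show ?thesis
      using B_pos[OF that] by simp
  qed
  have sumDG: "(\<Sum>y\<in>Y. frechet_derivative (G y) (at z) h) = frechet_derivative g (at z) h" if z: "z \<in> U'" for z h
  proof -
    have "((\<lambda>z. \<Sum>y\<in>Y. G y z) has_derivative (\<lambda>h. \<Sum>y\<in>Y. frechet_derivative (G y) (at z) h)) (at z)"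
      by (intro has_derivative_sum C1_on_has_derivative[OF C1G z])
    then have "(g has_derivative (\<lambda>h. \<Sum>y\<in>Y. frechet_derivative (G y) (at z) h)) (at z)"
      by (rule has_derivative_transform_within_open[OF _ U'(1) z sumG])
    from frechet_derivative_at[OF this] show ?thesis
      by metis
  qed
  have I: "(LINT z|S. G y z * surface_div \<Gamma> \<phi> z + clin (frechet_derivative (G y) (at z)) (\<phi> z)) = 0"
    if y: "y \<in> Y" for y
  proof -
    have y\<Gamma>: "y \<in> \<Gamma>"
      using y Y by blast
    then obtain q \<gamma> where p: "graph_patch \<Gamma> (W y) q \<gamma>"
      using W by blast
    show ?thesis
      by (rule divergence_theorem_patch[OF p \<phi> C1G U'(1,2) compact_cball, of y "e y"])
        (use e[OF y\<Gamma>] b_zero y\<Gamma> in \<open>auto simp: G_def\<close>)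
  qed
  have int: "integrable S (\<lambda>z. G y z * surface_div \<Gamma> \<phi> z + clin (frechet_derivative (G y) (at z)) (\<phi> z))" for y
    by (intro continuous_on_imp_integrable_S continuous_intros surface_div_continuous \<phi>
        continuous_on_clin_derivative[OF C1G U'(2)] continuous_on_subset[OF C1_on_imp_continuous_on[OF C1G] U'(2)])
  have "(LINT z|S. g z * surface_div \<Gamma> \<phi> z + clin (frechet_derivative g (at z)) (\<phi> z))
      = (LINT z|S. (\<Sum>y\<in>Y. G y z * surface_div \<Gamma> \<phi> z + clin (frechet_derivative (G y) (at z)) (\<phi> z)))"
  proof (rule Bochner_Integration.integral_cong[OF refl])
    fix z assume "z \<in> space S"
    then have z: "z \<in> U'"
      using U'(2) by auto
    have "frechet_derivative g (at z) = (\<lambda>h. \<Sum>y\<in>Y. frechet_derivative (G y) (at z) h)"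
      using sumDG[OF z] by auto
    then show "g z * surface_div \<Gamma> \<phi> z + clin (frechet_derivative g (at z)) (\<phi> z)
        = (\<Sum>y\<in>Y. G y z * surface_div \<Gamma> \<phi> z + clin (frechet_derivative (G y) (at z)) (\<phi> z))"
      by (simp add: clin_sum_left sum.distrib sum_distrib_right[symmetric] sumG[OF z])
  qed
  also have "\<dots> = 0"
    using I int by (simp add: Bochner_Integration.integral_sum)
  finally have "(LINT z|S. g z * surface_div \<Gamma> \<phi> z + clin (frechet_derivative g (at z)) (\<phi> z)) = 0" .
  moreover have "integrable S (\<lambda>z. g z * surface_div \<Gamma> \<phi> z)"
    by (intro continuous_on_imp_integrable_S continuous_intros surface_div_continuous \<phi>
        continuous_on_subset[OF C1_on_imp_continuous_on[OF g(1)] g(3)])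
  moreover have "integrable S (\<lambda>z. clin (frechet_derivative g (at z)) (\<phi> z))"
    by (intro continuous_on_imp_integrable_S continuous_on_clin_derivative[OF g(1,3) \<phi>])
  ultimately show ?thesis
    by (simp add: eq_neg_iff_add_eq_0)
qed

end


section \<open>Differentiation under the integral sign\<close>

text \<open>
  By the mean value theorem a bound for the derivative in \<open>z\<close> also bounds the difference quotients, so
  that dominated convergence applies.
\<close>

lemma has_derivative_integral:
  fixes f :: "'a::real_normed_vector \<Rightarrow> 'y \<Rightarrow> 'b::{banach, second_countable_topology}"
  assumes M: "finite_measure M" and e: "e > 0" and B: "B \<ge> 0"
    and f: "\<And>z. z \<in> ball x e \<Longrightarrow> integrable M (f z)"
    and f': "\<And>z y. z \<in> ball x e \<Longrightarrow> y \<in> space M \<Longrightarrow> ((\<lambda>z. f z y) has_derivative f' z y) (at z)"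
    and meas: "\<And>h. (\<lambda>y. f' x y h) \<in> borel_measurable M"
    and bound: "\<And>z y h. z \<in> ball x e \<Longrightarrow> y \<in> space M \<Longrightarrow> norm (f' z y h) \<le> B * norm h"
  shows "((\<lambda>z. LINT y|M. f z y) has_derivative (\<lambda>h. LINT y|M. f' x y h)) (at x)"
proof -
  interpret finite_measure M by fact
  have x: "x \<in> ball x e" using e by simp
  have lin: "linear (f' x y)" if "y \<in> space M" for y
    using f'[OF x that] has_derivative_linear by blast
  have int: "integrable M (\<lambda>y. f' x y h)" for h
    by (rule integrable_const_bound[of _ "B * norm h", OF AE_I2 meas]) (use bound[OF x] in auto)
  show ?thesis
    unfolding has_derivative_at
  proof
    show "bounded_linear (\<lambda>h. LINT y|M. f' x y h)"
    proof (rule bounded_linear_intro[where K = "B * measure M (space M)"])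
      show "(LINT y|M. f' x y (g + h)) = (LINT y|M. f' x y g) + (LINT y|M. f' x y h)" for g h
        by (subst Bochner_Integration.integral_add[OF int int, symmetric])
          (rule Bochner_Integration.integral_cong, auto simp: linear_add[OF lin])
      show "(LINT y|M. f' x y (r *\<^sub>R h)) = r *\<^sub>R (LINT y|M. f' x y h)" for r h
        by (subst integral_scaleR_right[symmetric])
          (rule Bochner_Integration.integral_cong, auto simp: linear_cmul[OF lin])
      show "norm (LINT y|M. f' x y h) \<le> norm h * (B * measure M (space M))" for h
      proof -
        have "norm (LINT y|M. f' x y h) \<le> (LINT y|M. norm (f' x y h))"
          by (rule integral_norm_bound)
        also have "\<dots> \<le> (LINT y|M. B * norm h)"
          by (rule integral_mono) (use int bound[OF x] in auto)
        finally show ?thesis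
          by (simp add: algebra_simps)
      qed
    qed
    let ?q = "\<lambda>h y. (1 / norm h) *\<^sub>R (f (x + h) y - f x y - f' x y h)"
    have qlim: "((\<lambda>h. ?q h y) \<longlongrightarrow> 0) (at 0)" if "y \<in> space M" for y
    proof (rule tendsto_norm_zero_cancel)
      have "((\<lambda>h. norm (f (x + h) y - f x y - f' x y h) / norm h) \<longlongrightarrow> 0) (at 0)"
        using f'[OF x that] unfolding has_derivative_at by blast
      then show "((\<lambda>h. norm (?q h y)) \<longlongrightarrow> 0) (at 0)"
        by simp
    qed
    have qbound: "norm (?q h y) \<le> 2 * B" if h: "h \<noteq> 0" "norm h < e" and y: "y \<in> space M" for h y
    proof -
      have "norm (f (x + h) y - f x y) \<le> B * norm (x + h - x)"
      proof (rule differentiable_bound[of "ball x e" "\<lambda>z. f z y" "\<lambda>z. f' z y"])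
        show "((\<lambda>z. f z y) has_derivative f' z y) (at z within ball x e)" if "z \<in> ball x e" for z
          using f'[OF that y] by (rule has_derivative_at_withinI)
        show "onorm (f' z y) \<le> B" if "z \<in> ball x e" for z
          by (rule onorm_bound[OF B]) (rule bound[OF that y])
      qed (use h x in \<open>auto simp: dist_norm\<close>)
      moreover have "norm (f' x y h) \<le> B * norm h"
        by (rule bound[OF x y])
      ultimately have "norm (f (x + h) y - f x y - f' x y h) \<le> 2 * B * norm h"
        using norm_triangle_ineq4[of "f (x + h) y - f x y" "f' x y h"] by simp
      then have "norm (f (x + h) y - f x y - f' x y h) / norm h \<le> 2 * B"
        using h by (simp add: pos_divide_le_eq)
      then show ?thesis
        by simp
    qed
    have "((\<lambda>h. LINT y|M. ?q h y) \<longlongrightarrow> 0) (at 0)"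
      unfolding tendsto_at_iff_sequentially
    proof (intro allI impI)
      fix H :: "nat \<Rightarrow> 'a" assume H: "\<forall>i. H i \<in> UNIV - {0}" "H \<longlonglongrightarrow> 0"
      have "eventually (\<lambda>i. dist (H i) 0 < e) sequentially"
        using tendstoD[OF H(2) e] .
      then obtain n where n: "\<And>i. i \<ge> n \<Longrightarrow> norm (H i) < e"
        by (auto simp: eventually_sequentially)
      have "(\<lambda>i. LINT y|M. ?q (H (i + n)) y) \<longlonglongrightarrow> (LINT y|M. 0)"
      proof (rule integral_dominated_convergence[where w = "\<lambda>_. 2 * B"])
        show "?q (H (i + n)) \<in> borel_measurable M" for i
        proof -
          have "x + H (i + n) \<in> ball x e"
            using n[of "i + n"] by (simp add: dist_norm)
          then show ?thesis
            using borel_measurable_integrable[OF f[of "x + H (i + n)"]]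
              borel_measurable_integrable[OF f[OF x]] meas
            by (intro borel_measurable_scaleR borel_measurable_diff) auto
        qed
        show "AE y in M. (\<lambda>i. ?q (H (i + n)) y) \<longlonglongrightarrow> 0"
        proof (rule AE_I2)
          fix y assume "y \<in> space M"
          from qlim[OF this, unfolded tendsto_at_iff_sequentially] H
          have "((\<lambda>h. ?q h y) \<circ> H) \<longlonglongrightarrow> 0" by blast
          from LIMSEQ_ignore_initial_segment[OF this, of n] show "(\<lambda>i. ?q (H (i + n)) y) \<longlonglongrightarrow> 0"
            by (simp add: o_def)
        qed
        show "AE y in M. norm (?q (H (i + n)) y) \<le> 2 * B" for i
          by (rule AE_I2, rule qbound) (use H n in auto)
      qed auto
      then show "((\<lambda>h. LINT y|M. ?q h y) \<circ> H) \<longlonglongrightarrow> 0"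
        using LIMSEQ_offset[of "\<lambda>i. LINT y|M. ?q (H i) y" n 0] by (simp add: o_def)
    qed
    then have "((\<lambda>h. norm (LINT y|M. ?q h y)) \<longlongrightarrow> 0) (at 0)"
      by (rule tendsto_norm_zero)
    moreover have "norm (LINT y|M. ?q h y) = norm ((LINT y|M. f (x + h) y) - (LINT y|M. f x y) - (LINT y|M. f' x y h)) / norm h"
      if h: "h \<noteq> 0" "norm h < e" for h
    proof -
      have xh: "x + h \<in> ball x e"
        using h by (simp add: dist_norm)
      have "(LINT y|M. ?q h y) = (1 / norm h) *\<^sub>R (LINT y|M. f (x + h) y - f x y - f' x y h)"
        by (rule integral_scaleR_right)
      also have "(LINT y|M. f (x + h) y - f x y - f' x y h)
          = (LINT y|M. f (x + h) y) - (LINT y|M. f x y) - (LINT y|M. f' x y h)"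
        using f[OF xh] f[OF x] int by simp
      finally have "norm (LINT y|M. ?q h y) = norm ((1 / norm h) *\<^sub>R
          ((LINT y|M. f (x + h) y) - (LINT y|M. f x y) - (LINT y|M. f' x y h)))"
        by (rule arg_cong)
      then show ?thesis
        by (simp only: norm_scaleR) simp
    qed
    then have "eventually (\<lambda>h. norm (LINT y|M. ?q h y) = norm ((LINT y|M. f (x + h) y) - (LINT y|M. f x y) - (LINT y|M. f' x y h)) / norm h) (at 0)"
      using e unfolding eventually_at by (intro exI[of _ e]) auto
    ultimately show "((\<lambda>h. norm ((LINT y|M. f (x + h) y) - (LINT y|M. f x y) - (LINT y|M. f' x y h)) / norm h) \<longlongrightarrow> 0) (at 0)"
      by (rule Lim_transform_eventually)
  qed
qed

section \<open>The fundamental solution and its derivatives\<close>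

text \<open>
  \<open>G = \<kappa>\<^sub>0 \<bar>v\<bar>\<close>, \<open>\<nabla>G = \<kappa>\<^sub>1 \<bar>v\<bar> v\<close> and \<open>D\<^sup>2G = \<kappa>\<^sub>1 \<bar>v\<bar> I + \<kappa>\<^sub>2 \<bar>v\<bar> v v\<^sup>T\<close>, where \<open>\<kappa>\<^sub>1 r = \<kappa>\<^sub>0' r / r\<close> and
  \<open>\<kappa>\<^sub>2 r = \<kappa>\<^sub>1' r / r\<close>.
\<close>

definition kap0 :: "complex \<Rightarrow> complex \<Rightarrow> complex" where
  "kap0 s z = exp (- s * z) / (of_real (4 * pi) * z)"

definition kap1 :: "complex \<Rightarrow> complex \<Rightarrow> complex" where
  "kap1 s z = - (s * z + 1) * exp (- s * z) / (of_real (4 * pi) * z ^ 3)"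

definition kap2 :: "complex \<Rightarrow> complex \<Rightarrow> complex" where
  "kap2 s z = (s ^ 2 * z ^ 2 + 3 * s * z + 3) * exp (- s * z) / (of_real (4 * pi) * z ^ 5)"

definition radial0 :: "complex \<Rightarrow> real^3 \<Rightarrow> complex" where
  "radial0 s v = kap0 s (of_real (norm v))"

definition radial1 :: "complex \<Rightarrow> real^3 \<Rightarrow> complex" where
  "radial1 s v = kap1 s (of_real (norm v))"

definition radial2 :: "complex \<Rightarrow> real^3 \<Rightarrow> complex" where
  "radial2 s v = kap2 s (of_real (norm v))"

lemma fundamental_solution_radial: "fundamental_solution s = radial0 s"
  by (simp add: fun_eq_iff fundamental_solution_def radial0_def kap0_def)

lemma DERIV_kap0:
  assumes "z \<noteq> 0" shows "(kap0 s has_field_derivative kap1 s z * z) (at z)"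
proof -
  have "(kap0 s has_field_derivative
      (- s * exp (- s * z) * (of_real (4 * pi) * z) - exp (- s * z) * of_real (4 * pi)) / (of_real (4 * pi) * z)\<^sup>2) (at z)"
    unfolding kap0_def[abs_def] using assms
    by (auto intro!: derivative_eq_intros simp: power2_eq_square)
  then show ?thesis
    by (rule DERIV_cong) (use assms in \<open>simp add: kap1_def power2_eq_square power3_eq_cube divide_simps, simp add: algebra_simps\<close>)
qed

lemma DERIV_kap1:
  assumes "z \<noteq> 0" shows "(kap1 s has_field_derivative kap2 s z * z) (at z)"
proof -
  have "(kap1 s has_field_derivative
      ((- s * exp (- s * z) + - (s * z + 1) * (- s * exp (- s * z))) * (of_real (4 * pi) * z ^ 3)
        - (- (s * z + 1) * exp (- s * z)) * (of_real (4 * pi) * (3 * z ^ 2))) / (of_real (4 * pi) * z ^ 3)\<^sup>2) (at z)"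
    unfolding kap1_def[abs_def] using assms
    by (auto intro!: derivative_eq_intros simp: power2_eq_square)
  then show ?thesis
    by (rule DERIV_cong) (use assms in \<open>simp add: kap2_def eval_nat_numeral divide_simps, simp add: algebra_simps\<close>)
qed

text \<open>
  Since the gradient of \<open>\<bar>v\<bar>\<close> is \<open>v / \<bar>v\<bar>\<close>, a factor \<open>\<bar>v\<bar>\<close> in the derivative of \<open>k\<close> cancels.
\<close>

lemma has_derivative_radial:
  fixes v :: "'a::real_inner"
  assumes v: "v \<noteq> 0" and k: "(k has_field_derivative k' * of_real (norm v)) (at (of_real (norm v)))"
  shows "((\<lambda>v. k (of_real (norm v)) :: complex) has_derivative (\<lambda>h. of_real (v \<bullet> h) * k')) (at v)"
proof -
  have "((\<lambda>r. k (of_real r)) has_derivative (\<lambda>t. t *\<^sub>R (k' * of_real (norm v)))) (at (norm v))"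
    using has_vector_derivative_real_field[OF k] unfolding has_vector_derivative_def .
  from has_derivative_compose[OF has_derivative_norm[OF v] this]
  have "((\<lambda>v. k (of_real (norm v))) has_derivative (\<lambda>h. (sgn v \<bullet> h) *\<^sub>R (k' * of_real (norm v)))) (at v)"
    by (simp only: inner_commute)
  moreover have "(sgn v \<bullet> h) *\<^sub>R (k' * of_real (norm v)) = of_real (v \<bullet> h) * k'" for h
    using v by (simp add: sgn_div_norm scaleR_conv_of_real[where 'a=complex] field_simps)
  ultimately show ?thesis
    by simp
qed

lemma radial0_has_derivative:
  "v \<noteq> 0 \<Longrightarrow> (radial0 s has_derivative (\<lambda>h. of_real (v \<bullet> h) * radial1 s v)) (at v)"
  unfolding radial0_def[abs_def] radial1_def
  by (rule has_derivative_radial) (auto intro: DERIV_kap0)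

lemma radial1_has_derivative:
  "v \<noteq> 0 \<Longrightarrow> (radial1 s has_derivative (\<lambda>h. of_real (v \<bullet> h) * radial2 s v)) (at v)"
  unfolding radial1_def[abs_def] radial2_def
  by (rule has_derivative_radial) (auto intro: DERIV_kap1)

lemma continuous_on_radial:
  "continuous_on (- {0}) (radial0 s)" "continuous_on (- {0}) (radial1 s)" "continuous_on (- {0}) (radial2 s)"
  unfolding radial0_def[abs_def] radial1_def[abs_def] radial2_def[abs_def] kap0_def kap1_def kap2_def
  by (intro continuous_intros; simp)+

lemma exp_decay:
  assumes "Re s > 0" "d \<le> r" shows "cmod (exp (- s * of_real r)) \<le> exp (- d * Re s)"
  using assms by (simp add: norm_exp_eq_Re mult_right_mono)

text \<open>
  Everywhere at distance at least \<open>d\<close> the exponential is at most \<open>exp (- d * Re s)\<close> and negative powers of \<open>\<bar>v\<bar>\<close> are at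
  most those of \<open>d\<close>; each differentiation costs one factor \<open>\<bar>s\<bar>\<close>.
\<close>

context
  fixes s :: complex and d :: real and v :: "real^3"
  assumes s: "Re s > 0" and d: "d > 0" "d \<le> norm v"
begin

lemma norm_radial0: "cmod (radial0 s v) \<le> exp (- d * Re s) / d"
proof -
  have "cmod (radial0 s v) = cmod (exp (- s * of_real (norm v))) / (4 * pi * norm v)"
    by (simp add: radial0_def kap0_def norm_divide norm_mult)
  also have "\<dots> \<le> exp (- d * Re s) / d"
  proof (rule frac_le)
    have "1 * norm v \<le> 4 * pi * norm v"
      using pi_gt3 by (intro mult_right_mono) auto
    then show "d \<le> 4 * pi * norm v"
      using d by linarith
  qed (use d exp_decay[OF s d(2)] in auto)
  finally show ?thesis .
qed

lemma norm_radial1: "cmod (radial1 s v) * norm v \<le> (cmod s / d + 1 / d ^ 2) * exp (- d * Re s)"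
proof -
  let ?r = "norm v"
  have r: "?r > 0" using d by linarith
  have "cmod (radial1 s v) * ?r = cmod (s * of_real ?r + 1) * cmod (exp (- s * of_real ?r)) / (4 * pi * ?r ^ 2)"
    using r by (simp add: radial1_def kap1_def norm_divide norm_mult norm_power eval_nat_numeral divide_simps)
      (metis add.commute norm_minus_cancel minus_add_distrib uminus_add_conv_diff)
  also have "\<dots> \<le> (cmod s * ?r + 1) * exp (- d * Re s) / ?r ^ 2"
  proof (rule frac_le)
    show "cmod (s * of_real ?r + 1) * cmod (exp (- s * of_real ?r)) \<le> (cmod s * ?r + 1) * exp (- d * Re s)"
      by (intro mult_mono exp_decay s d order_trans[OF norm_triangle_ineq]) (auto simp: norm_mult)
    have "1 * ?r ^ 2 \<le> 4 * pi * ?r ^ 2"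
      using pi_gt3 by (intro mult_right_mono) auto
    then show "?r ^ 2 \<le> 4 * pi * ?r ^ 2" by simp
  qed (use r in auto)
  also have "\<dots> = (cmod s / ?r + 1 / ?r ^ 2) * exp (- d * Re s)"
    using r by (simp add: field_simps power2_eq_square)
  also have "\<dots> \<le> (cmod s / d + 1 / d ^ 2) * exp (- d * Re s)"
    using d by (intro mult_right_mono add_mono divide_left_mono power_mono mult_pos_pos) auto
  finally show ?thesis .
qed

lemma norm_radial1': "cmod (radial1 s v) \<le> (cmod s / d ^ 2 + 1 / d ^ 3) * exp (- d * Re s)"
proof -
  have "cmod (radial1 s v) * d \<le> cmod (radial1 s v) * norm v"
    using d by (intro mult_left_mono) auto
  also note norm_radial1
  finally show ?thesis
    using d by (simp add: field_simps eval_nat_numeral)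
qed

lemma norm_radial2:
  "cmod (radial2 s v) * norm v ^ 2 \<le> (cmod s ^ 2 / d + 3 * cmod s / d ^ 2 + 3 / d ^ 3) * exp (- d * Re s)"
proof -
  let ?r = "norm v"
  have r: "?r > 0" using d by linarith
  have "cmod (radial2 s v) * ?r ^ 2 = cmod (s ^ 2 * of_real ?r ^ 2 + 3 * s * of_real ?r + 3)
      * cmod (exp (- s * of_real ?r)) / (4 * pi * ?r ^ 3)"
    using r by (simp add: radial2_def kap2_def norm_divide norm_mult norm_power eval_nat_numeral divide_simps)
  also have "\<dots> \<le> (cmod s ^ 2 * ?r ^ 2 + 3 * cmod s * ?r + 3) * exp (- d * Re s) / ?r ^ 3"
  proof (rule frac_le)
    show "cmod (s ^ 2 * of_real ?r ^ 2 + 3 * s * of_real ?r + 3) * cmod (exp (- s * of_real ?r))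
        \<le> (cmod s ^ 2 * ?r ^ 2 + 3 * cmod s * ?r + 3) * exp (- d * Re s)"
    proof (intro mult_mono exp_decay s d)
      show "cmod (s ^ 2 * of_real ?r ^ 2 + 3 * s * of_real ?r + 3) \<le> cmod s ^ 2 * ?r ^ 2 + 3 * cmod s * ?r + 3"
        by (intro norm_triangle_le add_mono) (auto simp: norm_mult norm_power)
    qed auto
    have "1 * ?r ^ 3 \<le> 4 * pi * ?r ^ 3"
      using pi_gt3 by (intro mult_right_mono) auto
    then show "?r ^ 3 \<le> 4 * pi * ?r ^ 3" by simp
  qed (use r in auto)
  also have "\<dots> = (cmod s ^ 2 / ?r + 3 * cmod s / ?r ^ 2 + 3 / ?r ^ 3) * exp (- d * Re s)"
    using r by (simp add: field_simps eval_nat_numeral)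
  also have "\<dots> \<le> (cmod s ^ 2 / d + 3 * cmod s / d ^ 2 + 3 / d ^ 3) * exp (- d * Re s)"
    using d by (intro mult_right_mono add_mono divide_left_mono power_mono mult_pos_pos) auto
  finally show ?thesis .
qed

end


section \<open>The potentials away from the surface as integral operators\<close>

definition ccross :: "real^3 \<Rightarrow> complex^3 \<Rightarrow> complex^3" where
  "ccross v w = vector [of_real (v $ 2) * w $ 3 - of_real (v $ 3) * w $ 2,
     of_real (v $ 3) * w $ 1 - of_real (v $ 1) * w $ 3,
     of_real (v $ 1) * w $ 2 - of_real (v $ 2) * w $ 1]"

text \<open>
  With \<open>v = x - y\<close>, these are \<open>- s G w + s\<^sup>-\<^sup>1 (D\<^sup>2G) w\<close> and \<open>\<nabla>G \<times> w\<close>: all derivatives have been moved onto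
  the fundamental solution.
\<close>

definition single_kernel :: "complex \<Rightarrow> real^3 \<Rightarrow> complex^3 \<Rightarrow> complex^3" where
  "single_kernel s v w = (- s * radial0 s v) *s w
     + inverse s *s (radial2 s v *s (cdot v w *s cvec v) + radial1 s v *s w)"

definition double_kernel :: "complex \<Rightarrow> real^3 \<Rightarrow> complex^3 \<Rightarrow> complex^3" where
  "double_kernel s v w = radial1 s v *s ccross v w"

lemma ccross_nth [simp]:
  "ccross v w $ 1 = of_real (v $ 2) * w $ 3 - of_real (v $ 3) * w $ 2"
  "ccross v w $ 2 = of_real (v $ 3) * w $ 1 - of_real (v $ 1) * w $ 3"
  "ccross v w $ 3 = of_real (v $ 1) * w $ 2 - of_real (v $ 2) * w $ 1"
  by (simp_all add: ccross_def)

lemma norm_ccross: "norm (ccross v w) \<le> 6 * norm v * norm w"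
proof -
  have *: "cmod (of_real (v $ i) * w $ j - of_real (v $ k) * w $ l) \<le> 2 * norm v * norm w" for i j k l
  proof -
    have "cmod (of_real (v $ i) * w $ j) \<le> norm v * norm w" for i j
      by (auto simp: norm_mult intro!: mult_mono component_le_norm_cart Finite_Cartesian_Product.norm_nth_le)
    from add_mono[OF this[of i j] this[of k l]] show ?thesis
      using norm_triangle_ineq4[of "of_real (v $ i) * w $ j" "of_real (v $ k) * w $ l"] by simp
  qed
  have "norm (ccross v w) \<le> (\<Sum>i\<in>UNIV. norm (ccross v w $ i))"
    unfolding norm_vec_def by (rule L2_set_le_sum) simp
  also have "\<dots> \<le> 6 * norm v * norm w"
    using *[of 2 3 3 2] *[of 3 1 1 3] *[of 1 2 2 1] by (simp add: sum_3)
  finally show ?thesis .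
qed

lemma cdot_axis: "cdot (axis i 1) w = w $ i"
proof -
  have "cdot (axis i 1) w = (\<Sum>j\<in>UNIV. if j = i then w $ j else 0)"
    unfolding cdot_def by (rule sum.cong) (auto simp: axis_def)
  then show ?thesis by simp
qed

lemma clin_inner: "clin (\<lambda>h. - (of_real (v \<bullet> h) * c)) w = - (c * cdot v w)"
proof -
  have "clin (\<lambda>h. - (of_real (v \<bullet> h) * c)) w = (\<Sum>i\<in>UNIV. (- c) * (of_real (v $ i) * w $ i))"
    unfolding clin_def by (rule sum.cong) (auto simp: inner_axis)
  then show ?thesis
    by (simp add: cdot_def sum_distrib_left sum_negf)
qed

lemma single_kernel_nth:
  "single_kernel s v w $ i = - s * (radial0 s v * w $ i)
     + inverse s * (radial1 s v * cdot (axis i 1) w + of_real (v \<bullet> axis i 1) * radial2 s v * cdot v w)"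
  by (simp add: single_kernel_def cdot_axis inner_axis cvec_def algebra_simps)

lemma single_kernel_add: "single_kernel s v (w + w') = single_kernel s v w + single_kernel s v w'"
  by (simp add: single_kernel_def cdot_add_right vec_eq_iff algebra_simps)

lemma single_kernel_mult: "single_kernel s v (c *s w) = c *s single_kernel s v w"
  by (simp add: single_kernel_def cdot_mult_right vec_eq_iff algebra_simps)

lemma double_kernel_add: "double_kernel s v (w + w') = double_kernel s v w + double_kernel s v w'"
  by (simp add: double_kernel_def vec_eq_iff forall_3 algebra_simps)

lemma double_kernel_mult: "double_kernel s v (c *s w) = c *s double_kernel s v w"
  by (simp add: double_kernel_def vec_eq_iff forall_3 algebra_simps)

lemma continuous_on_vector_scalar_mult [continuous_intros]:
  fixes g :: "'a::topological_space \<Rightarrow> complex^'n"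
  shows "continuous_on A f \<Longrightarrow> continuous_on A g \<Longrightarrow> continuous_on A (\<lambda>x. f x *s g x)"
  by (rule bounded_bilinear.continuous_on[OF bounded_bilinear_vector_scalar_mult])

lemma continuous_on_cdot [continuous_intros]:
  "continuous_on A f \<Longrightarrow> continuous_on A g \<Longrightarrow> continuous_on A (\<lambda>x. cdot (f x) (g x))"
  by (rule bounded_bilinear.continuous_on[OF bounded_bilinear_cdot])

lemma continuous_on_cvec [continuous_intros]:
  "continuous_on A f \<Longrightarrow> continuous_on A (\<lambda>x. cvec (f x))"
  by (rule bounded_linear.continuous_on[OF bounded_linear_cvec])

lemma continuous_on_ccross [continuous_intros]:
  assumes "continuous_on A f" "continuous_on A g"
  shows "continuous_on A (\<lambda>x. ccross (f x) (g x))"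
proof -
  have "ccross (f x) (g x) = (\<chi> i. ccross (f x) (g x) $ i)" for x
    by simp
  moreover have "continuous_on A (\<lambda>x. ccross (f x) (g x) $ i)" for i
  proof -
    have "i = 1 \<or> i = 2 \<or> i = 3"
      by (rule exhaust_3)
    then show ?thesis
      by (elim disjE; simp; intro continuous_intros assms)
  qed
  ultimately show ?thesis
    using continuous_on_vec_lambda[of A "\<lambda>i x. ccross (f x) (g x) $ i"] by simp
qed

lemma continuous_on_radial_compose:
  assumes "continuous_on A f" "\<And>x. x \<in> A \<Longrightarrow> f x \<noteq> 0"
  shows "continuous_on A (\<lambda>x. radial0 s (f x))" "continuous_on A (\<lambda>x. radial1 s (f x))"
    "continuous_on A (\<lambda>x. radial2 s (f x))"
  by (rule continuous_on_compose2[OF continuous_on_radial(1) assms(1)]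
      continuous_on_compose2[OF continuous_on_radial(2) assms(1)]
      continuous_on_compose2[OF continuous_on_radial(3) assms(1)]; use assms(2) in auto)+

lemma continuous_on_pair_compose:
  assumes "continuous_on A (\<lambda>p. k (fst p) (snd p))" "continuous_on T f" "continuous_on T g"
    and "\<And>t. t \<in> T \<Longrightarrow> (f t, g t) \<in> A"
  shows "continuous_on T (\<lambda>t. k (f t) (g t))"
  using continuous_on_compose2[OF assms(1) continuous_on_Pair[OF assms(2,3)]] assms(4) by auto

lemma continuous_on_single_kernel:
  "continuous_on ((- {0}) \<times> UNIV) (\<lambda>p. single_kernel s (fst p) (snd p))"
  unfolding single_kernel_def
  by (intro continuous_intros continuous_on_radial_compose) auto

lemma continuous_on_double_kernel:
  "continuous_on ((- {0}) \<times> UNIV) (\<lambda>p. double_kernel s (fst p) (snd p))"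
  unfolding double_kernel_def
  by (intro continuous_intros continuous_on_radial_compose) auto

text \<open>
  The Hessian of \<open>G\<close> contributes \<open>\<bar>s\<bar>\<^sup>2\<close>; division by \<open>s\<close> leaves \<open>\<bar>s\<bar>\<close>, and lower order terms are
  absorbed because \<open>\<bar>s\<bar> \<ge> \<sigma>\<close>.
\<close>

lemma norm_single_kernel:
  assumes s: "Re s > 0" "cmod s \<ge> \<sigma>" "\<sigma> > 0" and d: "d > 0" "d \<le> norm v"
  shows "norm (single_kernel s v w)
      \<le> (4 / d + 10 / (\<sigma> * d ^ 2) + 10 / (\<sigma> ^ 2 * d ^ 3)) * cmod s * exp (- d * Re s) * norm w"
proof -
  define E where "E = exp (- d * Re s)"
  have s0: "cmod s > 0" using s by linarith
  have 0: "cmod (radial0 s v) \<le> E / d" and 1: "cmod (radial1 s v) \<le> (cmod s / d ^ 2 + 1 / d ^ 3) * E"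
    and 2: "cmod (radial2 s v) * norm v ^ 2 \<le> (cmod s ^ 2 / d + 3 * cmod s / d ^ 2 + 3 / d ^ 3) * E"
    unfolding E_def using norm_radial0[OF s(1) d] norm_radial1'[OF s(1) d] norm_radial2[OF s(1) d] by auto
  have a: "norm ((- s * radial0 s v) *s w) \<le> cmod s * (E / d) * norm w"
    by (simp only: norm_vector_scalar_mult norm_mult norm_minus_cancel)
      (intro mult_right_mono mult_left_mono 0; simp)
  have b: "norm (radial2 s v *s (cdot v w *s cvec v))
      \<le> 3 * ((cmod s ^ 2 / d + 3 * cmod s / d ^ 2 + 3 / d ^ 3) * E) * norm w"
  proof -
    have "norm (radial2 s v *s (cdot v w *s cvec v)) = cmod (radial2 s v) * (cmod (cdot v w) * norm v)"
      by (simp add: norm_vector_scalar_mult norm_cvec norm_mult)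
    also have "\<dots> \<le> cmod (radial2 s v) * ((3 * norm v * norm w) * norm v)"
      by (intro mult_left_mono mult_right_mono norm_cdot_le) auto
    also have "\<dots> = 3 * (cmod (radial2 s v) * norm v ^ 2) * norm w"
      by (simp add: power2_eq_square)
    also have "\<dots> \<le> 3 * ((cmod s ^ 2 / d + 3 * cmod s / d ^ 2 + 3 / d ^ 3) * E) * norm w"
      by (intro mult_right_mono mult_left_mono 2) auto
    finally show ?thesis .
  qed
  have c: "norm (radial1 s v *s w) \<le> ((cmod s / d ^ 2 + 1 / d ^ 3) * E) * norm w"
    by (simp only: norm_vector_scalar_mult) (intro mult_right_mono 1; simp)
  have "norm (inverse s *s (radial2 s v *s (cdot v w *s cvec v) + radial1 s v *s w))
      \<le> inverse (cmod s) * (3 * ((cmod s ^ 2 / d + 3 * cmod s / d ^ 2 + 3 / d ^ 3) * E) * norm w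
        + ((cmod s / d ^ 2 + 1 / d ^ 3) * E) * norm w)"
    by (simp only: norm_vector_scalar_mult norm_inverse)
      (intro mult_left_mono norm_triangle_le add_mono b c; simp)
  with a have "norm (single_kernel s v w) \<le> cmod s * (E / d) * norm w
      + inverse (cmod s) * (3 * ((cmod s ^ 2 / d + 3 * cmod s / d ^ 2 + 3 / d ^ 3) * E) * norm w
        + ((cmod s / d ^ 2 + 1 / d ^ 3) * E) * norm w)"
    unfolding single_kernel_def by (intro norm_triangle_le add_mono)
  also have "\<dots> = (4 / d + 10 / (cmod s * d ^ 2) + 10 / (cmod s ^ 2 * d ^ 3)) * (cmod s * E * norm w)"
    using s0 d by (simp add: field_simps eval_nat_numeral)
  also have "\<dots> \<le> (4 / d + 10 / (\<sigma> * d ^ 2) + 10 / (\<sigma> ^ 2 * d ^ 3)) * (cmod s * E * norm w)"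
    using s d s0 by (intro mult_right_mono add_mono divide_left_mono power_mono mult_pos_pos) (auto simp: E_def)
  finally show ?thesis
    by (simp add: E_def mult.assoc)
qed

lemma norm_double_kernel:
  assumes s: "Re s > 0" "cmod s \<ge> \<sigma>" "\<sigma> > 0" and d: "d > 0" "d \<le> norm v"
  shows "norm (double_kernel s v w) \<le> (6 / d + 6 / (\<sigma> * d ^ 2)) * cmod s * exp (- d * Re s) * norm w"
proof -
  define E where "E = exp (- d * Re s)"
  have s0: "cmod s > 0" using s by linarith
  have "norm (double_kernel s v w) \<le> cmod (radial1 s v) * (6 * norm v * norm w)"
    unfolding double_kernel_def norm_vector_scalar_mult by (intro mult_left_mono norm_ccross) auto
  also have "\<dots> = 6 * (cmod (radial1 s v) * norm v) * norm w"
    by simp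
  also have "\<dots> \<le> 6 * ((cmod s / d + 1 / d ^ 2) * E) * norm w"
    unfolding E_def by (intro mult_right_mono mult_left_mono norm_radial1 s d) auto
  also have "\<dots> = (6 / d + 6 / (cmod s * d ^ 2)) * (cmod s * E * norm w)"
    using s0 d by (simp add: field_simps)
  also have "\<dots> \<le> (6 / d + 6 / (\<sigma> * d ^ 2)) * (cmod s * E * norm w)"
    using s d s0 by (intro mult_right_mono add_mono divide_left_mono mult_pos_pos) (auto simp: E_def)
  finally show ?thesis
    by (simp add: E_def mult.assoc)
qed

context compact_C2_surface
begin

text \<open>
  A closed ball around \<open>x\<close> that misses the surface keeps \<open>z - y\<close> away from the singularity; by
  compactness the derivatives of the kernel are bounded there.
\<close>

lemma surface_potential_has_derivative:
  fixes k :: "real^3 \<Rightarrow> real^3 \<Rightarrow> 'b::{banach, second_countable_topology}"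
  assumes x: "x \<notin> \<Gamma>"
    and k': "\<And>v y. v \<noteq> 0 \<Longrightarrow> y \<in> \<Gamma> \<Longrightarrow> ((\<lambda>v. k v y) has_derivative k' v y) (at v)"
    and cont: "continuous_on ((- {0}) \<times> \<Gamma>) (\<lambda>p. k (fst p) (snd p))"
    and cont': "\<And>h. continuous_on ((- {0}) \<times> \<Gamma>) (\<lambda>p. k' (fst p) (snd p) h)"
  shows "((\<lambda>z. LINT y|S. k (z - y) y) has_derivative (\<lambda>h. LINT y|S. k' (x - y) y h)) (at x)"
proof -
  obtain e where e: "e > 0" "cball x e \<inter> \<Gamma> = {}"
    using closed_surface x open_Compl[OF closed_surface] open_contains_cball[of "- \<Gamma>"] by blast
  have ne: "z - y \<noteq> 0" if "z \<in> cball x e" "y \<in> \<Gamma>" for z y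
    using that e(2) by auto
  have "\<exists>B. \<forall>z\<in>cball x e. \<forall>y\<in>\<Gamma>. norm (k' (z - y) y i) \<le> B" for i
  proof -
    have "continuous_on (cball x e \<times> \<Gamma>) (\<lambda>p. k' (fst p - snd p) (snd p) i)"
      by (rule continuous_on_pair_compose[OF cont'[of i]]) (use ne in \<open>auto intro!: continuous_intros\<close>)
    then have "compact ((\<lambda>p. k' (fst p - snd p) (snd p) i) ` (cball x e \<times> \<Gamma>))"
      by (intro compact_continuous_image compact_Times compact_cball compact_surface)
    from compact_imp_bounded[OF this]
    obtain B where "\<forall>w\<in>(\<lambda>p. k' (fst p - snd p) (snd p) i) ` (cball x e \<times> \<Gamma>). norm w \<le> B"
      unfolding bounded_iff by blast
    then show ?thesis
      by (intro exI[of _ B]) auto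
  qed
  then obtain B where B: "\<And>i z y. z \<in> cball x e \<Longrightarrow> y \<in> \<Gamma> \<Longrightarrow> norm (k' (z - y) y i) \<le> B i"
    by metis
  show ?thesis
  proof (rule has_derivative_integral[OF finite_measure_S e(1), where B = "\<Sum>i\<in>UNIV. max 0 (B (axis i 1))"])
    show "0 \<le> (\<Sum>i\<in>UNIV. max 0 (B (axis i 1)))"
      by (intro sum_nonneg) simp
    show "integrable S (\<lambda>y. k (z - y) y)" if "z \<in> ball x e" for z
    proof (rule continuous_on_imp_integrable_S)
      show "continuous_on \<Gamma> (\<lambda>y. k (z - y) y)"
        by (rule continuous_on_pair_compose[OF cont]) (use ne that in \<open>auto intro!: continuous_intros\<close>)
    qed
    show "((\<lambda>z. k (z - y) y) has_derivative k' (z - y) y) (at z)" if "z \<in> ball x e" "y \<in> space S" for z y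
    proof -
      have "((\<lambda>z. z - y) has_derivative (\<lambda>h. h)) (at z)"
        by (auto intro!: derivative_eq_intros)
      from has_derivative_compose[OF this k'[of "z - y" y]] show ?thesis
        using ne that by auto
    qed
    show "(\<lambda>y. k' (x - y) y h) \<in> borel_measurable S" for h
    proof (rule continuous_on_imp_measurable_S)
      show "continuous_on \<Gamma> (\<lambda>y. k' (x - y) y h)"
        by (rule continuous_on_pair_compose[OF cont'[of h]]) (use x in \<open>auto intro!: continuous_intros\<close>)
    qed
    show "norm (k' (z - y) y h) \<le> (\<Sum>i\<in>UNIV. max 0 (B (axis i 1))) * norm h"
      if z: "z \<in> ball x e" and y: "y \<in> space S" for z y h
    proof -
      have lin: "linear (k' (z - y) y)"
        using k'[of "z - y" y] ne[of z y] z y has_derivative_linear by auto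
      have "k' (z - y) y h = k' (z - y) y (\<Sum>i\<in>UNIV. (h $ i) *\<^sub>R axis i 1)"
        by (simp add: sum_axis)
      also have "\<dots> = (\<Sum>i\<in>UNIV. (h $ i) *\<^sub>R k' (z - y) y (axis i 1))"
        by (simp add: linear_sum[OF lin] linear_cmul[OF lin])
      finally have "norm (k' (z - y) y h) \<le> (\<Sum>i\<in>UNIV. norm ((h $ i) *\<^sub>R k' (z - y) y (axis i 1)))"
        using norm_sum by metis
      also have "\<dots> \<le> (\<Sum>i\<in>UNIV. norm h * max 0 (B (axis i 1)))"
        using B[of z y] z y
        by (intro sum_mono) (auto intro!: mult_mono component_le_norm_cart simp: le_max_iff_disj)
      finally show ?thesis
        by (simp add: sum_distrib_left[symmetric] mult.commute)
    qed
  qed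
qed

lemma kernel_integrable:
  fixes K :: "real^3 \<Rightarrow> complex^3 \<Rightarrow> 'b::{banach, second_countable_topology}"
  assumes "x \<notin> \<Gamma>" and "\<phi> \<in> regular_tangential_fields \<Gamma>"
    and K: "continuous_on ((- {0}) \<times> UNIV) (\<lambda>p. K (fst p) (snd p))"
  shows "integrable S (\<lambda>y. K (x - y) (\<phi> y))"
proof (rule continuous_on_imp_integrable_S)
  show "continuous_on \<Gamma> (\<lambda>y. K (x - y) (\<phi> y))"
    by (rule continuous_on_pair_compose[OF K _ regular_field_continuous[OF assms(2)]])
      (use assms(1) in \<open>auto intro!: continuous_intros\<close>)
qed

lemma integral_nth:
  fixes f :: "real^3 \<Rightarrow> complex^3"
  assumes "integrable S f" shows "(LINT y|S. f y) $ i = (LINT y|S. f y $ i)"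
  using integral_bounded_linear[OF bounded_linear_vec_nth assms, of i] by simp

lemma vector_potential_has_derivative:
  assumes x: "x \<notin> \<Gamma>" and \<phi>: "\<phi> \<in> regular_tangential_fields \<Gamma>"
  shows "((\<lambda>z. LINT y|S. fundamental_solution s (z - y) *s \<phi> y) has_derivative
      (\<lambda>h. LINT y|S. (of_real ((x - y) \<bullet> h) * radial1 s (x - y)) *s \<phi> y)) (at x)"
  unfolding fundamental_solution_radial
proof (rule surface_potential_has_derivative[OF x])
  have \<phi>c: "continuous_on ((- {0}) \<times> \<Gamma>) (\<lambda>p. \<phi> (snd p))"
    by (rule continuous_on_compose2[OF regular_field_continuous[OF \<phi>]]) (auto intro!: continuous_intros)
  show "continuous_on ((- {0}) \<times> \<Gamma>) (\<lambda>p. radial0 s (fst p) *s \<phi> (snd p))"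
    by (intro continuous_intros continuous_on_radial_compose \<phi>c) auto
  show "continuous_on ((- {0}) \<times> \<Gamma>) (\<lambda>p. (of_real (fst p \<bullet> h) * radial1 s (fst p)) *s \<phi> (snd p))" for h
    by (intro continuous_intros continuous_on_radial_compose \<phi>c) auto
  show "((\<lambda>v. radial0 s v *s \<phi> y) has_derivative (\<lambda>h. (of_real (v \<bullet> h) * radial1 s v) *s \<phi> y)) (at v)"
    if "v \<noteq> 0" for v y
    by (rule bounded_linear.has_derivative[OF bounded_bilinear.bounded_linear_left[OF bounded_bilinear_vector_scalar_mult]
          radial0_has_derivative[OF that]])
qed

text \<open>
  Integration by parts moves the surface divergence onto \<open>y \<mapsto> G (z - y)\<close>, whose derivative is that of
  \<open>G\<close> with the opposite sign.  After this step no derivative of the density is left, which is why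
  a bound by an \<open>L\<^sup>p\<close> norm is possible.
\<close>

lemma scalar_potential_by_parts:
  assumes z: "z \<notin> \<Gamma>" and \<phi>: "\<phi> \<in> regular_tangential_fields \<Gamma>"
  shows "(LINT y|S. fundamental_solution s (z - y) * surface_div \<Gamma> \<phi> y)
      = (LINT y|S. radial1 s (z - y) * cdot (z - y) (\<phi> y))"
proof -
  let ?g = "\<lambda>y. radial0 s (z - y)"
  have D: "(?g has_derivative (\<lambda>h. - (of_real ((z - y) \<bullet> h) * radial1 s (z - y)))) (at y)" if "y \<noteq> z" for y
  proof -
    have "((\<lambda>y. z - y) has_derivative (\<lambda>h. - h)) (at y)"
      by (auto intro!: derivative_eq_intros)
    from has_derivative_compose[OF this radial0_has_derivative[of "z - y" s]] show ?thesis
      using that by simp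
  qed
  have C1: "C1_on (- {z}) ?g"
    by (rule C1_onI[OF D]) (auto intro!: continuous_intros continuous_on_radial_compose)
  have "(LINT y|S. ?g y * surface_div \<Gamma> \<phi> y) = - (LINT y|S. clin (frechet_derivative ?g (at y)) (\<phi> y))"
    by (rule surface_integration_by_parts[OF \<phi> C1]) (use z in auto)
  also have "\<dots> = - (LINT y|S. - (radial1 s (z - y) * cdot (z - y) (\<phi> y)))"
  proof (rule arg_cong[where f=uminus], rule Bochner_Integration.integral_cong[OF refl])
    fix y assume "y \<in> space S"
    then have "y \<noteq> z" using z by auto
    from frechet_derivative_at[OF D[OF this]]
    have "clin (frechet_derivative ?g (at y)) (\<phi> y)
        = clin (\<lambda>h. - (of_real ((z - y) \<bullet> h) * radial1 s (z - y))) (\<phi> y)"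
      by simp
    also have "\<dots> = - (radial1 s (z - y) * cdot (z - y) (\<phi> y))"
      by (rule clin_inner)
    finally show "clin (frechet_derivative ?g (at y)) (\<phi> y) = - (radial1 s (z - y) * cdot (z - y) (\<phi> y))" .
  qed
  finally show ?thesis
    unfolding fundamental_solution_radial by simp
qed

lemma scalar_potential_has_derivative:
  assumes x: "x \<notin> \<Gamma>" and \<phi>: "\<phi> \<in> regular_tangential_fields \<Gamma>"
  shows "((\<lambda>z. LINT y|S. fundamental_solution s (z - y) * surface_div \<Gamma> \<phi> y) has_derivative
      (\<lambda>h. LINT y|S. radial1 s (x - y) * cdot h (\<phi> y)
          + of_real ((x - y) \<bullet> h) * radial2 s (x - y) * cdot (x - y) (\<phi> y))) (at x)"
proof -
  have "((\<lambda>z. LINT y|S. radial1 s (z - y) * cdot (z - y) (\<phi> y)) has_derivative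
      (\<lambda>h. LINT y|S. radial1 s (x - y) * cdot h (\<phi> y)
          + of_real ((x - y) \<bullet> h) * radial2 s (x - y) * cdot (x - y) (\<phi> y))) (at x)"
  proof (rule surface_potential_has_derivative[OF x])
    have \<phi>c: "continuous_on ((- {0}) \<times> \<Gamma>) (\<lambda>p. \<phi> (snd p))"
      by (rule continuous_on_compose2[OF regular_field_continuous[OF \<phi>]]) (auto intro!: continuous_intros)
    show "continuous_on ((- {0}) \<times> \<Gamma>) (\<lambda>p. radial1 s (fst p) * cdot (fst p) (\<phi> (snd p)))"
      by (intro continuous_intros continuous_on_radial_compose \<phi>c) auto
    show "continuous_on ((- {0}) \<times> \<Gamma>) (\<lambda>p. radial1 s (fst p) * cdot h (\<phi> (snd p))
        + of_real (fst p \<bullet> h) * radial2 s (fst p) * cdot (fst p) (\<phi> (snd p)))" for h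
      by (intro continuous_intros continuous_on_radial_compose \<phi>c) auto
    show "((\<lambda>v. radial1 s v * cdot v (\<phi> y)) has_derivative (\<lambda>h. radial1 s v * cdot h (\<phi> y)
        + of_real (v \<bullet> h) * radial2 s v * cdot v (\<phi> y))) (at v)" if "v \<noteq> 0" for v y
      by (intro has_derivative_mult radial1_has_derivative that bounded_linear_imp_has_derivative
          bounded_bilinear.bounded_linear_left[OF bounded_bilinear_cdot])
  qed
  then show ?thesis
    by (rule has_derivative_transform_within_open[OF _ open_Compl[OF closed_surface]])
      (use x scalar_potential_by_parts[OF _ \<phi>] in auto)
qed

lemma single_layer_eq:
  assumes x: "x \<notin> \<Gamma>" and \<phi>: "\<phi> \<in> regular_tangential_fields \<Gamma>"
  shows "single_layer \<Gamma> s \<phi> x = (LINT y|S. single_kernel s (x - y) (\<phi> y))"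
proof -
  let ?u = "\<lambda>z. LINT y|S. fundamental_solution s (z - y) * surface_div \<Gamma> \<phi> y"
  have "single_layer \<Gamma> s \<phi> x $ i = (LINT y|S. single_kernel s (x - y) (\<phi> y)) $ i" for i
  proof -
    let ?H = "\<lambda>y. radial1 s (x - y) * cdot (axis i 1) (\<phi> y)
          + of_real ((x - y) \<bullet> axis i 1) * radial2 s (x - y) * cdot (x - y) (\<phi> y)"
    have "grad ?u x $ i = (LINT y|S. ?H y)"
      using fun_cong[OF frechet_derivative_at[OF scalar_potential_has_derivative[OF x \<phi>, of s]], of "axis i 1"]
      by (simp add: grad_def partial_deriv_def)
    moreover have "(LINT y|S. fundamental_solution s (x - y) *s \<phi> y) $ i = (LINT y|S. radial0 s (x - y) * \<phi> y $ i)"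
      unfolding fundamental_solution_radial
      by (subst integral_nth, rule kernel_integrable[OF x \<phi>])
        (auto intro!: continuous_intros continuous_on_radial_compose)
    ultimately have "single_layer \<Gamma> s \<phi> x $ i
        = - s * (LINT y|S. radial0 s (x - y) * \<phi> y $ i) + inverse s * (LINT y|S. ?H y)"
      by (simp add: single_layer_def)
    also have "\<dots> = (LINT y|S. - s * (radial0 s (x - y) * \<phi> y $ i)) + (LINT y|S. inverse s * ?H y)"
      by simp
    also have "\<dots> = (LINT y|S. - s * (radial0 s (x - y) * \<phi> y $ i) + inverse s * ?H y)"
    proof (rule Bochner_Integration.integral_add[symmetric])
      show "integrable S (\<lambda>y. - s * (radial0 s (x - y) * \<phi> y $ i))"
        by (rule kernel_integrable[OF x \<phi>, of "\<lambda>v w. - s * (radial0 s v * w $ i)"])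
          (intro continuous_intros continuous_on_radial_compose; auto)
      show "integrable S (\<lambda>y. inverse s * ?H y)"
        by (rule kernel_integrable[OF x \<phi>, of "\<lambda>v w. inverse s * (radial1 s v * cdot (axis i 1) w
          + of_real (v \<bullet> axis i 1) * radial2 s v * cdot v w)"])
          (intro continuous_intros continuous_on_radial_compose; auto)
    qed
    also have "\<dots> = (LINT y|S. single_kernel s (x - y) (\<phi> y) $ i)"
      by (simp only: single_kernel_nth)
    also have "\<dots> = (LINT y|S. single_kernel s (x - y) (\<phi> y)) $ i"
      by (rule integral_nth[symmetric], rule kernel_integrable[OF x \<phi> continuous_on_single_kernel])
    finally show ?thesis .
  qed
  then show ?thesis
    by (simp add: vec_eq_iff)
qed

lemma double_layer_eq:
  assumes x: "x \<notin> \<Gamma>" and \<phi>: "\<phi> \<in> regular_tangential_fields \<Gamma>"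
  shows "double_layer \<Gamma> s \<phi> x = (LINT y|S. double_kernel s (x - y) (\<phi> y))"
proof -
  let ?U = "\<lambda>z. LINT y|S. fundamental_solution s (z - y) *s \<phi> y"
  let ?I = "\<lambda>j i. LINT y|S. radial1 s (x - y) * (of_real ((x - y) $ j) * \<phi> y $ i)"
  have int: "integrable S (\<lambda>y. radial1 s (x - y) * (of_real ((x - y) $ j) * \<phi> y $ i))" for i j
    by (rule kernel_integrable[OF x \<phi>, of "\<lambda>v w. radial1 s v * (of_real (v $ j) * w $ i)"])
      (intro continuous_intros continuous_on_radial_compose; auto)
  have pd: "partial_deriv j (\<lambda>z. ?U z $ i) x = ?I j i" for i j
  proof -
    have "((\<lambda>z. ?U z $ i) has_derivative
        (\<lambda>h. (LINT y|S. (of_real ((x - y) \<bullet> h) * radial1 s (x - y)) *s \<phi> y) $ i)) (at x)"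
      by (rule bounded_linear.has_derivative[OF bounded_linear_vec_nth vector_potential_has_derivative[OF x \<phi>]])
    from fun_cong[OF frechet_derivative_at[OF this], of "axis j 1"]
    have "partial_deriv j (\<lambda>z. ?U z $ i) x = (LINT y|S. (of_real ((x - y) \<bullet> axis j 1) * radial1 s (x - y)) *s \<phi> y) $ i"
      by (simp add: partial_deriv_def)
    also have "\<dots> = (LINT y|S. ((of_real ((x - y) \<bullet> axis j 1) * radial1 s (x - y)) *s \<phi> y) $ i)"
      by (rule integral_nth, rule kernel_integrable[OF x \<phi>, of "\<lambda>v w. (of_real (v \<bullet> axis j 1) * radial1 s v) *s w"])
        (intro continuous_intros continuous_on_radial_compose; auto)
    also have "\<dots> = ?I j i"
      by (rule Bochner_Integration.integral_cong) (auto simp: inner_axis algebra_simps)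
    finally show ?thesis .
  qed
  have K: "(LINT y|S. double_kernel s (x - y) (\<phi> y)) $ i = (LINT y|S. double_kernel s (x - y) (\<phi> y) $ i)" for i
    by (rule integral_nth, rule kernel_integrable[OF x \<phi> continuous_on_double_kernel])
  have diff: "?I j i - ?I j' i' = (LINT y|S. radial1 s (x - y) * (of_real ((x - y) $ j) * \<phi> y $ i - of_real ((x - y) $ j') * \<phi> y $ i'))"
    for i j i' j'
    using Bochner_Integration.integral_diff[OF int[of j i] int[of j' i']] by (simp add: right_diff_distrib)
  show ?thesis
    unfolding double_layer_def curl_def pd diff by (simp add: vec_eq_iff forall_3 K[unfolded double_kernel_def] double_kernel_def)
qed

end


section \<open>The space of p-integrable fields\<close>

lemma powr_add_le:
  fixes a b p :: real
  assumes "a \<ge> 0" "b \<ge> 0" "p \<ge> 0"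
  shows "(a + b) powr p \<le> 2 powr p * (a powr p + b powr p)"
proof -
  have "(a + b) powr p \<le> (2 * max a b) powr p"
    by (rule powr_mono2) (use assms in auto)
  also have "\<dots> = 2 powr p * max a b powr p"
    using assms by (simp add: powr_mult)
  also have "\<dots> \<le> 2 powr p * (a powr p + b powr p)"
    by (intro mult_left_mono) (auto simp: max_def)
  finally show ?thesis .
qed

lemma le_one_plus_powr:
  fixes t p :: real
  assumes "t \<ge> 0" "p \<ge> 1" shows "t \<le> 1 + t powr p"
proof (cases "t \<le> 1")
  case False
  then have "t powr 1 \<le> t powr p"
    using assms by (intro powr_mono) auto
  then show ?thesis
    using False by simp
qed (simp add: add_increasing2)

context compact_C2_surface
begin

lemma Lp_norm_nonneg: "Lp_norm \<Gamma> p f \<ge> 0"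
  by (simp add: Lp_norm_def)

text \<open>
  Normalising to \<open>\<parallel>f\<parallel>\<^sub>p = 1\<close> and using \<open>t \<le> 1 + t\<^sup>p\<close> gives an embedding constant that does not
  depend on \<open>p\<close>.
\<close>

lemma Lp_imp_L1:
  assumes p: "p \<ge> 1" and f: "f \<in> Lp_fields \<Gamma> p"
  shows "integrable S f"
    and "(LINT y|S. norm (f y)) \<le> (1 + measure S \<Gamma>) * Lp_norm \<Gamma> p f"
proof -
  interpret finite_measure S by (rule finite_measure_S)
  have meas [measurable]: "f \<in> borel_measurable S" and int: "integrable S (\<lambda>y. norm (f y) powr p)"
    using f unfolding Lp_fields_def by auto
  show intf: "integrable S f"
    by (rule Bochner_Integration.integrable_bound[of S "\<lambda>y. 1 + norm (f y) powr p"])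
      (use int le_one_plus_powr[OF norm_ge_zero p] in \<open>auto intro!: AE_I2\<close>)
  define I where "I = (LINT y|S. norm (f y) powr p)"
  have I0: "I \<ge> 0"
    by (simp add: I_def)
  show "(LINT y|S. norm (f y)) \<le> (1 + measure S \<Gamma>) * Lp_norm \<Gamma> p f"
  proof (cases "I = 0")
    case True
    then have "AE y in S. norm (f y) powr p = 0"
      using int by (subst (asm) I_def) (simp add: integral_nonneg_eq_0_iff_AE)
    then have "AE y in S. norm (f y) = 0"
      by eventually_elim simp
    then have "(LINT y|S. norm (f y)) = 0"
      by (rule integral_eq_zero_AE)
    then show ?thesis
      by (simp add: Lp_norm_nonneg)
  next
    case False
    define N where "N = I powr (1 / p)"
    have N: "N > 0" and Np: "N powr p = I"
      using False I0 p by (auto simp: N_def powr_powr)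
    have "(LINT y|S. norm (f y) / N) \<le> (LINT y|S. 1 + norm (f y) powr p / I)"
    proof (rule integral_mono)
      show "norm (f y) / N \<le> 1 + norm (f y) powr p / I" for y
        using le_one_plus_powr[OF _ p, of "norm (f y) / N"] N Np by (simp add: powr_divide)
    qed (use int intf in auto)
    also have "\<dots> = measure S \<Gamma> + 1"
      using int False by (simp add: I_def[symmetric])
    finally have "(LINT y|S. norm (f y)) \<le> (measure S \<Gamma> + 1) * N"
      using N by (simp add: field_simps)
    then show ?thesis
      by (simp add: Lp_norm_def I_def[symmetric] N_def[symmetric] add.commute)
  qed
qed

text \<open>
  The surface has distance at least \<open>d\<close> from \<open>x\<close>, so only values \<open>K v\<close> with \<open>\<bar>v\<bar> \<ge> d\<close> enter and the \<open>L\<^sup>1\<close> norm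
  of the field controls the integral.
\<close>

lemma kernel_operator:
  assumes p: "p \<ge> 1" and d: "d > 0" "\<And>y. y \<in> \<Gamma> \<Longrightarrow> d \<le> norm (x - y)"
    and cont: "continuous_on ((- {0}) \<times> UNIV) (\<lambda>q. K (fst q) (snd q))"
    and add: "\<And>v w w'. K v (w + w') = K v w + K v w'"
    and mult: "\<And>v c w. K v (c *s w) = c *s K v w"
    and bound: "\<And>v w. d \<le> norm v \<Longrightarrow> norm (K v w) \<le> A * norm w" and A: "A \<ge> 0"
  defines "T \<equiv> \<lambda>f. LINT y|S. K (x - y) (f y)"
  shows "bounded_linear_Lp \<Gamma> p T"
    and "f \<in> Lp_fields \<Gamma> p \<Longrightarrow> norm (T f) \<le> (1 + measure S \<Gamma>) * A * Lp_norm \<Gamma> p f"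
proof -
  have meas: "(\<lambda>y. K (x - y) (f y)) \<in> borel_measurable S" if "f \<in> borel_measurable S" for f
  proof -
    have "(\<lambda>y. x - y) \<in> borel_measurable S"
      by (intro continuous_on_imp_measurable_S continuous_intros)
    then have "(\<lambda>y. (x - y, f y)) \<in> borel_measurable S"
      using that by (rule borel_measurable_Pair)
    then have "(\<lambda>y. (x - y, f y)) \<in> measurable S (restrict_space borel ((- {0}) \<times> UNIV))"
      by (rule measurable_restrict_space2[rotated]) (use d in force)
    from measurable_compose[OF this borel_measurable_continuous_on_restrict[OF cont]]
    show ?thesis by simp
  qed
  have int: "integrable S (\<lambda>y. K (x - y) (f y))" if f: "f \<in> Lp_fields \<Gamma> p" for f
  proof (rule Bochner_Integration.integrable_bound)
    show "integrable S (\<lambda>y. A * norm (f y))"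
      using Lp_imp_L1(1)[OF p f] by simp
    show "(\<lambda>y. K (x - y) (f y)) \<in> borel_measurable S"
      using f by (intro meas) (simp add: Lp_fields_def)
    show "AE y in S. norm (K (x - y) (f y)) \<le> norm (A * norm (f y))"
      using bound d A by (auto intro!: AE_I2)
  qed
  have est: "norm (T f) \<le> (1 + measure S \<Gamma>) * A * Lp_norm \<Gamma> p f" if f: "f \<in> Lp_fields \<Gamma> p" for f
  proof -
    have "norm (T f) \<le> (LINT y|S. norm (K (x - y) (f y)))"
      unfolding T_def by (rule integral_norm_bound)
    also have "\<dots> \<le> (LINT y|S. A * norm (f y))"
      by (rule integral_mono) (use int[OF f] Lp_imp_L1(1)[OF p f] bound d in auto)
    also have "\<dots> = A * (LINT y|S. norm (f y))"
      by simp
    also have "\<dots> \<le> A * ((1 + measure S \<Gamma>) * Lp_norm \<Gamma> p f)"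
      by (intro mult_left_mono Lp_imp_L1 p f A)
    finally show ?thesis
      by (simp add: mult.commute mult.left_commute)
  qed
  then show "f \<in> Lp_fields \<Gamma> p \<Longrightarrow> norm (T f) \<le> (1 + measure S \<Gamma>) * A * Lp_norm \<Gamma> p f" .
  show "bounded_linear_Lp \<Gamma> p T"
    unfolding bounded_linear_Lp_def
  proof (intro conjI ballI allI)
    show "T (\<lambda>y. f y + g y) = T f + T g" if "f \<in> Lp_fields \<Gamma> p" "g \<in> Lp_fields \<Gamma> p" for f g
      unfolding T_def add by (rule Bochner_Integration.integral_add[OF int int]) fact+
    show "T (\<lambda>y. c *s f y) = c *s T f" if "f \<in> Lp_fields \<Gamma> p" for c f
      unfolding T_def mult
      by (rule integral_bounded_linear[OF bounded_bilinear.bounded_linear_right[OF bounded_bilinear_vector_scalar_mult] int])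
        fact
    show "\<exists>B. \<forall>f\<in>Lp_fields \<Gamma> p. norm (T f) \<le> B * Lp_norm \<Gamma> p f"
      using est by blast
  qed
qed

section \<open>Density of the regular tangential fields\<close>

lemma L1_approx_trans:
  fixes f g h :: "real^3 \<Rightarrow> 'b::{banach, second_countable_topology}"
  assumes "integrable S f" "integrable S g" "integrable S h"
  shows "(LINT y|S. norm (f y - h y)) \<le> (LINT y|S. norm (f y - g y)) + (LINT y|S. norm (g y - h y))"
proof -
  have "(LINT y|S. norm (f y - h y)) \<le> (LINT y|S. norm (f y - g y) + norm (g y - h y))"
  proof (rule integral_mono)
    show "norm (f y - h y) \<le> norm (f y - g y) + norm (g y - h y)" for y
      using norm_triangle_ineq[of "f y - g y" "g y - h y"] by simp
  qed (use assms in auto)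
  then show ?thesis
    using assms by simp
qed

lemma borel_subset_in_sets_S: "A \<in> sets borel \<Longrightarrow> A \<subseteq> \<Gamma> \<Longrightarrow> A \<in> sets S"
  unfolding sets_S using closed_surface by (simp add: sets_restrict_space_iff)

lemma sets_S_borel: "A \<in> sets S \<Longrightarrow> A \<in> sets borel"
  unfolding sets_S using closed_surface by (simp add: sets_restrict_space_iff)

lemma compact_inner_approximation:
  assumes A: "A \<in> sets S" and e: "e > 0"
  obtains K where "compact K" "K \<subseteq> A" "measure S A - e < measure S K"
proof -
  interpret finite_measure S by (rule finite_measure_S)
  define M where "M = distr S borel (\<lambda>y. y)"
  have id: "(\<lambda>y. y) \<in> measurable S borel"
    by (rule continuous_on_imp_measurable_S) (intro continuous_intros)
  have M: "emeasure M B = emeasure S B" if "B \<in> sets borel" "B \<subseteq> \<Gamma>" for B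
    unfolding M_def using that by (subst emeasure_distr[OF id]) (auto simp: Int_absorb2)
  have A\<Gamma>: "A \<subseteq> \<Gamma>"
    using sets.sets_into_space[OF A] by simp
  have eM: "emeasure M A = (SUP K \<in> {K. K \<subseteq> A \<and> compact K}. emeasure M K)"
  proof (rule inner_regular)
    have "emeasure M (space M) = emeasure S \<Gamma>"
      unfolding M_def by (subst emeasure_distr[OF id]) auto
    then show "emeasure M (space M) \<noteq> \<infinity>"
      using emeasure_finite[of \<Gamma>] by simp
  qed (use sets_S_borel[OF A] in \<open>auto simp: M_def\<close>)
  have "\<exists>K. compact K \<and> K \<subseteq> A \<and> measure S A - e < measure S K"
  proof (rule ccontr)
    assume no: "\<not> ?thesis"
    have *: "measure S K \<le> measure S A - e" if "compact K" "K \<subseteq> A" for K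
      by (rule leI) (use no that in blast)
    have nn: "0 \<le> measure S A - e"
      using *[of "{}"] by simp
    have "emeasure M A \<le> ennreal (measure S A - e)"
      unfolding eM
    proof (rule SUP_least)
      fix K assume K: "K \<in> {K. K \<subseteq> A \<and> compact K}"
      then have "emeasure M K = ennreal (measure S K)"
        using A\<Gamma> M[of K] by (auto simp: emeasure_eq_measure compact_imp_closed)
      then show "emeasure M K \<le> ennreal (measure S A - e)"
        using * K by (auto intro!: ennreal_leI)
    qed
    then have "measure S A \<le> measure S A - e"
      using M[OF sets_S_borel[OF A] A\<Gamma>] nn by (simp add: emeasure_eq_measure)
    then show False
      using e by simp
  qed
  then show ?thesis
    using that by blast
qed

text \<open>
  Indicators of Borel sets are approximated by indicators of compact subsets (inner regularity), and
  those by the continuous functions \<open>max 0 (1 - n dist(y, K))\<close>.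
\<close>

lemma continuous_dense_L1:
  fixes f :: "real^3 \<Rightarrow> 'b::euclidean_space"
  assumes "integrable S f" "e > 0"
  shows "\<exists>g. continuous_on UNIV g \<and> (LINT y|S. norm (f y - g y)) < e"
  using assms
proof (induction f arbitrary: e rule: integrable_induct)
  case (base A c)
  interpret finite_measure S by (rule finite_measure_S)
  have cn: "norm c + 1 > 0"
    by (simp add: add_nonneg_pos)
  obtain K where K: "compact K" "K \<subseteq> A" "measure S A - e / (2 * (norm c + 1)) < measure S K"
    using compact_inner_approximation[OF base(1), of "e / (2 * (norm c + 1))"] base cn by auto
  have KS: "K \<in> sets S"
  proof (rule borel_subset_in_sets_S)
    show "K \<in> sets borel"
      using compact_imp_closed[OF K(1)] by simp
    show "K \<subseteq> \<Gamma>"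
      using K(2) sets.sets_into_space[OF base(1)] by simp
  qed
  have "(LINT y|S. norm (indicator A y *\<^sub>R c - indicator K y *\<^sub>R c)) = (LINT y|S. indicator (A - K) y *\<^sub>R norm c)"
    using K(2) by (intro Bochner_Integration.integral_cong) (auto simp: indicator_def)
  also have "\<dots> = measure S (A - K) * norm c"
  proof -
    have "(A - K) \<inter> \<Gamma> = A - K"
      using sets.sets_into_space[OF base(1)] by auto
    then show ?thesis
      using base(1) KS by simp
  qed
  also have "measure S (A - K) = measure S A - measure S K"
    by (rule finite_measure_Diff[OF base(1) KS K(2)])
  also have "(measure S A - measure S K) * norm c \<le> e / (2 * (norm c + 1)) * norm c"
    using K(3) by (intro mult_right_mono) auto
  also have "\<dots> < e / (2 * (norm c + 1)) * (norm c + 1)"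
    using base cn by (intro mult_strict_left_mono) auto
  also have "\<dots> = e / 2"
  proof -
    have "e / (2 * t) * t = e / 2" if "t > 0" for t :: real
      using that by simp
    from this[OF cn] show ?thesis .
  qed
  finally have 1: "(LINT y|S. norm (indicator A y *\<^sub>R c - indicator K y *\<^sub>R c)) < e / 2" .
  have intK: "integrable S (\<lambda>y. indicator K y *\<^sub>R c)" and intA: "integrable S (\<lambda>y. indicator A y *\<^sub>R c)"
    using KS base(1) by (auto intro!: integrable_real_indicator simp: emeasure_eq_measure)
  show ?case
  proof (cases "K = {}")
    case True
    with 1 base show ?thesis
      by (intro exI[of _ "\<lambda>_. 0"]) auto
  next
    case False
    define g where "g n y = max 0 (1 - real n * infdist y K) *\<^sub>R c" for n y
    have gc: "continuous_on T (g n)" for n T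
      unfolding g_def[abs_def] by (intro continuous_intros)
    have "(\<lambda>n. LINT y|S. norm (indicator K y *\<^sub>R c - g n y)) \<longlonglongrightarrow> (LINT y|S. 0)"
    proof (rule integral_dominated_convergence[where w = "\<lambda>_. 2 * norm c"])
      show "(\<lambda>y. norm (indicator K y *\<^sub>R c - g n y)) \<in> borel_measurable S" for n
      proof -
        note [measurable] = borel_measurable_integrable[OF intK] continuous_on_imp_measurable_S[OF gc, of n]
        show ?thesis by measurable
      qed
      show "AE y in S. (\<lambda>n. norm (indicator K y *\<^sub>R c - g n y)) \<longlonglongrightarrow> 0"
      proof (rule AE_I2)
        fix y
        show "(\<lambda>n. norm (indicator K y *\<^sub>R c - g n y)) \<longlonglongrightarrow> 0"
        proof (cases "y \<in> K")
          case True
          then show ?thesis by (simp add: g_def)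
        next
          case out: False
          have i: "infdist y K > 0"
            using out False compact_imp_closed[OF K(1)] in_closed_iff_infdist_zero infdist_nonneg[of y K]
            by (metis less_eq_real_def)
          obtain m where "1 / infdist y K < real m"
            using reals_Archimedean2 by blast
          then have m: "1 < real m * infdist y K"
            using i by (simp add: field_simps)
          have "norm (indicator K y *\<^sub>R c - g n y) = 0" if "n \<ge> m" for n
          proof -
            have "real m * infdist y K \<le> real n * infdist y K"
              using that i by (intro mult_right_mono) auto
            then show ?thesis
              using m out by (simp add: g_def)
          qed
          then show ?thesis
            by (intro tendsto_eventually) (auto simp: eventually_sequentially)
        qed
      qed
      show "AE y in S. norm (norm (indicator K y *\<^sub>R c - g n y)) \<le> 2 * norm c" for n
      proof (rule AE_I2)
        fix y
        have "norm (indicator K y *\<^sub>R c) \<le> norm c" "norm (g n y) \<le> norm c"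
          using infdist_nonneg[of y K]
          by (auto simp: indicator_def g_def max_def intro!: mult_left_le_one_le)
        then show "norm (norm (indicator K y *\<^sub>R c - g n y)) \<le> 2 * norm c"
          using norm_triangle_ineq4[of "indicator K y *\<^sub>R c" "g n y"] by simp
      qed
    qed auto
    then have "eventually (\<lambda>n. (LINT y|S. norm (indicator K y *\<^sub>R c - g n y)) < e / 2) sequentially"
      using base by (intro order_tendstoD(2)[where y = 0]) auto
    then obtain n where n: "(LINT y|S. norm (indicator K y *\<^sub>R c - g n y)) < e / 2"
      by (auto simp: eventually_sequentially)
    have "(LINT y|S. norm (indicator A y *\<^sub>R c - g n y)) < e"
      using L1_approx_trans[OF intA intK continuous_on_imp_integrable_S[OF gc], of n] 1 n by simp
    then show ?thesis
      using gc by blast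
  qed
next
  case (add f g)
  obtain f' where f': "continuous_on UNIV f'" "(LINT y|S. norm (f y - f' y)) < e / 2"
    using add.IH(1)[of "e / 2"] add.prems by auto
  obtain g' where g': "continuous_on UNIV g'" "(LINT y|S. norm (g y - g' y)) < e / 2"
    using add.IH(2)[of "e / 2"] add.prems by auto
  have int': "integrable S f'" "integrable S g'"
    using f' g' by (auto intro: continuous_on_imp_integrable_S continuous_on_subset)
  have "(LINT y|S. norm ((f y + g y) - (f' y + g' y))) \<le> (LINT y|S. norm (f y - f' y) + norm (g y - g' y))"
    by (rule integral_mono) (use add.hyps int' norm_diff_triangle_ineq in auto)
  also have "\<dots> < e"
    using add.hyps int' f' g' by simp
  finally show ?case
    using f' g' by (intro exI[of _ "\<lambda>y. f' y + g' y"]) (auto intro!: continuous_intros)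
next
  case (lim f s)
  have "(\<lambda>i. LINT y|S. norm (f y - s i y)) \<longlonglongrightarrow> (LINT y|S. 0)"
  proof (rule integral_dominated_convergence[where w = "\<lambda>y. 3 * norm (f y)"])
    show "(\<lambda>y. norm (f y - s i y)) \<in> borel_measurable S" for i
    proof -
      note [measurable] = borel_measurable_integrable[OF lim.hyps(1)[of i]] borel_measurable_integrable[OF lim.hyps(4)]
      show ?thesis by measurable
    qed
    show "AE y in S. (\<lambda>i. norm (f y - s i y)) \<longlonglongrightarrow> 0"
    proof (rule AE_I2)
      fix y assume "y \<in> space S"
      from tendsto_diff[OF tendsto_const[of "f y"] lim.hyps(2)[OF this]] show "(\<lambda>i. norm (f y - s i y)) \<longlonglongrightarrow> 0"
        by (simp add: tendsto_norm_zero)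
    qed
    show "AE y in S. norm (norm (f y - s i y)) \<le> 3 * norm (f y)" for i
    proof (rule AE_I2)
      fix y assume "y \<in> space S"
      from lim.hyps(3)[OF this, of i] show "norm (norm (f y - s i y)) \<le> 3 * norm (f y)"
        using norm_triangle_ineq4[of "f y" "s i y"] by simp
    qed
  qed (use lim.hyps(4) in auto)
  then have "eventually (\<lambda>i. (LINT y|S. norm (f y - s i y)) < e / 2) sequentially"
    using lim.prems by (intro order_tendstoD(2)[where y = 0]) auto
  then obtain i where i: "(LINT y|S. norm (f y - s i y)) < e / 2"
    by (auto simp: eventually_sequentially)
  obtain g where g: "continuous_on UNIV g" "(LINT y|S. norm (s i y - g y)) < e / 2"
    using lim.IH[of "e / 2"] lim.prems by auto
  have "integrable S g"
    using g by (auto intro: continuous_on_imp_integrable_S continuous_on_subset)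
  from L1_approx_trans[OF lim.hyps(4) lim.hyps(1)[of i] this] g i show ?case
    by (intro exI[of _ g]) auto
qed

text \<open>
  For a bounded field the continuous approximation may be clamped to the same ball; then the
  \<open>p\<close>-th power of the error is bounded by a multiple of the error, and polynomials approximate the
  clamped field uniformly on the compact surface.
\<close>

lemma C1_dense_bounded:
  fixes f :: "real^3 \<Rightarrow> 'b::euclidean_space"
  assumes f: "f \<in> borel_measurable S" and M: "\<And>y. y \<in> \<Gamma> \<Longrightarrow> norm (f y) \<le> M" "M \<ge> 0"
    and p: "p \<ge> 1" and e: "e > 0"
  shows "\<exists>h. C1_on UNIV h \<and> (LINT y|S. norm (f y - h y) powr p) < e"
proof -
  interpret finite_measure S by (rule finite_measure_S)
  have intf: "integrable S f"
    by (rule integrable_const_bound[of _ M]) (use f M in auto)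
  define c where "c = (2 * M + 1) powr (p - 1)"
  have c: "c > 0"
    using M(2) by (simp add: c_def)
  define \<delta> where "\<delta> = min 1 (e / (2 * c * (measure S \<Gamma> + 1)))"
  have m: "measure S \<Gamma> + 1 > 0"
    by (simp add: add_nonneg_pos)
  have \<delta>: "\<delta> > 0" "\<delta> \<le> 1" "\<delta> * measure S \<Gamma> * c < e / 2"
  proof -
    show "\<delta> > 0" "\<delta> \<le> 1"
      using e c m by (auto simp: \<delta>_def)
    have "\<delta> * measure S \<Gamma> * c < \<delta> * (measure S \<Gamma> + 1) * c"
      using \<open>\<delta> > 0\<close> c by (intro mult_strict_right_mono mult_strict_left_mono) auto
    also have "\<dots> \<le> (e / (2 * c * (measure S \<Gamma> + 1))) * (measure S \<Gamma> + 1) * c"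
      using c m by (intro mult_right_mono) (auto simp: \<delta>_def)
    also have "\<dots> = e / 2"
    proof -
      have "e / (2 * c * t) * t * c = e / 2" if "t > 0" for t :: real
        using that c by simp
      from this[OF m] show ?thesis .
    qed
    finally show "\<delta> * measure S \<Gamma> * c < e / 2" .
  qed
  obtain g where g: "continuous_on UNIV g" "(LINT y|S. norm (f y - g y)) < e / (2 * c)"
    using continuous_dense_L1[OF intf, of "e / (2 * c)"] e c by auto
  define k where "k y = closest_point (cball 0 M) (g y)" for y
  have ball: "convex (cball (0::'b) M)" "closed (cball (0::'b) M)" "cball (0::'b) M \<noteq> {}"
    using M(2) by auto
  have k: "continuous_on UNIV k"
    unfolding k_def[abs_def]
    by (rule continuous_on_compose2[OF continuous_on_closest_point[OF ball, of UNIV] g(1)]) simp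
  have kM: "norm (k y) \<le> M" for y
    using closest_point_in_set[OF ball(2,3), of "g y"] by (simp add: k_def)
  have kf: "norm (f y - k y) \<le> norm (f y - g y)" if "y \<in> \<Gamma>" for y
    using closest_point_lipschitz[OF ball, of "f y" "g y"] M(1)[OF that]
    by (simp add: k_def closest_point_self dist_norm)
  obtain h where h: "polynomial_function h" "\<And>y. y \<in> \<Gamma> \<Longrightarrow> norm (k y - h y) < \<delta>"
    using Stone_Weierstrass_polynomial_function[OF compact_surface continuous_on_subset[OF k] \<delta>(1)] by auto
  have hC1: "C1_on UNIV h"
    by (rule C1_on_polynomial_function[OF h(1)])
  have inth: "integrable S h" and intg: "integrable S g"
    using C1_on_imp_continuous_on[OF hC1] g(1)
    by (auto intro: continuous_on_imp_integrable_S continuous_on_subset)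
  have pw: "norm (f y - h y) powr p \<le> c * norm (f y - g y) + c * \<delta>" if y: "y \<in> \<Gamma>" for y
  proof -
    have t: "norm (f y - h y) \<le> norm (f y - k y) + norm (k y - h y)"
      using norm_triangle_ineq[of "f y - k y" "k y - h y"] by simp
    have "norm (f y - k y) \<le> 2 * M"
      using norm_triangle_ineq4[of "f y" "k y"] M(1)[OF y] kM[of y] by simp
    then have b: "norm (f y - h y) \<le> 2 * M + 1"
      using t h(2)[OF y] \<delta>(2) by simp
    have "norm (f y - h y) powr p = norm (f y - h y) * norm (f y - h y) powr (p - 1)"
      by (cases "f y = h y") (simp_all add: powr_diff)
    also have "\<dots> \<le> norm (f y - h y) * c"
      unfolding c_def using b p by (intro mult_left_mono powr_mono2) auto
    also have "\<dots> \<le> (norm (f y - g y) + \<delta>) * c"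
      using t kf[OF y] h(2)[OF y] c by (intro mult_right_mono) auto
    finally show ?thesis
      by (simp add: algebra_simps)
  qed
  have "(LINT y|S. norm (f y - h y) powr p) \<le> (LINT y|S. c * norm (f y - g y) + c * \<delta>)"
  proof (rule integral_mono)
    show "integrable S (\<lambda>y. c * norm (f y - g y) + c * \<delta>)"
      using intf intg by auto
    then show "integrable S (\<lambda>y. norm (f y - h y) powr p)"
      by (rule Bochner_Integration.integrable_bound)
        (use pw borel_measurable_integrable[OF intf] borel_measurable_integrable[OF inth] \<delta>(1) c in \<open>auto intro!: AE_I2\<close>)
  qed (use pw in auto)
  also have "\<dots> = c * (LINT y|S. norm (f y - g y)) + \<delta> * measure S \<Gamma> * c"
    using intf intg by simp
  also have "\<dots> < c * (e / (2 * c)) + e / 2"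
    using g(2) \<delta>(3) c by (intro add_strict_mono mult_strict_left_mono)
  also have "\<dots> = e"
    using c by simp
  finally show ?thesis
    using hC1 by blast
qed

end


context compact_C2_surface
begin

lemma norm_unit_normal:
  assumes "y \<in> \<Gamma>" shows "norm (unit_normal \<Gamma> y) = 1"
proof -
  obtain W q \<gamma> where "graph_patch \<Gamma> W q \<gamma>" and W: "y \<in> W"
    using patches[OF assms] by blast
  then interpret graph_patch \<Gamma> W q \<gamma> by blast
  obtain c where c: "unit_normal \<Gamma> (X (proj y)) = c *\<^sub>R N (proj y)"
      "c * c * (J (proj y) * J (proj y)) = 1"
    using unit_normal_patch[OF proj_in[OF assms W]] .
  then have "unit_normal \<Gamma> y \<bullet> unit_normal \<Gamma> y = 1"
    using X_proj[OF assms W] by (simp add: N_square)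
  then show ?thesis
    by (simp add: norm_eq_sqrt_inner)
qed

definition tangential_part :: "real^3 \<Rightarrow> complex^3 \<Rightarrow> complex^3" where
  "tangential_part y w = w - cdot (unit_normal \<Gamma> y) w *s cvec (unit_normal \<Gamma> y)"

lemma tangential_part_diff:
  "tangential_part y (v - w) = tangential_part y v - tangential_part y w"
  by (simp add: tangential_part_def cdot_diff_right vec_eq_iff algebra_simps)

lemma tangential_part_fixed: "tangential_at \<Gamma> y w \<Longrightarrow> tangential_part y w = w"
  by (simp add: tangential_part_def tangential_at_iff)

lemma norm_tangential_part:
  assumes "y \<in> \<Gamma>" shows "norm (tangential_part y w) \<le> 4 * norm w"
proof -
  have "norm (tangential_part y w) \<le> norm w + cmod (cdot (unit_normal \<Gamma> y) w) * norm (unit_normal \<Gamma> y)"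
    unfolding tangential_part_def
    using norm_triangle_ineq4[of w "cdot (unit_normal \<Gamma> y) w *s cvec (unit_normal \<Gamma> y)"]
    by (simp add: norm_vector_scalar_mult norm_cvec)
  also have "\<dots> \<le> norm w + 3 * norm w"
    using norm_cdot_le[of "unit_normal \<Gamma> y" w] norm_unit_normal[OF assms] by simp
  finally show ?thesis by simp
qed

text \<open>
  The projection is quadratic in the unit normal, so the choice of its sign does not matter and
  the C1 field \<open>N / J\<close> may be used in each patch.
\<close>

lemma tangential_part_regular:
  assumes h: "C1_on UNIV h"
  shows "(\<lambda>y. tangential_part y (h y)) \<in> regular_tangential_fields \<Gamma>"
  unfolding regular_tangential_fields_def
proof (intro CollectI conjI ballI)
  fix y assume y: "y \<in> \<Gamma>"
  have "unit_normal \<Gamma> y \<bullet> unit_normal \<Gamma> y = 1"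
    using norm_unit_normal[OF y] by (simp add: norm_eq_sqrt_inner)
  then show "tangential_at \<Gamma> y (tangential_part y (h y))"
    by (simp add: tangential_at_iff tangential_part_def cdot_diff_right cdot_mult_right cdot_cvec)
  obtain W q \<gamma> where "graph_patch \<Gamma> W q \<gamma>" and W: "y \<in> W"
    using patches[OF y] by blast
  then interpret graph_patch \<Gamma> W q \<gamma> by blast
  let ?n = "\<lambda>z. N (proj z)" and ?r = "\<lambda>z. inverse (J (proj z) * J (proj z))"
  let ?\<psi> = "\<lambda>z. h z - (?r z *\<^sub>R cdot (?n z) (h z)) *s cvec (?n z)"
  have C1p: "C1_on UNIV (\<lambda>z. f (proj z))" if "C1_on UNIV f" for f :: "real^2 \<Rightarrow> 'b::real_normed_vector"
    by (rule C1_on_compose[OF C1_on_bounded_linear[OF bounded_linear_proj] that]) simp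
  have "J u * J u \<noteq> 0" for u
    using J_pos[of u] by simp
  then have "C1_on UNIV ?\<psi>"
    by (intro C1_on_diff h C1_on_bilinear[OF bounded_bilinear_vector_scalar_mult] C1_on_scaleR
        C1_on_bilinear[OF bounded_bilinear_cdot] C1_on_linear_compose[OF bounded_linear_cvec]
        C1p[OF C1_N] C1_on_inverse C1_on_mult C1p[OF C1_J])
  then have "C1_on W ?\<psi>"
    using C1_on_subset by blast
  moreover have "?\<psi> z = tangential_part z (h z)" if z: "z \<in> W \<inter> \<Gamma>" for z
  proof -
    obtain c where c: "unit_normal \<Gamma> (X (proj z)) = c *\<^sub>R ?n z" "c * c * (J (proj z) * J (proj z)) = 1"
      using unit_normal_patch[OF proj_in] z by blast
    have r: "?r z = c * c"
      using c(2) J_pos[of "proj z"] by (simp add: field_simps)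
    have n: "unit_normal \<Gamma> z = c *\<^sub>R ?n z"
      using c(1) X_proj z by auto
    have cv: "cvec (c *\<^sub>R v) = of_real c *s cvec v" for v
      by (simp add: cvec_def vec_eq_iff)
    show ?thesis
      unfolding tangential_part_def n r cv cdot_scaleR_left
      by (simp add: vec_eq_iff scaleR_conv_of_real[where 'a=complex] algebra_simps)
  qed
  ultimately show "\<exists>U \<psi>. open U \<and> y \<in> U \<and> C1_on U \<psi> \<and> (\<forall>z\<in>U \<inter> \<Gamma>. \<psi> z = tangential_part z (h z))"
    using open_W W by blast
qed

lemma regular_fields_in_Lp:
  assumes p: "p \<ge> 1" shows "regular_tangential_fields \<Gamma> \<subseteq> Lp_fields \<Gamma> p"
proof
  fix \<phi> assume \<phi>: "\<phi> \<in> regular_tangential_fields \<Gamma>"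
  note c = regular_field_continuous[OF \<phi>]
  have "continuous_on \<Gamma> (\<lambda>y. norm (\<phi> y) powr p)"
    by (rule continuous_on_powr') (use p c in \<open>auto intro!: continuous_intros\<close>)
  then show "\<phi> \<in> Lp_fields \<Gamma> p"
    using \<phi> continuous_on_imp_measurable_S[OF c] continuous_on_imp_integrable_S
    by (auto simp: Lp_fields_def regular_tangential_fields_def intro!: AE_I2)
qed

text \<open>
  Truncate \<open>f\<close> to a bounded field, approximate that by a C1 field, and project the result to the tangent
  planes: the projection fixes the truncated field almost everywhere and enlarges the error at
  most by a constant factor.
\<close>

lemma regular_fields_dense:
  assumes p: "p \<ge> 1" shows "Lp_dense \<Gamma> p (regular_tangential_fields \<Gamma>)"
  unfolding Lp_dense_def
proof (intro conjI ballI allI impI regular_fields_in_Lp[OF p])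
  interpret finite_measure S by (rule finite_measure_S)
  fix f and \<epsilon> :: real assume f: "f \<in> Lp_fields \<Gamma> p" and \<epsilon>: "\<epsilon> > 0"
  have [measurable]: "f \<in> borel_measurable S" and int: "integrable S (\<lambda>y. norm (f y) powr p)"
    and tan: "AE y in S. tangential_at \<Gamma> y (f y)"
    using f by (auto simp: Lp_fields_def)
  define t where "t n y = (if norm (f y) \<le> real n then f y else 0)" for n y
  have tm [measurable]: "t n \<in> borel_measurable S" for n
    unfolding t_def[abs_def] by measurable
  \<comment> \<open>chosen so that the two errors add up to \<open>\<epsilon>\<^sup>p\<close> after \<open>(a + b)\<^sup>p \<le> 2\<^sup>p (a\<^sup>p + b\<^sup>p)\<close>\<close>
  define \<eta> where "\<eta> = \<epsilon> powr p / (2 powr p * (1 + 4 powr p))"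
  have den: "2 powr p * (1 + 4 powr p) > 0"
    by (simp add: add_pos_nonneg)
  have \<eta>: "\<eta> > 0"
    using den \<epsilon> by (simp add: \<eta>_def)
  have "(\<lambda>n. LINT y|S. norm (f y - t n y) powr p) \<longlonglongrightarrow> (LINT y|S. 0)"
  proof (rule integral_dominated_convergence[where w = "\<lambda>y. norm (f y) powr p"])
    show "(\<lambda>y. norm (f y - t n y) powr p) \<in> borel_measurable S" for n
      by measurable
    show "AE y in S. (\<lambda>n. norm (f y - t n y) powr p) \<longlonglongrightarrow> 0"
    proof (rule AE_I2)
      fix y
      obtain m where m: "norm (f y) \<le> real m"
        using real_arch_simple by blast
      have "norm (f y - t n y) powr p = 0" if "n \<ge> m" for n
        using m that by (simp add: t_def)
      then show "(\<lambda>n. norm (f y - t n y) powr p) \<longlonglongrightarrow> 0"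
        by (intro tendsto_eventually) (auto simp: eventually_sequentially)
    qed
    show "AE y in S. norm (norm (f y - t n y) powr p) \<le> norm (f y) powr p" for n
      by (rule AE_I2) (simp add: t_def)
  qed (use int in auto)
  then have "eventually (\<lambda>n. (LINT y|S. norm (f y - t n y) powr p) < \<eta>) sequentially"
    using \<eta> by (intro order_tendstoD(2)[where y = 0]) auto
  then obtain n where n: "(LINT y|S. norm (f y - t n y) powr p) < \<eta>"
    by (auto simp: eventually_sequentially)
  obtain h where h: "C1_on UNIV h" "(LINT y|S. norm (t n y - h y) powr p) < \<eta>"
  proof -
    have "norm (t n y) \<le> real n" for y
      by (simp add: t_def)
    from C1_dense_bounded[OF tm this of_nat_0_le_iff p \<eta>] show ?thesis
      using that by blast
  qed
  define \<phi> where "\<phi> y = tangential_part y (h y)" for y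
  have \<phi>: "\<phi> \<in> regular_tangential_fields \<Gamma>"
    unfolding \<phi>_def[abs_def] by (rule tangential_part_regular[OF h(1)])
  have \<phi>m [measurable]: "\<phi> \<in> borel_measurable S"
    by (rule continuous_on_imp_measurable_S[OF regular_field_continuous[OF \<phi>]])
  have [measurable]: "h \<in> borel_measurable S"
    by (rule continuous_on_imp_measurable_S)
      (rule continuous_on_subset[OF C1_on_imp_continuous_on[OF h(1)] subset_UNIV])
  have int1: "integrable S (\<lambda>y. norm (f y - t n y) powr p)"
    by (rule Bochner_Integration.integrable_bound[OF int]) (auto simp: t_def intro!: AE_I2)
  have int2: "integrable S (\<lambda>y. norm (t n y - h y) powr p)"
  proof -
    have "bounded (h ` \<Gamma>)"
      by (intro compact_imp_bounded compact_continuous_image compact_surface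
          continuous_on_subset[OF C1_on_imp_continuous_on[OF h(1)]]) simp
    then obtain B where B: "\<And>y. y \<in> \<Gamma> \<Longrightarrow> norm (h y) \<le> B"
      by (auto simp: bounded_iff)
    show ?thesis
    proof (rule integrable_const_bound[of _ "(real n + B) powr p"])
      show "AE y in S. norm (norm (t n y - h y) powr p) \<le> (real n + B) powr p"
      proof (rule AE_I2)
        fix y assume "y \<in> space S"
        then have "norm (t n y - h y) \<le> real n + B"
          using B[of y] norm_triangle_ineq4[of "t n y" "h y"] by (auto simp: t_def split: if_splits)
        then show "norm (norm (t n y - h y) powr p) \<le> (real n + B) powr p"
          using p by (simp add: powr_mono2)
      qed
    qed measurable
  qed
  have bound: "AE y in S. norm (f y - \<phi> y) powr p
      \<le> 2 powr p * (norm (f y - t n y) powr p + 4 powr p * norm (t n y - h y) powr p)"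
    using tan AE_space
  proof eventually_elim
    case (elim y)
    have "tangential_at \<Gamma> y (t n y)"
      using elim(1) by (simp add: t_def tangential_at_def)
    then have "t n y = tangential_part y (t n y)"
      by (simp add: tangential_part_fixed)
    then have "t n y - \<phi> y = tangential_part y (t n y - h y)"
      by (simp add: \<phi>_def tangential_part_diff)
    then have "norm (t n y - \<phi> y) \<le> 4 * norm (t n y - h y)"
      using norm_tangential_part[of y] elim(2) by simp
    then have "norm (f y - \<phi> y) \<le> norm (f y - t n y) + 4 * norm (t n y - h y)"
      using norm_triangle_ineq[of "f y - t n y" "t n y - \<phi> y"] by simp
    then have "norm (f y - \<phi> y) powr p \<le> (norm (f y - t n y) + 4 * norm (t n y - h y)) powr p"
      using p by (intro powr_mono2) auto
    also have "\<dots> \<le> 2 powr p * (norm (f y - t n y) powr p + (4 * norm (t n y - h y)) powr p)"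
      using p by (intro powr_add_le) auto
    finally show ?case
      by (simp add: powr_mult)
  qed
  have "(LINT y|S. norm (f y - \<phi> y) powr p)
      \<le> (LINT y|S. 2 powr p * (norm (f y - t n y) powr p + 4 powr p * norm (t n y - h y) powr p))"
    (is "_ \<le> integral\<^sup>L S ?b")
  proof (rule integral_mono_AE[OF _ _ bound])
    show b: "integrable S ?b"
      using int1 int2 by auto
    show "integrable S (\<lambda>y. norm (f y - \<phi> y) powr p)"
      by (rule Bochner_Integration.integrable_bound[OF b]) (use bound in \<open>auto elim!: eventually_mono\<close>)
  qed
  also have "\<dots> = 2 powr p * ((LINT y|S. norm (f y - t n y) powr p)
      + 4 powr p * (LINT y|S. norm (t n y - h y) powr p))"
    using int1 int2 by simp
  also have "\<dots> < 2 powr p * (\<eta> + 4 powr p * \<eta>)"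
    using n h(2) by (intro mult_strict_left_mono add_strict_mono) auto
  also have "\<dots> = \<epsilon> powr p"
  proof -
    have "\<eta> * (2 powr p * (1 + 4 powr p)) = \<epsilon> powr p"
      using den unfolding \<eta>_def by (rule nonzero_eq_divide_eq[THEN iffD1, OF less_imp_neq[THEN not_sym] refl])
    then show ?thesis
      by (simp add: algebra_simps)
  qed
  finally have "(LINT y|S. norm (f y - \<phi> y) powr p) < \<epsilon> powr p" .
  then have "Lp_norm \<Gamma> p (\<lambda>y. f y - \<phi> y) < (\<epsilon> powr p) powr (1 / p)"
    unfolding Lp_norm_def using p by (intro powr_less_mono2) auto
  also have "\<dots> = \<epsilon>"
    using p \<epsilon> by (simp add: powr_powr)
  finally show "\<exists>\<phi>\<in>regular_tangential_fields \<Gamma>. Lp_norm \<Gamma> p (\<lambda>y. f y - \<phi> y) < \<epsilon>"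
    using \<phi> by blast
qed

text \<open>
  The extension is given by the same integral: linearity and the bound come from the kernel, and
  agreement on regular fields is the integral representation of the potential.
\<close>

lemma layer_extension:
  fixes L :: "(real^3 \<Rightarrow> complex^3) \<Rightarrow> complex^3"
  assumes p: "p \<ge> 1" and d: "d > 0" "\<And>y. y \<in> \<Gamma> \<Longrightarrow> d \<le> norm (x - y)"
    and K: "continuous_on ((- {0}) \<times> UNIV) (\<lambda>q. K (fst q) (snd q))"
      "\<And>v w w'. K v (w + w') = K v w + K v w'" "\<And>v c w. K v (c *s w) = c *s K v w"
    and bound: "\<And>v w. d \<le> norm v \<Longrightarrow> norm (K v w) \<le> A * norm w" and A: "A \<ge> 0"
    and L: "\<And>\<phi>. \<phi> \<in> regular_tangential_fields \<Gamma> \<Longrightarrow> L \<phi> = (LINT y|S. K (x - y) (\<phi> y))"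
    and B: "(1 + measure S \<Gamma>) * A \<le> B"
  shows "\<exists>T. bounded_linear_Lp \<Gamma> p T \<and> (\<forall>\<phi>\<in>regular_tangential_fields \<Gamma>. T \<phi> = L \<phi>) \<and>
     (\<forall>f\<in>Lp_fields \<Gamma> p. norm (T f) \<le> B * Lp_norm \<Gamma> p f)"
proof (intro exI conjI ballI)
  let ?T = "\<lambda>f. LINT y|S. K (x - y) (f y)"
  show "bounded_linear_Lp \<Gamma> p ?T"
    by (rule kernel_operator(1)[OF p d K bound A])
  show "?T \<phi> = L \<phi>" if "\<phi> \<in> regular_tangential_fields \<Gamma>" for \<phi>
    using L[OF that] by simp
  show "norm (?T f) \<le> B * Lp_norm \<Gamma> p f" if "f \<in> Lp_fields \<Gamma> p" for f
    using kernel_operator(2)[OF p d K bound A that] mult_right_mono[OF B Lp_norm_nonneg, of p f]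
    by linarith
qed

end

theorem lemma4:
  fixes \<Omega> \<Gamma> :: "(real^3) set" and x :: "real^3" and d :: real
  assumes "exterior_domain \<Omega>" and "C2_boundary \<Omega>" and "\<Gamma> = frontier \<Omega>"
    and "x \<in> \<Omega>" and "d = infdist x \<Gamma>" and "d > 0"
  shows "(\<forall>\<sigma>>0. \<exists>C>0. \<forall>s p. Re s > 0 \<longrightarrow> cmod s \<ge> \<sigma> \<longrightarrow> 1 \<le> p \<longrightarrow>
            (\<forall>\<phi>\<in>regular_tangential_fields \<Gamma>.
               norm (single_layer \<Gamma> s \<phi> x) \<le> C * cmod s * exp (- d * Re s) * Lp_norm \<Gamma> p \<phi> \<and>
               norm (double_layer \<Gamma> s \<phi> x) \<le> C * cmod s * exp (- d * Re s) * Lp_norm \<Gamma> p \<phi>) \<and>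
            (\<exists>S\<^sub>x. bounded_linear_Lp \<Gamma> p S\<^sub>x \<and>
               (\<forall>\<phi>\<in>regular_tangential_fields \<Gamma>. S\<^sub>x \<phi> = single_layer \<Gamma> s \<phi> x) \<and>
               (\<forall>f\<in>Lp_fields \<Gamma> p. norm (S\<^sub>x f) \<le> C * cmod s * exp (- d * Re s) * Lp_norm \<Gamma> p f)) \<and>
            (\<exists>D\<^sub>x. bounded_linear_Lp \<Gamma> p D\<^sub>x \<and>
               (\<forall>\<phi>\<in>regular_tangential_fields \<Gamma>. D\<^sub>x \<phi> = double_layer \<Gamma> s \<phi> x) \<and>
               (\<forall>f\<in>Lp_fields \<Gamma> p. norm (D\<^sub>x f) \<le> C * cmod s * exp (- d * Re s) * Lp_norm \<Gamma> p f)))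
         \<and> (\<forall>p\<ge>1. Lp_dense \<Gamma> p (regular_tangential_fields \<Gamma>))"
proof (intro conjI allI impI, goal_cases)
  interpret compact_C2_surface \<Gamma>
    using exterior_domain_compact_C2_surface assms(1-3) by blast
  case (2 p)
  then show ?case
    by (rule regular_fields_dense)
next
  interpret compact_C2_surface \<Gamma>
    using exterior_domain_compact_C2_surface assms(1-3) by blast
  case (1 \<sigma>)
  note \<sigma> = this
  have x: "x \<notin> \<Gamma>"
    using exterior_domain_open[OF assms(1)] assms(3,4) by (simp add: frontier_def interior_open)
  have dist: "d \<le> norm (x - y)" if "y \<in> \<Gamma>" for y
    using infdist_le[OF that, of x] assms(5) by (simp add: dist_norm)
  \<comment> \<open>the constants of the two kernel bounds, times the constant of the embedding of \<open>L\<^sup>p\<close> into \<open>L\<^sup>1\<close>\<close>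
  define m where "m = 1 + measure S \<Gamma>"
  define a b where "a = 4 / d + 10 / (\<sigma> * d ^ 2) + 10 / (\<sigma> ^ 2 * d ^ 3)" and "b = 6 / d + 6 / (\<sigma> * d ^ 2)"
  have pos: "m > 0" "a > 0" "b > 0"
    using \<sigma> assms(6) by (simp_all add: m_def a_def b_def add_pos_nonneg add_pos_pos)
  define C where "C = m * (a + b)"
  have C: "C > 0" "m * a \<le> C" "m * b \<le> C"
    using pos by (auto simp: C_def)
  let ?ext = "\<lambda>L s p T. bounded_linear_Lp \<Gamma> p T \<and> (\<forall>\<phi>\<in>regular_tangential_fields \<Gamma>. T \<phi> = L \<Gamma> s \<phi> x) \<and>
      (\<forall>f\<in>Lp_fields \<Gamma> p. norm (T f) \<le> C * cmod s * exp (- d * Re s) * Lp_norm \<Gamma> p f)"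
  have enlarge: "m * (k * cmod s * exp (- d * Re s)) \<le> C * cmod s * exp (- d * Re s)" if "m * k \<le> C" for k s
    using mult_right_mono[OF that, of "cmod s * exp (- d * Re s)"] by (simp add: mult.assoc)
  have single: "\<exists>T. ?ext single_layer s p T"
    if s: "Re s > 0" "cmod s \<ge> \<sigma>" and p: "1 \<le> p" for s p
    by (rule layer_extension[OF p assms(6) dist continuous_on_single_kernel single_kernel_add
          single_kernel_mult norm_single_kernel[OF s \<sigma> assms(6)] _ single_layer_eq[OF x]])
      (use enlarge[OF C(2), of s] pos in \<open>simp_all add: m_def a_def[symmetric]\<close>)
  have double: "\<exists>T. ?ext double_layer s p T"
    if s: "Re s > 0" "cmod s \<ge> \<sigma>" and p: "1 \<le> p" for s p
    by (rule layer_extension[OF p assms(6) dist continuous_on_double_kernel double_kernel_add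
          double_kernel_mult norm_double_kernel[OF s \<sigma> assms(6)] _ double_layer_eq[OF x]])
      (use enlarge[OF C(3), of s] pos in \<open>simp_all add: m_def b_def[symmetric]\<close>)
  \<comment> \<open>regular fields are in \<open>L\<^sup>p\<close>, so the bounds for the potentials are those of the extensions\<close>
  have pointwise: "norm (L \<Gamma> s \<phi> x) \<le> C * cmod s * exp (- d * Re s) * Lp_norm \<Gamma> p \<phi>"
    if "\<exists>T. ?ext L s p T" "1 \<le> p" "\<phi> \<in> regular_tangential_fields \<Gamma>" for L s p \<phi>
    using that regular_fields_in_Lp by (metis subsetD)
  show ?case
  proof (intro exI[of _ C] conjI allI impI C(1), goal_cases)
    case (1 s p)
    then show ?case
      using pointwise[where L=single_layer and s=s and p=p] pointwise[where L=double_layer and s=s and p=p]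
        single[of s p] double[of s p] by blast
  next
    case (2 s p)
    then show ?case by (rule single)
  next
    case (3 s p)
    then show ?case by (rule double)
  qed
qed

end
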